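(* (i) A function $f$ belongs to $\mathcal S$ if and only if it has an expansion $$f(x_0,p,\underline\omega)=\sum_{j\in\mathbb Z,\,k\in\mathbb N_0}(x_0+\underline\omega p)^j\,\underline\omega^k\,P_{k,j}(\underline\omega)$$ for some $k$-homogeneous monogenic polynomials $P_{k,j}:\mathbb R^n\to\mathbb R_n$ such that for each $m\in\mathbb N_0$ and each $a>0$ there is $C>0$ with $\|P_{k,j}\|\le C\,a^{|j|}(k+1)^{-m}$ for all $k\in\mathbb N_0$, $j\in\mathbb Z$ (here $\|\cdot\|$ is $\|\cdot\|_{L_2}$ or $\|\cdot\|_\infty$ on $S^{n-1}$); this expansion is unique. (ii) Moreover, $f$ belongs to $\mathcal S_0$ (resp. $\mathcal S_\infty$) if and only if its expansion as in (i) has $P_{k,j}=0$ unless $j\ge0$ (resp. unless $j<0$). In particular $\mathcal S=\mathcal S_0\oplus\mathcal S_\infty$ and $\mathcal S_\infty=I_2(\mathcal S_0)$.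
   Context: $\mathbb R_n$ is the real Clifford algebra generated by $e_1,\dots,e_n$ with $e_ie_j+e_je_i=-2\delta_{ij}$; $|\cdot|$ its Euclidean norm; $S^{n-1}=\{\underline\omega=\sum\omega_je_j:\sum\omega_j^2=1\}$. A smooth $f:U\times S^{n-1}\to\mathbb R_n$ ($U\subseteq\mathbb R^2$ open, variables $(x_0,p,\underline\omega)$) is slice monogenic if $\frac12(\partial_{x_0}+\underline\omega\partial_p)f=0$ for every $\underline\omega$; even if $f(x_0,-p,-\underline\omega)=f(x_0,p,\underline\omega)$. $\mathcal S$: right $\mathbb R_n$-module of even slice monogenic functions on $(\mathbb R^2\setminus\{0\})\times S^{n-1}$; $\mathcal S_0$: those extending analytically to $\mathbb R^2\times S^{n-1}$; $\mathcal S_\infty$: those extending analytically at $\infty$ (regular at infinity and tending to $0$ as $x_0^2+p^2\to\infty$). $I_2f(x_0,p,\underline\omega)=\frac{x_0-\underline\omega p}{x_0^2+p^2}f\big(\frac{x_0}{x_0^2+p^2},\frac{-p}{x_0^2+p^2},\underline\omega\big)$. A $k$-homogeneous monogenic polynomial is a homogeneous polynomial $P:\mathbb R^n\to\mathbb R_n$ of degree $k$ with $\sum_je_j\partial_{x_j}P=0$. $\|g\|_{L_2}^2=\frac1{A_n}\int_{S^{n-1}}|g|^2d\underline\omega$, $\|g\|_\infty=\sup_{S^{n-1}}|g|$. *)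

theory Defs
  imports "HOL-Analysis.Analysis"
begin

text \<open>The generators are indexed by a finite linearly ordered type 'n (so n = CARD('n)).
  An element of R_n is represented by its coordinates with respect to the basis of
  blades e_A (A a subset of the generators), i.e. as a vector in real^('n set).
  The Euclidean norm of this vector is the Euclidean norm of R_n.\<close>

type_synonym 'n clif = "real ^ ('n set)"

definition blade_sign :: "'n::{finite,linorder} set \<Rightarrow> 'n set \<Rightarrow> real" where
  "blade_sign A B = (-1) ^ (card {(a, b). a \<in> A \<and> b \<in> B \<and> b < a} + card (A \<inter> B))"

definition cl_mult :: "'n::{finite,linorder} clif \<Rightarrow> 'n clif \<Rightarrow> 'n clif" (infixl "\<star>" 70) where
  "x \<star> y = (\<chi> C. \<Sum>A\<in>UNIV. \<Sum>B\<in>UNIV.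
       if (A - B) \<union> (B - A) = C then blade_sign A B * (x $ A) * (y $ B) else 0)"

definition cl_one :: "'n::{finite,linorder} clif" where
  "cl_one = (\<chi> A. if A = {} then 1 else 0)"

definition cl_e :: "'n::{finite,linorder} \<Rightarrow> 'n clif" where
  "cl_e i = (\<chi> A. if A = {i} then 1 else 0)"

definition cl_vec :: "(real ^ ('n::{finite,linorder})) \<Rightarrow> 'n clif" where
  "cl_vec w = (\<Sum>i\<in>UNIV. (w $ i) *\<^sub>R cl_e i)"

primrec cl_pow :: "'n::{finite,linorder} clif \<Rightarrow> nat \<Rightarrow> 'n clif" where
  "cl_pow x 0 = cl_one"
| "cl_pow x (Suc k) = x \<star> cl_pow x k"

definition cl_inv :: "'n::{finite,linorder} clif \<Rightarrow> 'n clif" where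
  "cl_inv x = (THE y. x \<star> y = cl_one \<and> y \<star> x = cl_one)"

definition cl_zpow :: "'n::{finite,linorder} clif \<Rightarrow> int \<Rightarrow> 'n clif" where
  "cl_zpow x j = (if 0 \<le> j then cl_pow x (nat j) else cl_pow (cl_inv x) (nat (- j)))"

definition para :: "real \<Rightarrow> real \<Rightarrow> (real ^ ('n::{finite,linorder})) \<Rightarrow> 'n clif" where
  "para x0 p w = x0 *\<^sub>R cl_one + p *\<^sub>R cl_vec w"

fun smooth_k :: "nat \<Rightarrow> 'a::euclidean_space set \<Rightarrow> ('a \<Rightarrow> 'b::euclidean_space) \<Rightarrow> bool" where
  "smooth_k 0 S f = continuous_on S f"
| "smooth_k (Suc k) S f = (f differentiable_on S \<and>
      (\<forall>v\<in>Basis. smooth_k k S (\<lambda>x. frechet_derivative f (at x) v)))"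

definition smooth_on :: "'a::euclidean_space set \<Rightarrow> ('a \<Rightarrow> 'b::euclidean_space) \<Rightarrow> bool" where
  "smooth_on S f = (\<forall>k. smooth_k k S f)"

definition sdom :: "(real \<times> real) set \<Rightarrow> (real \<times> real \<times> (real ^ 'n)) set" where
  "sdom U = {(x0, p, w). (x0, p) \<in> U \<and> w \<in> sphere 0 1}"

definition smooth_on_sdom ::
  "(real \<times> real) set \<Rightarrow> (real \<times> real \<times> (real ^ ('n::{finite,linorder})) \<Rightarrow> 'n clif) \<Rightarrow> bool" where
  "smooth_on_sdom U f = (\<exists>W F. open W \<and> sdom U \<subseteq> W \<and> smooth_on W F \<and> (\<forall>z\<in>sdom U. F z = f z))"

definition slice_monogenic ::
  "(real \<times> real) set \<Rightarrow> (real \<times> real \<times> (real ^ ('n::{finite,linorder})) \<Rightarrow> 'n clif) \<Rightarrow> bool" where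
  "slice_monogenic U f = (open U \<and> smooth_on_sdom U f \<and>
     (\<forall>x0 p w. (x0, p) \<in> U \<and> w \<in> sphere 0 1 \<longrightarrow>
        (\<exists>D0 Dp. ((\<lambda>t. f (t, p, w)) has_vector_derivative D0) (at x0) \<and>
                 ((\<lambda>t. f (x0, t, w)) has_vector_derivative Dp) (at p) \<and>
                 (1/2) *\<^sub>R (D0 + cl_vec w \<star> Dp) = 0)))"

abbreviation punct :: "(real \<times> real) set" where
  "punct \<equiv> UNIV - {(0, 0)}"

definition in_S :: "(real \<times> real \<times> (real ^ ('n::{finite,linorder})) \<Rightarrow> 'n clif) \<Rightarrow> bool" where
  "in_S f = (slice_monogenic punct f \<and>
     (\<forall>x0 p w. (x0, p) \<noteq> (0, 0) \<and> w \<in> sphere 0 1 \<longrightarrow> f (x0, -p, -w) = f (x0, p, w)))"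

definition in_S0 :: "(real \<times> real \<times> (real ^ ('n::{finite,linorder})) \<Rightarrow> 'n clif) \<Rightarrow> bool" where
  "in_S0 f = (in_S f \<and> (\<exists>g. slice_monogenic UNIV g \<and>
     (\<forall>x0 p w. (x0, p) \<noteq> (0, 0) \<and> w \<in> sphere 0 1 \<longrightarrow> g (x0, p, w) = f (x0, p, w))))"

definition in_Sinf :: "(real \<times> real \<times> (real ^ ('n::{finite,linorder})) \<Rightarrow> 'n clif) \<Rightarrow> bool" where
  "in_Sinf f = (in_S f \<and>
     (\<exists>g. slice_monogenic UNIV g \<and>
        (\<forall>x0 p w. (x0, p) \<noteq> (0, 0) \<and> w \<in> sphere 0 1 \<longrightarrow>
           g (x0, p, w) = f (x0 / (x0\<^sup>2 + p\<^sup>2), - p / (x0\<^sup>2 + p\<^sup>2), w))) \<and>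
     (\<forall>\<epsilon>>0. \<exists>R. \<forall>x0 p w. x0\<^sup>2 + p\<^sup>2 \<ge> R \<and> w \<in> sphere 0 1 \<longrightarrow> norm (f (x0, p, w)) < \<epsilon>))"

definition I2 :: "(real \<times> real \<times> (real ^ ('n::{finite,linorder})) \<Rightarrow> 'n clif) \<Rightarrow> (real \<times> real \<times> (real, 'n) vec \<Rightarrow> 'n clif)" where
  "I2 f = (\<lambda>(x0, p, w). ((1 / (x0\<^sup>2 + p\<^sup>2)) *\<^sub>R (x0 *\<^sub>R cl_one - p *\<^sub>R cl_vec w))
             \<star> f (x0 / (x0\<^sup>2 + p\<^sup>2), - p / (x0\<^sup>2 + p\<^sup>2), w))"

definition hom_poly :: "nat \<Rightarrow> ((real ^ ('n::{finite,linorder})) \<Rightarrow> 'n clif) \<Rightarrow> bool" where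
  "hom_poly k P = (\<exists>c :: ('n \<Rightarrow> nat) \<Rightarrow> 'n clif. \<forall>x.
      P x = (\<Sum>\<alpha>\<in>{\<alpha>. sum \<alpha> UNIV = k}. (\<Prod>i\<in>UNIV. (x $ i) ^ \<alpha> i) *\<^sub>R c \<alpha>))"

definition monogenic_hom :: "nat \<Rightarrow> ((real ^ ('n::{finite,linorder})) \<Rightarrow> 'n clif) \<Rightarrow> bool" where
  "monogenic_hom k P = (hom_poly k P \<and>
      (\<forall>x. (\<Sum>i\<in>UNIV. cl_e i \<star> frechet_derivative P (at x) (axis i 1)) = 0))"

definition sup_norm_S :: "((real ^ ('n::{finite,linorder})) \<Rightarrow> 'n clif) \<Rightarrow> real" where
  "sup_norm_S g = Sup ((\<lambda>w. norm (g w)) ` sphere 0 1)"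

text \<open>Normalised L2 norm on S^{n-1}: (1/A_n) int_{S^{n-1}} |g|^2 equals the average over the
  unit ball of |g(x/|x|)|^2 (cone construction of the surface measure).\<close>
definition L2_norm_S :: "((real ^ ('n::{finite,linorder})) \<Rightarrow> 'n clif) \<Rightarrow> real" where
  "L2_norm_S g = sqrt ((integral\<^sup>L lborel (\<lambda>x. indicator (ball 0 1) x * (norm (g ((1 / norm x) *\<^sub>R x)))\<^sup>2))
                      / measure lborel (ball (0 :: (real, 'n) vec) 1))"

definition exp_term :: "(nat \<Rightarrow> int \<Rightarrow> (real ^ ('n::{finite,linorder})) \<Rightarrow> 'n clif)
     \<Rightarrow> real \<Rightarrow> real \<Rightarrow> (real, 'n) vec \<Rightarrow> int \<times> nat \<Rightarrow> 'n clif" where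
  "exp_term P x0 p w = (\<lambda>(j, k). cl_zpow (para x0 p w) j \<star> (cl_pow (cl_vec w) k \<star> P k j w))"

definition is_expansion ::
  "(((real ^ ('n::{finite,linorder})) \<Rightarrow> 'n clif) \<Rightarrow> real)
   \<Rightarrow> (real \<times> real \<times> (real, 'n) vec \<Rightarrow> 'n clif) \<Rightarrow> (nat \<Rightarrow> int \<Rightarrow> (real, 'n) vec \<Rightarrow> 'n clif) \<Rightarrow> bool" where
  "is_expansion N f P = ((\<forall>k j. monogenic_hom k (P k j)) \<and>
     (\<forall>m::nat. \<forall>a>0. \<exists>C>0. \<forall>k j. N (P k j) \<le> C * a ^ nat \<bar>j\<bar> / (real k + 1) ^ m) \<and>
     (\<forall>x0 p w. (x0, p) \<noteq> (0, 0) \<and> w \<in> sphere 0 1 \<longrightarrow>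
        (exp_term P x0 p w has_sum f (x0, p, w)) UNIV))"

end

theory Submission
  imports Defs "HOL-Complex_Analysis.Complex_Residues"
begin

text \<open>On a fixed sphere direction $\underline\omega$, left multiplication by $\underline\omega$ is a complex
  structure on the Clifford algebra, so the slice equation is a Cauchy--Riemann equation: $f$ has a Laurent series
  $\sum_j (x_0+\underline\omega p)^j a_j(\underline\omega)$ with $a_j$ given by Fourier integrals over circles, which
  by Cauchy's theorem scale as $r^j$ with the radius $r$.
  The even functions $a_j$ on the sphere are expanded through the spherical Dirac operator: it is symmetric, for
  monogenic $P_k$ the functions $P_k$ and $\underline\omega P_k$ are its eigenfunctions, and they are complete by the
  Fischer decomposition and the Stone--Weierstrass theorem. Symmetry gives orthogonality, and moving $m$ powers of the
  operator onto $f$ gives the decay $(k+1)^{-m}$ of the components of $a_j$; evenness of $f$ leaves only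
  $\underline\omega^k P_k$.
  Conversely, a Markov inequality for homogeneous polynomials bounds the derivatives of each term polynomially in $k$,
  so rapidly decreasing expansions may be differentiated termwise.
  Extension to $0$ is read off from Cauchy's estimate on small circles, and $\infty$ is reduced to $0$ by inversion,
  which reverses the order of the coefficients.\<close>

section \<open>The Clifford algebra\<close>

lemma blade_sign_eq_prod:
  "blade_sign A B = (\<Prod>a\<in>A. \<Prod>b\<in>B. if b \<le> a then -1 else 1)"
proof -
  have "(\<Prod>a\<in>A. \<Prod>b\<in>B. if b \<le> a then -1 else 1::real)
      = (\<Prod>x\<in>A \<times> B. if snd x \<le> fst x then -1 else 1)"
    by (simp add: prod.cartesian_product split_def)
  also have "\<dots> = (-1) ^ card ((A \<times> B) \<inter> {x. snd x \<le> fst x})"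
    by (subst prod.If_cases) auto
  also have "(A \<times> B) \<inter> {x. snd x \<le> fst x}
      = {(a, b). a \<in> A \<and> b \<in> B \<and> b < a} \<union> (\<lambda>x. (x, x)) ` (A \<inter> B)"
    by auto
  also have "card \<dots> = card {(a, b). a \<in> A \<and> b \<in> B \<and> b < a} + card ((\<lambda>x. (x, x)) ` (A \<inter> B))"
    by (rule card_Un_disjoint) auto
  also have "card ((\<lambda>x. (x, x)) ` (A \<inter> B)) = card (A \<inter> B)"
    by (rule card_image) (auto simp: inj_on_def)
  finally show ?thesis by (simp add: blade_sign_def)
qed

lemma prod_sym_diff:
  fixes g :: "'a::finite \<Rightarrow> real"
  assumes "\<And>a. g a * g a = 1"
  shows "prod g (sym_diff A B) = prod g A * prod g B"
proof -
  have "prod g A * prod g B = (prod g (A - B) * prod g (A \<inter> B)) * (prod g (B - A) * prod g (A \<inter> B))"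
    using prod.Int_Diff[of A g B] prod.Int_Diff[of B g A] by (simp add: Int_commute mult.commute)
  also have "\<dots> = prod g (A - B) * prod g (B - A) * prod (\<lambda>a. g a * g a) (A \<inter> B)"
    by (simp add: prod.distrib)
  also have "\<dots> = prod g (sym_diff A B)"
    by (subst prod.union_disjoint) (auto simp: assms)
  finally show ?thesis by simp
qed

lemma blade_sign_sym_diff_left: "blade_sign (sym_diff A B) C = blade_sign A C * blade_sign B C"
  unfolding blade_sign_eq_prod
  by (rule prod_sym_diff) (auto simp: prod.distrib[symmetric] intro!: prod.neutral)

lemma blade_sign_sym_diff_right: "blade_sign A (sym_diff B C) = blade_sign A B * blade_sign A C"
proof -
  have "blade_sign A (sym_diff B C)
      = (\<Prod>a\<in>A. (\<Prod>b\<in>B. if b \<le> a then -1 else 1) * (\<Prod>b\<in>C. if b \<le> a then -1 else 1))"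
    unfolding blade_sign_eq_prod by (intro prod.cong refl prod_sym_diff) auto
  then show ?thesis by (simp add: blade_sign_eq_prod prod.distrib)
qed

lemma blade_sign_square: "blade_sign A B * blade_sign A B = 1"
  by (simp add: blade_sign_def flip: power_mult_distrib)

lemma sym_diff_cancel: "sym_diff A (sym_diff A B) = B"
  by auto

lemma bij_sym_diff: "bij (sym_diff A)"
  by (rule o_bij[of "sym_diff A"]) (auto simp: fun_eq_iff)

lemma cl_mult_nth:
  "(x \<star> y) $ C = (\<Sum>A\<in>UNIV. blade_sign A (sym_diff A C) * x $ A * y $ sym_diff A C)"
proof -
  have "(\<Sum>B\<in>UNIV. if sym_diff A B = C then blade_sign A B * x $ A * y $ B else 0)
      = blade_sign A (sym_diff A C) * x $ A * y $ sym_diff A C" for A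
  proof -
    have solve_iff: "(sym_diff A B = C) = (B = sym_diff A C)" for B by auto
    show ?thesis unfolding solve_iff by simp
  qed
  then show ?thesis by (simp add: cl_mult_def)
qed

lemma cl_mult_assoc: "(x \<star> y) \<star> z = x \<star> (y \<star> z)"
proof (rule vec_eq_iff[THEN iffD2], rule allI)
  fix D
  have regroup: "a * (b * x * y) * z = c * x * (d * y * z)" if "a * b = c * d" for a b c d x y z :: real
  proof -
    have "a * (b * x * y) * z = (a * b) * (x * y * z)" by simp
    then show ?thesis unfolding that by simp
  qed
  have "((x \<star> y) \<star> z) $ D = (\<Sum>E\<in>UNIV. \<Sum>A\<in>UNIV. blade_sign E (sym_diff E D)
      * (blade_sign A (sym_diff A E) * x $ A * y $ sym_diff A E) * z $ sym_diff E D)"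
    by (simp add: cl_mult_nth sum_distrib_left sum_distrib_right mult_ac)
  also have "\<dots> = (\<Sum>A\<in>UNIV. \<Sum>E\<in>UNIV. blade_sign E (sym_diff E D)
      * (blade_sign A (sym_diff A E) * x $ A * y $ sym_diff A E) * z $ sym_diff E D)"
    by (rule sum.swap)
  also have "\<dots> = (\<Sum>A\<in>UNIV. \<Sum>B\<in>UNIV. blade_sign (sym_diff A B) (sym_diff (sym_diff A B) D)
      * (blade_sign A (sym_diff A (sym_diff A B)) * x $ A * y $ sym_diff A (sym_diff A B))
      * z $ sym_diff (sym_diff A B) D)"
    by (intro sum.cong refl sum.reindex_bij_betw[symmetric] bij_sym_diff)
  also have "\<dots> = (\<Sum>A\<in>UNIV. \<Sum>B\<in>UNIV. blade_sign A (sym_diff A D) * x $ A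
      * (blade_sign B (sym_diff B (sym_diff A D)) * y $ B * z $ sym_diff B (sym_diff A D)))"
  proof (intro sum.cong refl)
    fix A B
    have assoc: "sym_diff (sym_diff A B) D = sym_diff B (sym_diff A D)" by auto
    have split: "blade_sign A (sym_diff A D) = blade_sign A B * blade_sign A (sym_diff B (sym_diff A D))"
      using blade_sign_sym_diff_right[of A B "sym_diff B (sym_diff A D)"] unfolding sym_diff_cancel .
    have "blade_sign (sym_diff A B) (sym_diff B (sym_diff A D)) * blade_sign A B
       = blade_sign A (sym_diff A D) * blade_sign B (sym_diff B (sym_diff A D))"
      unfolding split blade_sign_sym_diff_left by (simp only: mult_ac)
    then show "blade_sign (sym_diff A B) (sym_diff (sym_diff A B) D)
      * (blade_sign A (sym_diff A (sym_diff A B)) * x $ A * y $ sym_diff A (sym_diff A B))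
      * z $ sym_diff (sym_diff A B) D = blade_sign A (sym_diff A D) * x $ A
      * (blade_sign B (sym_diff B (sym_diff A D)) * y $ B * z $ sym_diff B (sym_diff A D))"
      unfolding assoc sym_diff_cancel by (rule regroup)
  qed
  also have "\<dots> = (x \<star> (y \<star> z)) $ D"
    by (simp add: cl_mult_nth sum_distrib_left)
  finally show "((x \<star> y) \<star> z) $ D = (x \<star> (y \<star> z)) $ D" .
qed

interpretation cl_mult: bounded_bilinear "(\<star>) :: 'n::{finite,linorder} clif \<Rightarrow> 'n clif \<Rightarrow> 'n clif"
proof -
  have "bilinear ((\<star>) :: 'n clif \<Rightarrow> 'n clif \<Rightarrow> 'n clif)"
    by (auto simp: bilinear_def linear_iff vec_eq_iff cl_mult_nth algebra_simps sum.distrib sum_distrib_left)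
  then show "bounded_bilinear ((\<star>) :: 'n clif \<Rightarrow> 'n clif \<Rightarrow> 'n clif)"
    by (simp add: bilinear_conv_bounded_bilinear)
qed

lemma blade_sign_empty [simp]: "blade_sign {} A = 1" "blade_sign A {} = 1"
  by (simp_all add: blade_sign_eq_prod)

lemma cl_one_mult [simp]: "cl_one \<star> x = x"
  by (simp add: vec_eq_iff cl_mult_nth cl_one_def if_distrib if_distribR cong: if_cong)

lemma cl_mult_one [simp]: "x \<star> cl_one = x"
proof -
  have eq: "(sym_diff A C = {}) = (A = C)" for A C :: "'a set" by auto
  show ?thesis
    unfolding vec_eq_iff cl_mult_nth cl_one_def vec_lambda_beta eq
    by (simp add: if_distrib cong: if_cong)
qed

lemma cl_e_mult_nth: "(cl_e i \<star> x) $ C = blade_sign {i} (sym_diff {i} C) * x $ sym_diff {i} C"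
  by (simp add: cl_mult_nth cl_e_def if_distrib if_distribR cong: if_cong)

lemma blade_sign_singletons: "blade_sign {i} {j} = (if j \<le> i then -1 else 1)"
  by (simp add: blade_sign_eq_prod)

lemma cl_e_anticommute:
  "cl_e i \<star> (cl_e j \<star> x) + cl_e j \<star> (cl_e i \<star> x) = (if i = j then -2 else 0) *\<^sub>R x"
proof (rule vec_eq_iff[THEN iffD2], rule allI)
  fix C
  have sym_diffs: "sym_diff {j} (sym_diff {i} C) = sym_diff {i} (sym_diff {j} C)"
    "sym_diff {i} (sym_diff {i} C) = C" by auto
  show "(cl_e i \<star> (cl_e j \<star> x) + cl_e j \<star> (cl_e i \<star> x)) $ C = ((if i = j then -2 else 0) *\<^sub>R x) $ C"
    by (auto simp: cl_e_mult_nth sym_diffs blade_sign_sym_diff_right blade_sign_singletons blade_sign_square)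
qed

lemma inner_cl_e_mult: "inner (cl_e i \<star> x) y = - inner x (cl_e i \<star> y)"
proof -
  have sign: "blade_sign {i} (sym_diff {i} C) = - blade_sign {i} C" for C
    by (simp add: blade_sign_sym_diff_right blade_sign_singletons)
  have "inner (cl_e i \<star> x) y
      = (\<Sum>C\<in>UNIV. blade_sign {i} (sym_diff {i} C) * x $ sym_diff {i} C * y $ C)"
    by (simp add: inner_vec_def cl_e_mult_nth)
  also have "\<dots> = (\<Sum>C\<in>UNIV. blade_sign {i} (sym_diff {i} (sym_diff {i} C))
      * x $ sym_diff {i} (sym_diff {i} C) * y $ sym_diff {i} C)"
    by (rule sum.reindex_bij_betw[symmetric, OF bij_sym_diff])
  also have "\<dots> = - inner x (cl_e i \<star> y)"
    unfolding sym_diff_cancel by (simp add: inner_vec_def cl_e_mult_nth sign sum_negf mult_ac)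
  finally show ?thesis .
qed

lemma bounded_linear_cl_vec: "bounded_linear cl_vec"
  unfolding cl_vec_def
  by (intro bounded_linear_sum bounded_linear_compose[OF bounded_linear_scaleR_left bounded_linear_vec_nth])

lemma cl_vec_linear_simps:
  "cl_vec (x + y) = cl_vec x + cl_vec y" "cl_vec (- x) = - cl_vec x" "cl_vec (x - y) = cl_vec x - cl_vec y"
  "cl_vec (c *\<^sub>R x) = c *\<^sub>R cl_vec x"
  by (simp_all add: cl_vec_def scaleR_left_distrib scaleR_left_diff_distrib sum.distrib sum_subtractf
      sum_negf scaleR_sum_right)

lemma cl_vec_axis: "cl_vec (axis i 1) = cl_e i"
  by (simp add: cl_vec_def axis_def if_distrib if_distribR cong: if_cong)

lemma cl_vec_mult: "cl_vec w \<star> x = (\<Sum>i\<in>UNIV. (w $ i) *\<^sub>R (cl_e i \<star> x))"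
  by (simp add: cl_vec_def cl_mult.sum_left cl_mult.scaleR_left)

lemma inner_cl_vec_mult: "inner (cl_vec w \<star> x) y = - inner x (cl_vec w \<star> y)"
  by (simp add: cl_vec_mult inner_sum_left inner_sum_right inner_cl_e_mult sum_negf)

lemma cl_vec_anticommute:
  "cl_vec v \<star> (cl_vec w \<star> x) + cl_vec w \<star> (cl_vec v \<star> x) = (-2 * inner v w) *\<^sub>R x"
proof -
  have "cl_vec v \<star> (cl_vec w \<star> x) = (\<Sum>i\<in>UNIV. \<Sum>j\<in>UNIV. (v $ i * w $ j) *\<^sub>R (cl_e i \<star> (cl_e j \<star> x)))"
    by (subst cl_vec_mult[of v], subst cl_vec_mult[of w])
      (simp add: cl_mult.sum_right cl_mult.scaleR_right scaleR_sum_right)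
  moreover have "cl_vec w \<star> (cl_vec v \<star> x)
      = (\<Sum>j\<in>UNIV. \<Sum>i\<in>UNIV. (v $ i * w $ j) *\<^sub>R (cl_e j \<star> (cl_e i \<star> x)))"
    by (subst cl_vec_mult[of w], subst cl_vec_mult[of v])
      (simp add: cl_mult.sum_right cl_mult.scaleR_right scaleR_sum_right mult_ac)
  moreover have "\<dots> = (\<Sum>i\<in>UNIV. \<Sum>j\<in>UNIV. (v $ i * w $ j) *\<^sub>R (cl_e j \<star> (cl_e i \<star> x)))"
    by (rule sum.swap)
  ultimately have "cl_vec v \<star> (cl_vec w \<star> x) + cl_vec w \<star> (cl_vec v \<star> x)
      = (\<Sum>i\<in>UNIV. \<Sum>j\<in>UNIV. (v $ i * w $ j) *\<^sub>R (cl_e i \<star> (cl_e j \<star> x) + cl_e j \<star> (cl_e i \<star> x)))"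
    by (simp add: sum.distrib scaleR_add_right)
  also have "\<dots> = (\<Sum>i\<in>UNIV. \<Sum>j\<in>UNIV. if i = j then (-2 * v $ i * w $ i) *\<^sub>R x else 0)"
    by (intro sum.cong refl) (simp add: cl_e_anticommute)
  also have "\<dots> = (-2 * inner v w) *\<^sub>R x"
    by (simp add: inner_vec_def scaleR_left.sum[symmetric] sum_negf sum_distrib_left mult_ac)
  finally show ?thesis .
qed

lemma cl_e_cl_vec_mult: "cl_e i \<star> (cl_vec x \<star> y) = - (cl_vec x \<star> (cl_e i \<star> y)) - (2 * x $ i) *\<^sub>R y"
  using cl_vec_anticommute[of "axis i 1" x y]
  by (simp add: cl_vec_axis inner_axis' algebra_simps eq_neg_iff_add_eq_0)

lemma cl_vec_square: "cl_vec w \<star> (cl_vec w \<star> x) = - ((norm w)\<^sup>2 *\<^sub>R x)"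
proof -
  have "2 *\<^sub>R (cl_vec w \<star> (cl_vec w \<star> x)) = 2 *\<^sub>R (- ((norm w)\<^sup>2 *\<^sub>R x))"
    using cl_vec_anticommute[of w w x] by (simp add: power2_norm_eq_inner flip: scaleR_2)
  then show ?thesis by (simp only: scaleR_cancel_left) simp
qed

lemma norm_cl_vec_mult: "norm (cl_vec w \<star> x) = norm w * norm x"
proof -
  have "(norm (cl_vec w \<star> x))\<^sup>2 = (norm w * norm x)\<^sup>2"
    unfolding power2_norm_eq_inner[of "cl_vec w \<star> x"] inner_cl_vec_mult cl_vec_square
    by (simp add: power_mult_distrib power2_norm_eq_inner)
  then show ?thesis by (simp add: power2_eq_iff_nonneg)
qed

definition slice_act :: "real ^ 'n::{finite,linorder} \<Rightarrow> complex \<Rightarrow> 'n clif \<Rightarrow> 'n clif" where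
  "slice_act w z x = Re z *\<^sub>R x + Im z *\<^sub>R (cl_vec w \<star> x)"

interpretation slice_act: bounded_bilinear "slice_act w" for w
  unfolding bilinear_conv_bounded_bilinear[symmetric] bilinear_def linear_iff slice_act_def
  by (auto simp: cl_mult.add_right cl_mult.scaleR_right algebra_simps)

lemma slice_act_one [simp]: "slice_act w 1 x = x"
  and slice_act_of_real [simp]: "slice_act w (of_real c) x = c *\<^sub>R x"
  and slice_act_ii: "slice_act w \<i> x = cl_vec w \<star> x"
  by (simp_all add: slice_act_def)

lemma slice_act_mult:
  assumes "norm w = 1"
  shows "slice_act w (z1 * z2) x = slice_act w z1 (slice_act w z2 x)"
  by (simp add: slice_act_def cl_mult.add_right cl_mult.scaleR_right cl_vec_square assms algebra_simps)

lemma slice_act_uminus_direction: "slice_act (- w) z x = slice_act w (cnj z) x"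
  by (simp add: slice_act_def cl_vec_linear_simps cl_mult.minus_left)

lemma norm_slice_act:
  assumes "norm w = 1"
  shows "norm (slice_act w z x) = norm z * norm x"
proof -
  have "inner x (cl_vec w \<star> x) = 0"
    using inner_cl_vec_mult[of w x x] by (simp add: inner_commute)
  then have "(norm (slice_act w z x))\<^sup>2 = (Re z)\<^sup>2 * (norm x)\<^sup>2 + (Im z)\<^sup>2 * (norm (cl_vec w \<star> x))\<^sup>2"
    unfolding power2_norm_eq_inner
    by (simp add: slice_act_def inner_add_left inner_add_right inner_commute power2_eq_square)
  also have "\<dots> = (norm z * norm x)\<^sup>2"
    by (simp add: norm_cl_vec_mult assms cmod_power2 power_mult_distrib algebra_simps)
  finally show ?thesis by (simp add: power2_eq_iff_nonneg)
qed

lemma continuous_on_cl_mult [continuous_intros]: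
  "continuous_on S f \<Longrightarrow> continuous_on S g \<Longrightarrow> continuous_on S (\<lambda>x. f x \<star> g x)"
  by (rule cl_mult.continuous_on)

lemma continuous_on_cl_vec [continuous_intros]:
  "continuous_on S f \<Longrightarrow> continuous_on S (\<lambda>x. cl_vec (f x))"
  by (rule bounded_linear.continuous_on[OF bounded_linear_cl_vec])

lemma continuous_on_slice_act [continuous_intros]:
  assumes "continuous_on S h" "continuous_on S g" "continuous_on S f"
  shows "continuous_on S (\<lambda>x. slice_act (h x) (g x) (f x))"
  unfolding slice_act_def using assms by (intro continuous_intros)

lemma para_mult: "para x0 p w \<star> x = slice_act w (Complex x0 p) x"
  by (simp add: para_def slice_act_def cl_mult.add_left cl_mult.scaleR_left)

lemma cl_pow_para_mult:
  assumes "norm w = 1"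
  shows "cl_pow (para x0 p w) m \<star> x = slice_act w (Complex x0 p ^ m) x"
  by (induction m) (simp_all add: cl_mult_assoc slice_act_mult assms flip: para_mult)

lemma cl_pow_cl_vec_mult:
  assumes "norm w = 1"
  shows "cl_pow (cl_vec w) k \<star> x = slice_act w (\<i> ^ k) x"
  using cl_pow_para_mult[OF assms, of 0 1] by (simp add: para_def imaginary_unit.code)

lemma para_mult_para:
  assumes "norm w = 1"
  shows "para a b w \<star> para c d w = para (Re (Complex a b * Complex c d)) (Im (Complex a b * Complex c d)) w"
  using slice_act_mult[OF assms, of "Complex a b" "Complex c d" cl_one]
  by (simp add: slice_act_def para_def cl_mult.add_left cl_mult.scaleR_left)

lemma cl_inv_eqI:
  assumes "x \<star> y = cl_one" "y \<star> x = cl_one"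
  shows "cl_inv x = y"
  unfolding cl_inv_def using assms by (intro the_equality) (metis cl_mult_assoc cl_mult_one cl_one_mult)+

lemma cl_inv_para:
  assumes "norm w = 1" "Complex x0 p \<noteq> 0"
  shows "cl_inv (para x0 p w) = para (Re (inverse (Complex x0 p))) (Im (inverse (Complex x0 p))) w"
proof -
  have "para (Re 1) (Im 1) w = cl_one" by (simp add: para_def)
  then show ?thesis
    using assms(2) by (intro cl_inv_eqI) (simp_all only: para_mult_para[OF assms(1)] complex_surj right_inverse
      left_inverse simp_thms not_False_eq_True)
qed

lemma cl_zpow_para_mult:
  assumes "norm w = 1" "Complex x0 p \<noteq> 0"
  shows "cl_zpow (para x0 p w) j \<star> x = slice_act w (Complex x0 p powi j) x"
  unfolding cl_zpow_def power_int_def cl_inv_para[OF assms]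
  by (simp only: if_distribR if_distrib[of "\<lambda>y. y \<star> x"] if_distrib[of "\<lambda>z. slice_act w z x"]
      cl_pow_para_mult[OF assms(1)] complex_surj)

lemma exp_term_eq_slice_act:
  assumes "norm w = 1" "(x0, p) \<noteq> (0, 0)"
  shows "exp_term P x0 p w (j, k) = slice_act w (Complex x0 p powi j * \<i> ^ k) (P k j w)"
proof -
  have "Complex x0 p \<noteq> 0" using assms(2) by (simp add: complex_eq_iff)
  then show ?thesis
    by (simp add: exp_term_def cl_zpow_para_mult[OF assms(1)] cl_pow_cl_vec_mult[OF assms(1)]
        slice_act_mult[OF assms(1)])
qed

section \<open>Homogeneous polynomials and the Fischer decomposition\<close>

definition monomial :: "('n \<Rightarrow> nat) \<Rightarrow> real ^ 'n::finite \<Rightarrow> real" where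
  "monomial \<alpha> x = (\<Prod>i\<in>UNIV. (x $ i) ^ \<alpha> i)"

lemma hom_poly_iff_monomials:
  "hom_poly k P \<longleftrightarrow> (\<exists>c. P = (\<lambda>x. \<Sum>\<alpha> | sum \<alpha> UNIV = k. monomial \<alpha> x *\<^sub>R c \<alpha>))"
  by (simp add: hom_poly_def monomial_def fun_eq_iff)

lemma finite_multi_index: "finite {\<alpha> :: 'n::finite \<Rightarrow> nat. sum \<alpha> UNIV = k}"
proof (rule finite_subset)
  show "{\<alpha> :: 'n \<Rightarrow> nat. sum \<alpha> UNIV = k} \<subseteq> Pi\<^sub>E UNIV (\<lambda>_. {..k})"
    by (auto simp: PiE_def intro: member_le_sum)
  show "finite (Pi\<^sub>E (UNIV :: 'n set) (\<lambda>_. {..k}))"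
    by (rule finite_PiE) auto
qed

lemma hom_poly_monomial: "hom_poly (sum \<alpha> UNIV) (\<lambda>x. monomial \<alpha> x *\<^sub>R c)"
  unfolding hom_poly_iff_monomials
  by (intro exI[of _ "\<lambda>\<beta>. if \<beta> = \<alpha> then c else 0"])
    (simp add: if_distrib[of "\<lambda>y. _ *\<^sub>R y"] sum.delta' finite_multi_index cong: if_cong)

lemma hom_poly_zero: "hom_poly k (\<lambda>x. 0)"
  unfolding hom_poly_def by (rule exI[of _ "\<lambda>_. 0"]) simp

lemma hom_poly_const: "hom_poly 0 (\<lambda>x. c)"
  using hom_poly_monomial[of "\<lambda>_. 0" c] by (simp add: monomial_def)

lemma hom_poly_add: "hom_poly k P \<Longrightarrow> hom_poly k Q \<Longrightarrow> hom_poly k (\<lambda>x. P x + Q x)"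
  unfolding hom_poly_def
  by (elim exE, rule_tac x="\<lambda>\<alpha>. c \<alpha> + ca \<alpha>" in exI) (simp add: sum.distrib scaleR_add_right)

lemma hom_poly_sum: "(\<And>i. i \<in> A \<Longrightarrow> hom_poly k (P i)) \<Longrightarrow> hom_poly k (\<lambda>x. \<Sum>i\<in>A. P i x)"
  by (induction A rule: infinite_finite_induct) (auto intro: hom_poly_zero hom_poly_add)

lemma hom_poly_linear:
  assumes "linear L" "hom_poly k P"
  shows "hom_poly k (\<lambda>x. L (P x))"
proof -
  obtain c where "P = (\<lambda>x. \<Sum>\<alpha> | sum \<alpha> UNIV = k. monomial \<alpha> x *\<^sub>R c \<alpha>)"
    using assms(2) by (auto simp: hom_poly_iff_monomials)
  then show ?thesis
    unfolding hom_poly_iff_monomials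
    by (intro exI[of _ "\<lambda>\<alpha>. L (c \<alpha>)"]) (simp add: linear_sum[OF assms(1)] linear_scale[OF assms(1)])
qed

lemma hom_poly_scaleR: "hom_poly k P \<Longrightarrow> hom_poly k (\<lambda>x. c *\<^sub>R P x)"
  by (rule hom_poly_linear[of "\<lambda>y. c *\<^sub>R y"]) (auto intro: linear_scaleR)

lemma hom_poly_diff: "hom_poly k P \<Longrightarrow> hom_poly k Q \<Longrightarrow> hom_poly k (\<lambda>x. P x - Q x)"
  using hom_poly_add[of k P "\<lambda>x. -1 *\<^sub>R Q x"] hom_poly_scaleR[of k Q "-1"] by simp

lemma hom_poly_cl_mult: "hom_poly k P \<Longrightarrow> hom_poly k (\<lambda>x. a \<star> P x)"
  by (rule hom_poly_linear[of "\<lambda>y. a \<star> y"])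
    (auto intro: bounded_linear.linear cl_mult.bounded_linear_right)

lemma monomial_fun_upd_Suc: "monomial (\<alpha>(i := Suc (\<alpha> i))) x = x $ i * monomial \<alpha> x"
proof -
  have "(\<Prod>l\<in>UNIV - {i}. (x $ l) ^ (\<alpha>(i := Suc (\<alpha> i))) l) = (\<Prod>l\<in>UNIV - {i}. (x $ l) ^ \<alpha> l)"
    by (intro prod.cong) auto
  then show ?thesis
    using prod.remove[of UNIV i "\<lambda>l. (x $ l) ^ \<alpha> l"] prod.remove[of UNIV i "\<lambda>l. (x $ l) ^ (\<alpha>(i := Suc (\<alpha> i))) l"]
    by (simp add: monomial_def)
qed

lemma sum_fun_upd_Suc: "sum (\<alpha>(i := Suc (\<alpha> i))) UNIV = Suc (sum \<alpha> (UNIV :: 'n::finite set))"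
proof -
  have "sum (\<alpha>(i := Suc (\<alpha> i))) (UNIV - {i}) = sum \<alpha> (UNIV - {i})"
    by (intro sum.cong) auto
  then show ?thesis
    using sum.remove[of UNIV i \<alpha>] sum.remove[of UNIV i "\<alpha>(i := Suc (\<alpha> i))"] by simp
qed

lemma hom_poly_coord:
  assumes "hom_poly k P"
  shows "hom_poly (Suc k) (\<lambda>x. x $ i *\<^sub>R P x)"
proof -
  obtain c where c: "P = (\<lambda>x. \<Sum>\<alpha> | sum \<alpha> UNIV = k. monomial \<alpha> x *\<^sub>R c \<alpha>)"
    using assms by (auto simp: hom_poly_iff_monomials)
  have "hom_poly (Suc k) (\<lambda>x. \<Sum>\<alpha> | sum \<alpha> UNIV = k. monomial (\<alpha>(i := Suc (\<alpha> i))) x *\<^sub>R c \<alpha>)"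
    by (intro hom_poly_sum) (metis (mono_tags) hom_poly_monomial sum_fun_upd_Suc mem_Collect_eq)
  then show ?thesis
    unfolding monomial_fun_upd_Suc by (simp add: c scaleR_sum_right)
qed

lemma monomial_induct [case_names const coord]:
  fixes \<alpha> :: "'n::finite \<Rightarrow> nat"
  assumes const: "\<Phi> 0 (\<lambda>x. 1)"
    and coord: "\<And>\<alpha> i. \<Phi> (sum \<alpha> UNIV) (monomial \<alpha>) \<Longrightarrow> \<Phi> (Suc (sum \<alpha> UNIV)) (\<lambda>x. x $ i * monomial \<alpha> x)"
  shows "\<Phi> (sum \<alpha> UNIV) (monomial \<alpha>)"
proof (induction "sum \<alpha> UNIV" arbitrary: \<alpha>)
  case 0
  then have "\<alpha> = (\<lambda>_. 0)" by (simp add: fun_eq_iff)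
  then show ?case using const by (simp add: monomial_def[abs_def])
next
  case (Suc k)
  then obtain i where i: "\<alpha> i \<noteq> 0" by (metis sum.neutral UNIV_I nat.distinct(1))
  define \<beta> where "\<beta> = \<alpha>(i := \<alpha> i - 1)"
  have \<alpha>: "\<alpha> = \<beta>(i := Suc (\<beta> i))" using i by (auto simp: \<beta>_def fun_eq_iff)
  have degree: "sum \<alpha> UNIV = Suc (sum \<beta> UNIV)" by (subst \<alpha>) (rule sum_fun_upd_Suc)
  have "monomial \<alpha> = (\<lambda>x. x $ i * monomial \<beta> x)"
    by (subst \<alpha>) (simp add: fun_eq_iff monomial_fun_upd_Suc)
  then show ?case using coord[OF Suc(1)] Suc(2) degree by simp
qed

lemma hom_poly_induct [consumes 1, case_names const add coord]:
  fixes P :: "real ^ 'n::{finite,linorder} \<Rightarrow> 'n clif"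
  assumes "hom_poly k P"
    and const: "\<And>c. \<Phi> 0 (\<lambda>x. c)"
    and add: "\<And>k P Q. hom_poly k P \<Longrightarrow> \<Phi> k P \<Longrightarrow> hom_poly k Q \<Longrightarrow> \<Phi> k Q \<Longrightarrow> \<Phi> k (\<lambda>x. P x + Q x)"
    and coord: "\<And>k i P. hom_poly k P \<Longrightarrow> \<Phi> k P \<Longrightarrow> \<Phi> (Suc k) (\<lambda>x. x $ i *\<^sub>R P x)"
  shows "\<Phi> k P"
proof -
  have zero: "\<Phi> k (\<lambda>x. 0)" for k
  proof (induction k)
    case (Suc k)
    then show ?case using coord[OF hom_poly_zero Suc, of undefined] by simp
  qed (rule const)
  have mono: "\<Phi> (sum \<alpha> UNIV) (\<lambda>x. monomial \<alpha> x *\<^sub>R c)" for \<alpha> :: "'n \<Rightarrow> nat" and c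
    by (rule monomial_induct[where \<Phi>="\<lambda>k m. \<Phi> k (\<lambda>x. m x *\<^sub>R c)"])
      (use const[of c] coord[OF hom_poly_monomial] in simp_all)
  have "hom_poly k (\<lambda>x. \<Sum>\<alpha>\<in>A. monomial \<alpha> x *\<^sub>R c \<alpha>) \<and> \<Phi> k (\<lambda>x. \<Sum>\<alpha>\<in>A. monomial \<alpha> x *\<^sub>R c \<alpha>)"
    if "A \<subseteq> {\<alpha>. sum \<alpha> UNIV = k}" for A c
    using finite_subset[OF that finite_multi_index] that
  proof (induction A rule: finite_induct)
    case empty
    show ?case using zero hom_poly_zero by simp
  next
    case (insert \<alpha> A)
    then have "k = sum \<alpha> UNIV" by simp
    with insert show ?case
      using hom_poly_monomial[of \<alpha> "c \<alpha>"] mono[of \<alpha> "c \<alpha>"] by (auto intro!: hom_poly_add add)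
  qed
  then show ?thesis using assms(1) unfolding hom_poly_iff_monomials by blast
qed

lemma sphere_direction:
  fixes x :: "'a::euclidean_space"
  obtains z where "norm z = 1" "x = norm x *\<^sub>R z"
proof (cases "x = 0")
  case True
  obtain z :: 'a where "norm z = 1" using vector_choose_size[of 1] by auto
  with True that show ?thesis by simp
next
  case False
  then show ?thesis using that[of "(1 / norm x) *\<^sub>R x"] by simp
qed

lemma hom_poly_scale_arg: "hom_poly k P \<Longrightarrow> P (t *\<^sub>R x) = t ^ k *\<^sub>R P x"
  by (induction rule: hom_poly_induct) (simp_all add: scaleR_add_right)

lemma hom_poly_uminus_arg: "hom_poly k P \<Longrightarrow> P (- x) = (-1) ^ k *\<^sub>R P x"
  using hom_poly_scale_arg[of k P "-1" x] by simp

lemma norm_hom_poly_le: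
  assumes P: "hom_poly k P" and M: "\<And>y. norm y = 1 \<Longrightarrow> norm (P y) \<le> M"
  shows "norm (P x) \<le> M * norm x ^ k"
proof -
  obtain z where z: "norm z = 1" "x = norm x *\<^sub>R z" by (rule sphere_direction)
  have "norm (P x) = norm (P z) * norm x ^ k"
    by (subst z(2)) (simp add: hom_poly_scale_arg[OF P])
  then show ?thesis using M[OF z(1)] by (simp add: mult_right_mono)
qed

lemma hom_poly_eq_0:
  assumes "hom_poly k P" "\<And>w. norm w = 1 \<Longrightarrow> P w = 0"
  shows "P = (\<lambda>x. 0)"
  using norm_hom_poly_le[OF assms(1), of 0] assms(2) by fastforce

definition partial_deriv :: "(real ^ 'n::finite \<Rightarrow> 'b::real_normed_vector) \<Rightarrow> 'n \<Rightarrow> (real, 'n) vec \<Rightarrow> 'b" where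
  "partial_deriv F i x = frechet_derivative F (at x) (axis i 1)"

lemma has_derivative_frechet: "F differentiable at x \<Longrightarrow> (F has_derivative frechet_derivative F (at x)) (at x)"
  by (simp add: frechet_derivative_works)

lemma partial_deriv_eq: "(F has_derivative F') (at x) \<Longrightarrow> partial_deriv F i x = F' (axis i 1)"
  unfolding partial_deriv_def by (simp add: frechet_derivative_at[symmetric])

lemma vec_eq_sum_axis: "(\<Sum>i\<in>UNIV. v $ i *\<^sub>R axis i 1) = (v :: real ^ 'n::finite)"
  using basis_expansion[of v] by (simp add: scalar_mult_eq_scaleR)

lemma frechet_derivative_eq_sum_partial_deriv:
  assumes "F differentiable at x"
  shows "frechet_derivative F (at x) v = (\<Sum>i\<in>UNIV. v $ i *\<^sub>R partial_deriv F i x)"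
proof -
  have linear: "linear (frechet_derivative F (at x))" using assms by (rule linear_frechet_derivative)
  have "frechet_derivative F (at x) v = frechet_derivative F (at x) (\<Sum>i\<in>UNIV. v $ i *\<^sub>R axis i 1)"
    by (simp only: vec_eq_sum_axis)
  then show ?thesis by (simp add: linear_sum[OF linear] linear_scale[OF linear] partial_deriv_def)
qed

lemma partial_deriv_const [simp]: "partial_deriv (\<lambda>x. c) i x = 0"
  by (subst partial_deriv_eq[OF has_derivative_const]) simp

lemma partial_deriv_add:
  assumes "F differentiable at x" "G differentiable at x"
  shows "partial_deriv (\<lambda>x. F x + G x) i x = partial_deriv F i x + partial_deriv G i x"
  using partial_deriv_eq[OF has_derivative_add[OF assms[THEN has_derivative_frechet]]]
  by (simp add: partial_deriv_def)

lemma partial_deriv_diff: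
  assumes "F differentiable at x" "G differentiable at x"
  shows "partial_deriv (\<lambda>x. F x - G x) i x = partial_deriv F i x - partial_deriv G i x"
  using partial_deriv_eq[OF has_derivative_diff[OF assms[THEN has_derivative_frechet]]]
  by (simp add: partial_deriv_def)

lemma partial_deriv_sum:
  assumes "\<And>j. j \<in> A \<Longrightarrow> F j differentiable at x"
  shows "partial_deriv (\<lambda>x. \<Sum>j\<in>A. F j x) i x = (\<Sum>j\<in>A. partial_deriv (F j) i x)"
  using partial_deriv_eq[OF has_derivative_sum[OF has_derivative_frechet[OF assms]]]
  by (simp add: partial_deriv_def)

lemma partial_deriv_linear:
  assumes "bounded_linear L" "F differentiable at x"
  shows "partial_deriv (\<lambda>x. L (F x)) i x = L (partial_deriv F i x)"
  using partial_deriv_eq[OF bounded_linear.has_derivative[OF assms(1) has_derivative_frechet[OF assms(2)]]]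
  by (simp add: partial_deriv_def)

lemma has_derivative_coord_scaleR:
  fixes F :: "real ^ 'n::finite \<Rightarrow> 'b::real_normed_vector"
  assumes "(F has_derivative F') (at x)"
  shows "((\<lambda>x. x $ j *\<^sub>R F x) has_derivative (\<lambda>v. x $ j *\<^sub>R F' v + v $ j *\<^sub>R F x)) (at x)"
  using assms by (auto intro!: derivative_eq_intros bounded_linear.has_derivative[OF bounded_linear_vec_nth])

lemma partial_deriv_coord_scaleR:
  assumes "F differentiable at x"
  shows "partial_deriv (\<lambda>x. x $ j *\<^sub>R F x) i x = x $ j *\<^sub>R partial_deriv F i x + (if i = j then F x else 0)"
  using partial_deriv_eq[OF has_derivative_coord_scaleR[OF has_derivative_frechet[OF assms]]]
  by (simp add: partial_deriv_def axis_def)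

lemma hom_poly_differentiable: "hom_poly k P \<Longrightarrow> P differentiable at x"
proof (induction rule: hom_poly_induct)
  case (coord k i P)
  then show ?case using has_derivative_coord_scaleR unfolding differentiable_def by blast
qed simp_all

lemma hom_poly_continuous_on: "hom_poly k P \<Longrightarrow> continuous_on S P"
  by (intro continuous_at_imp_continuous_on ballI differentiable_imp_continuous_within hom_poly_differentiable)

lemma hom_poly_partial_deriv_cases:
  "hom_poly k P \<Longrightarrow> if k = 0 then partial_deriv P i = (\<lambda>x. 0) else hom_poly (k - 1) (partial_deriv P i)"
proof (induction rule: hom_poly_induct)
  case (const c)
  show ?case by (simp add: fun_eq_iff)
next
  case (add k P Q)
  then have "partial_deriv (\<lambda>x. P x + Q x) i = (\<lambda>x. partial_deriv P i x + partial_deriv Q i x)"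
    by (auto simp: fun_eq_iff partial_deriv_add hom_poly_differentiable)
  with add show ?case by (auto intro: hom_poly_add)
next
  case (coord k j P)
  have "partial_deriv (\<lambda>x. x $ j *\<^sub>R P x) i = (\<lambda>x. x $ j *\<^sub>R partial_deriv P i x + (if i = j then P x else 0))"
    using coord(1) by (auto simp: fun_eq_iff partial_deriv_coord_scaleR hom_poly_differentiable)
  moreover have "hom_poly k (\<lambda>x. x $ j *\<^sub>R partial_deriv P i x)"
    using coord(2) hom_poly_coord[of "k - 1" "partial_deriv P i" j] by (cases k) (auto intro: hom_poly_zero)
  ultimately show ?case using hom_poly_add[OF _ coord(1)] by (cases "i = j") auto
qed

lemma hom_poly_partial_deriv: "hom_poly (Suc k) P \<Longrightarrow> hom_poly k (partial_deriv P i)"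
  and hom_poly_0_partial_deriv: "hom_poly 0 P \<Longrightarrow> partial_deriv P i x = 0"
  using hom_poly_partial_deriv_cases[of "Suc k" P i] hom_poly_partial_deriv_cases[of 0 P i] by simp_all

definition euler :: "(real ^ 'n::finite \<Rightarrow> 'b::real_normed_vector) \<Rightarrow> (real, 'n) vec \<Rightarrow> 'b" where
  "euler F x = (\<Sum>i\<in>UNIV. x $ i *\<^sub>R partial_deriv F i x)"

lemma euler_hom_poly: "hom_poly k P \<Longrightarrow> euler P x = real k *\<^sub>R P x"
proof (induction rule: hom_poly_induct)
  case (const c)
  show ?case by (simp add: euler_def)
next
  case (add k P Q)
  then show ?case
    by (simp add: euler_def partial_deriv_add hom_poly_differentiable scaleR_add_right sum.distrib)
next
  case (coord k j P)
  have "euler (\<lambda>x. x $ j *\<^sub>R P x) x = x $ j *\<^sub>R euler P x + (\<Sum>i\<in>UNIV. if i = j then x $ i *\<^sub>R P x else 0)"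
    unfolding euler_def scaleR_sum_right sum.distrib[symmetric]
    by (intro sum.cong refl)
      (simp add: partial_deriv_coord_scaleR[OF hom_poly_differentiable[OF coord(1)]] scaleR_add_right mult.commute)
  also have "\<dots> = real (Suc k) *\<^sub>R (x $ j *\<^sub>R P x)"
    using coord by (simp add: algebra_simps)
  finally show ?case .
qed

definition dirac :: "(real ^ 'n::{finite,linorder} \<Rightarrow> 'n clif) \<Rightarrow> (real, 'n) vec \<Rightarrow> 'n clif" where
  "dirac F x = (\<Sum>i\<in>UNIV. cl_e i \<star> partial_deriv F i x)"

definition vec_mult :: "(real ^ 'n::{finite,linorder} \<Rightarrow> 'n clif) \<Rightarrow> (real, 'n) vec \<Rightarrow> 'n clif" where
  "vec_mult F x = cl_vec x \<star> F x"

lemma monogenic_hom_iff: "monogenic_hom k P \<longleftrightarrow> hom_poly k P \<and> (\<forall>x. dirac P x = 0)"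
  by (simp add: monogenic_hom_def dirac_def partial_deriv_def)

lemma monogenic_hom_imp_hom_poly: "monogenic_hom k P \<Longrightarrow> hom_poly k P"
  by (simp add: monogenic_hom_def)

lemma hom_poly_vec_mult: "hom_poly k P \<Longrightarrow> hom_poly (Suc k) (vec_mult P)"
  unfolding vec_mult_def cl_vec_mult by (intro hom_poly_sum hom_poly_coord hom_poly_cl_mult)

lemma partial_deriv_vec_mult:
  assumes "F differentiable at x"
  shows "partial_deriv (vec_mult F) i x = cl_e i \<star> F x + cl_vec x \<star> partial_deriv F i x"
  unfolding vec_mult_def[abs_def]
  using partial_deriv_eq[OF cl_mult.FDERIV[OF
        bounded_linear.has_derivative[OF bounded_linear_cl_vec has_derivative_ident]
        has_derivative_frechet[OF assms]]]
  by (simp add: partial_deriv_def cl_vec_axis add.commute)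

lemma dirac_vec_mult:
  fixes F :: "real ^ 'n::{finite,linorder} \<Rightarrow> 'n clif"
  assumes "F differentiable at x"
  shows "dirac (vec_mult F) x = - (real CARD('n) *\<^sub>R F x) - 2 *\<^sub>R euler F x - cl_vec x \<star> dirac F x"
proof -
  have square: "cl_e i \<star> (cl_e i \<star> y) = - y" for i :: 'n and y
    using cl_vec_square[of "axis i 1" y] by (simp add: cl_vec_axis)
  have "dirac (vec_mult F) x
      = (\<Sum>i\<in>UNIV. - F x - cl_vec x \<star> (cl_e i \<star> partial_deriv F i x) - (2 * x $ i) *\<^sub>R partial_deriv F i x)"
    unfolding dirac_def
    by (intro sum.cong refl) (simp add: partial_deriv_vec_mult[OF assms] cl_mult.add_right square cl_e_cl_vec_mult)
  also have "\<dots> = - (real CARD('n) *\<^sub>R F x) - 2 *\<^sub>R euler F x - cl_vec x \<star> dirac F x"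
    by (simp add: sum_subtractf sum_negf sum_constant_scaleR euler_def dirac_def cl_mult.sum_right
        scaleR_sum_right del: sum_constant)
  finally show ?thesis .
qed

lemma dirac_diff:
  "F differentiable at x \<Longrightarrow> G differentiable at x \<Longrightarrow> dirac (\<lambda>x. F x - G x) x = dirac F x - dirac G x"
  by (simp add: dirac_def partial_deriv_diff cl_mult.diff_right sum_subtractf)

lemma dirac_sum:
  "(\<And>j. j \<in> A \<Longrightarrow> F j differentiable at x) \<Longrightarrow> dirac (\<lambda>x. \<Sum>j\<in>A. F j x) x = (\<Sum>j\<in>A. dirac (F j) x)"
  unfolding dirac_def by (subst sum.swap) (simp add: partial_deriv_sum cl_mult.sum_right)

lemma dirac_scaleR: "F differentiable at x \<Longrightarrow> dirac (\<lambda>x. c *\<^sub>R F x) x = c *\<^sub>R dirac F x"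
  by (simp add: dirac_def partial_deriv_linear[OF bounded_linear_scaleR_right] cl_mult.scaleR_right scaleR_sum_right)

lemma hom_poly_dirac: "hom_poly (Suc k) P \<Longrightarrow> hom_poly k (dirac P)"
  unfolding dirac_def[abs_def] by (intro hom_poly_sum hom_poly_cl_mult hom_poly_partial_deriv)

lemma monogenic_hom_scaleR: "monogenic_hom k P \<Longrightarrow> monogenic_hom k (\<lambda>x. c *\<^sub>R P x)"
  by (auto simp: monogenic_hom_iff dirac_scaleR[OF hom_poly_differentiable] intro: hom_poly_scaleR)

lemma monogenic_hom_zero: "monogenic_hom k (\<lambda>x. 0)"
  by (auto simp: monogenic_hom_iff dirac_def cl_mult.zero_right intro: hom_poly_zero)

lemma monogenic_hom_diff: "monogenic_hom k P \<Longrightarrow> monogenic_hom k Q \<Longrightarrow> monogenic_hom k (\<lambda>x. P x - Q x)"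
  by (auto simp: monogenic_hom_iff dirac_diff hom_poly_differentiable intro: hom_poly_diff)

lemma monogenic_hom_0: "hom_poly 0 P \<Longrightarrow> monogenic_hom 0 P"
  by (simp add: monogenic_hom_iff dirac_def hom_poly_0_partial_deriv cl_mult.zero_right)

lemma hom_poly_vec_mult_funpow: "hom_poly k P \<Longrightarrow> hom_poly (k + s) ((vec_mult ^^ s) P)"
  by (induction s) (auto intro: hom_poly_vec_mult)

lemma vec_mult_funpow_scaleR: "(vec_mult ^^ s) (\<lambda>x. c *\<^sub>R P x) = (\<lambda>x. c *\<^sub>R (vec_mult ^^ s) P x)"
  by (induction s) (auto simp: vec_mult_def fun_eq_iff cl_mult.scaleR_right)

definition fischer_const :: "nat \<Rightarrow> nat \<Rightarrow> nat \<Rightarrow> real" where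
  "fischer_const n l s = (if even s then real n + 2 * real l + real s else real s + 1)"

lemma fischer_const_pos: "0 < n \<Longrightarrow> 0 < fischer_const n l s"
  by (simp add: fischer_const_def)

lemma dirac_vec_mult_funpow:
  fixes Q :: "real ^ 'n::{finite,linorder} \<Rightarrow> 'n clif"
  assumes "monogenic_hom l Q"
  shows "dirac ((vec_mult ^^ Suc s) Q) x = - fischer_const CARD('n) l s *\<^sub>R (vec_mult ^^ s) Q x"
proof (induction s)
  case 0
  show ?case
    using assms euler_hom_poly[of l Q x] dirac_vec_mult[OF hom_poly_differentiable[of l Q], of x]
    by (simp add: monogenic_hom_iff fischer_const_def cl_mult.zero_right algebra_simps)
next
  case (Suc s)
  define R where "R = (vec_mult ^^ Suc s) Q"
  define c where "c = real CARD('n) + 2 * real (l + Suc s)"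
  have R: "hom_poly (l + Suc s) R"
    unfolding R_def by (rule hom_poly_vec_mult_funpow[OF monogenic_hom_imp_hom_poly[OF assms]])
  have "dirac (vec_mult R) x = - (c *\<^sub>R R x) - cl_vec x \<star> dirac R x"
    using euler_hom_poly[OF R, of x]
    by (simp add: dirac_vec_mult[OF hom_poly_differentiable[OF R]] c_def algebra_simps)
  also have "cl_vec x \<star> dirac R x = - fischer_const CARD('n) l s *\<^sub>R R x"
    unfolding R_def Suc cl_mult.scaleR_right by (simp add: vec_mult_def[of "(vec_mult ^^ s) Q"])
  also have "- (c *\<^sub>R R x) - - fischer_const CARD('n) l s *\<^sub>R R x = (fischer_const CARD('n) l s - c) *\<^sub>R R x"
    by (simp add: scaleR_left_diff_distrib)
  also have "fischer_const CARD('n) l s - c = - fischer_const CARD('n) l (Suc s)"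
    by (simp add: fischer_const_def c_def)
  finally show ?case by (simp add: R_def)
qed

lemma dirac_preimage:
  fixes Q :: "nat \<Rightarrow> real ^ 'n::{finite,linorder} \<Rightarrow> 'n clif"
  assumes Q: "\<And>s. s \<le> k \<Longrightarrow> monogenic_hom (k - s) (Q s)"
  obtains R where "\<And>s. s \<le> k \<Longrightarrow> monogenic_hom (k - s) (R s)"
    and "hom_poly (Suc k) (\<lambda>x. \<Sum>s\<le>k. (vec_mult ^^ Suc s) (R s) x)"
    and "\<And>x. dirac (\<lambda>x. \<Sum>s\<le>k. (vec_mult ^^ Suc s) (R s) x) x = (\<Sum>s\<le>k. (vec_mult ^^ s) (Q s) x)"
proof -
  define c where "c s = - fischer_const CARD('n) (k - s) s" for s
  have c: "c s \<noteq> 0" for s using fischer_const_pos[of "CARD('n)" "k - s" s] by (simp add: c_def)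
  define R where "R s = (\<lambda>x. (1 / c s) *\<^sub>R Q s x)" for s
  have R: "monogenic_hom (k - s) (R s)" if "s \<le> k" for s
    using Q[OF that] by (simp add: R_def monogenic_hom_scaleR)
  have hom: "hom_poly (Suc k) ((vec_mult ^^ Suc s) (R s))" if "s \<le> k" for s
    using hom_poly_vec_mult_funpow[of "k - s" "R s" "Suc s"] R[OF that] that
    by (simp add: monogenic_hom_iff del: funpow.simps)
  have "dirac ((vec_mult ^^ Suc s) (R s)) x = (vec_mult ^^ s) (Q s) x" if "s \<le> k" for s x
    unfolding dirac_vec_mult_funpow[OF R[OF that]] c_def[symmetric] unfolding R_def vec_mult_funpow_scaleR
    using c[of s] by simp
  then have "dirac (\<lambda>x. \<Sum>s\<le>k. (vec_mult ^^ Suc s) (R s) x) x = (\<Sum>s\<le>k. (vec_mult ^^ s) (Q s) x)" for x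
    using hom by (subst dirac_sum) (auto intro: hom_poly_differentiable simp del: funpow.simps)
  with R hom_poly_sum[of "{..k}" "Suc k" "\<lambda>s. (vec_mult ^^ Suc s) (R s)"] hom show ?thesis
    by (intro that[of R]) (simp_all del: funpow.simps)
qed

lemma fischer_decomposition:
  fixes P :: "real ^ 'n::{finite,linorder} \<Rightarrow> 'n clif"
  assumes "hom_poly k P"
  shows "\<exists>Q. (\<forall>s\<le>k. monogenic_hom (k - s) (Q s)) \<and> P = (\<lambda>x. \<Sum>s\<le>k. (vec_mult ^^ s) (Q s) x)"
  using assms
proof (induction k arbitrary: P)
  case 0
  then show ?case by (intro exI[of _ "\<lambda>_. P"]) (simp add: monogenic_hom_0)
next
  case (Suc k)
  obtain Q where Q: "\<And>s. s \<le> k \<Longrightarrow> monogenic_hom (k - s) (Q s)"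
    and dirac_P: "dirac P = (\<lambda>x. \<Sum>s\<le>k. (vec_mult ^^ s) (Q s) x)"
    using Suc.IH[OF hom_poly_dirac[OF Suc.prems]] by blast
  obtain R where R: "\<And>s. s \<le> k \<Longrightarrow> monogenic_hom (k - s) (R s)"
    and hom: "hom_poly (Suc k) (\<lambda>x. \<Sum>s\<le>k. (vec_mult ^^ Suc s) (R s) x)"
    and dirac_R: "\<And>x. dirac (\<lambda>x. \<Sum>s\<le>k. (vec_mult ^^ Suc s) (R s) x) x = (\<Sum>s\<le>k. (vec_mult ^^ s) (Q s) x)"
    using dirac_preimage[OF Q] by blast
  define M where "M x = P x - (\<Sum>s\<le>k. (vec_mult ^^ Suc s) (R s) x)" for x
  have "dirac M x = 0" for x
    unfolding M_def[abs_def]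
    by (simp only: dirac_diff hom_poly_differentiable[OF Suc.prems] hom_poly_differentiable[OF hom] dirac_R
        dirac_P diff_self)
  then have "monogenic_hom (Suc k) M"
    unfolding monogenic_hom_iff M_def[abs_def] using hom_poly_diff[OF Suc.prems hom] by blast
  moreover have "P = (\<lambda>x. \<Sum>s\<le>Suc k. (vec_mult ^^ s) (case s of 0 \<Rightarrow> M | Suc s \<Rightarrow> R s) x)"
    unfolding sum.atMost_Suc_shift by (simp add: M_def fun_eq_iff)
  ultimately show ?case
    using R by (intro exI[of _ "\<lambda>s. case s of 0 \<Rightarrow> M | Suc s \<Rightarrow> R s"]) (auto split: nat.split)
qed

lemma vec_mult_funpow_sphere:
  assumes "norm w = 1"
  shows "(vec_mult ^^ s) P w = slice_act w (\<i> ^ s) (P w)"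
  by (induction s) (simp_all add: vec_mult_def slice_act_mult[OF assms] slice_act_ii)

inductive sum_of_hom_polys :: "(real ^ 'n::{finite,linorder} \<Rightarrow> 'n clif) \<Rightarrow> bool" where
  hom: "hom_poly k P \<Longrightarrow> sum_of_hom_polys P"
| add: "sum_of_hom_polys P \<Longrightarrow> sum_of_hom_polys Q \<Longrightarrow> sum_of_hom_polys (\<lambda>x. P x + Q x)"

lemma sum_of_hom_polys_sum:
  "(\<And>i. i \<in> A \<Longrightarrow> sum_of_hom_polys (p i)) \<Longrightarrow> sum_of_hom_polys (\<lambda>x. \<Sum>i\<in>A. p i x)"
  by (induction A rule: infinite_finite_induct)
    (auto intro: sum_of_hom_polys.hom[OF hom_poly_zero] sum_of_hom_polys.add)

lemma sum_of_hom_polys_coord: "sum_of_hom_polys p \<Longrightarrow> sum_of_hom_polys (\<lambda>x. x $ i *\<^sub>R p x)"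
  by (induction rule: sum_of_hom_polys.induct)
    (auto simp: scaleR_add_right intro: sum_of_hom_polys.intros hom_poly_coord)

lemma sum_of_hom_polys_scaleR: "sum_of_hom_polys p \<Longrightarrow> sum_of_hom_polys (\<lambda>x. c *\<^sub>R p x)"
  by (induction rule: sum_of_hom_polys.induct)
    (auto simp: scaleR_add_right intro: sum_of_hom_polys.intros hom_poly_scaleR)

lemma sum_of_hom_polys_real_polynomial:
  fixes r :: "real ^ 'n::{finite,linorder} \<Rightarrow> real"
  assumes "real_polynomial_function r" "sum_of_hom_polys p"
  shows "sum_of_hom_polys (\<lambda>x. r x *\<^sub>R p x)"
  using assms
proof (induction arbitrary: p rule: real_polynomial_function.induct)
  case (linear f)
  have "linear f" using linear(1) by (rule bounded_linear.linear)
  then have expand: "f x = (\<Sum>i\<in>UNIV. x $ i * f (axis i 1))" for x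
    using vec_eq_sum_axis[of x] linear_sum[of f "\<lambda>i. x $ i *\<^sub>R axis i 1" UNIV] by (simp add: linear_scale)
  have "(\<lambda>x. f x *\<^sub>R p x) = (\<lambda>x. \<Sum>i\<in>UNIV. x $ i *\<^sub>R (f (axis i 1) *\<^sub>R p x))"
    by (rule ext, subst expand) (simp add: scaleR_sum_left)
  moreover have "sum_of_hom_polys \<dots>"
    using linear(2) by (intro sum_of_hom_polys_sum sum_of_hom_polys_coord sum_of_hom_polys_scaleR)
  ultimately show ?case by simp
next
  case (const c)
  then show ?case by (rule sum_of_hom_polys_scaleR)
next
  case (add f g)
  then show ?case unfolding scaleR_add_left by (intro sum_of_hom_polys.add)
next
  case (mult f g)
  then have "sum_of_hom_polys (\<lambda>x. f x *\<^sub>R (g x *\<^sub>R p x))" by blast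
  then show ?case by simp
qed

lemma sum_of_hom_polys_polynomial:
  fixes p :: "real ^ 'n::{finite,linorder} \<Rightarrow> 'n clif"
  assumes "polynomial_function p"
  shows "sum_of_hom_polys p"
proof -
  have "sum_of_hom_polys (\<lambda>x. \<Sum>b\<in>Basis. inner (p x) b *\<^sub>R b)"
    using assms
    by (intro sum_of_hom_polys_sum sum_of_hom_polys_real_polynomial sum_of_hom_polys.hom[OF hom_poly_const])
      (auto simp: polynomial_function_iff_Basis_inner)
  then show ?thesis by (simp add: euclidean_representation)
qed

section \<open>The rotation invariant probability measure on the sphere\<close>

lemma nn_integral_lborel_translate:
  fixes f :: "'a::euclidean_space \<Rightarrow> ennreal"
  assumes [measurable]: "f \<in> borel_measurable borel"
  shows "(\<integral>\<^sup>+x. f (c + x) \<partial>lborel) = (\<integral>\<^sup>+x. f x \<partial>lborel)"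
proof -
  have "(\<integral>\<^sup>+x. f x \<partial>lborel) = (\<integral>\<^sup>+x. f x \<partial>distr lborel borel ((+) c))"
    by (simp only: lborel_distr_plus)
  also have "\<dots> = (\<integral>\<^sup>+x. f (c + x) \<partial>lborel)"
    by (rule nn_integral_distr) auto
  finally show ?thesis by simp
qed

lemma borel_measurable_linear:
  fixes T :: "'a::euclidean_space \<Rightarrow> 'b::euclidean_space"
  assumes "linear T"
  shows "T \<in> borel_measurable borel"
  using assms linear_continuous_on by (intro borel_measurable_continuous_onI) (simp add: linear_conv_bounded_linear)

text \<open>The computation behind the uniqueness of Haar measure: both sides integrate $g(y)\,f(y+Tx)$.\<close>

lemma nn_integral_mult_linear_image:
  fixes f g :: "'a::euclidean_space \<Rightarrow> ennreal"
  assumes T: "linear T" "surj T"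
    and [measurable]: "f \<in> borel_measurable borel" "g \<in> borel_measurable borel"
  shows "(\<integral>\<^sup>+y. g y \<partial>lborel) * (\<integral>\<^sup>+x. f (T x) \<partial>lborel) = (\<integral>\<^sup>+y. f y * (\<integral>\<^sup>+x. g (y - T x) \<partial>lborel) \<partial>lborel)"
proof -
  have [measurable]: "T \<in> borel_measurable borel" using T(1) by (rule borel_measurable_linear)
  have translate_f: "(\<integral>\<^sup>+x. f (T x) \<partial>lborel) = (\<integral>\<^sup>+x. f (y + T x) \<partial>lborel)" for y
    using nn_integral_lborel_translate[of "\<lambda>x. f (T x)" "inv T y"]
    by (simp add: linear_add[OF T(1)] surj_f_inv_f[OF T(2)])
  have translate_g: "(\<integral>\<^sup>+y. g y * f (y + T x) \<partial>lborel) = (\<integral>\<^sup>+y. g (y - T x) * f y \<partial>lborel)" for x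
    using nn_integral_lborel_translate[of "\<lambda>y. g (y - T x) * f y" "T x"] by (simp add: add.commute)
  have "(\<integral>\<^sup>+y. g y \<partial>lborel) * (\<integral>\<^sup>+x. f (T x) \<partial>lborel) = (\<integral>\<^sup>+y. g y * (\<integral>\<^sup>+x. f (T x) \<partial>lborel) \<partial>lborel)"
    by (simp add: nn_integral_multc)
  also have "\<dots> = (\<integral>\<^sup>+y. (\<integral>\<^sup>+x. g y * f (y + T x) \<partial>lborel) \<partial>lborel)"
    by (intro nn_integral_cong, subst translate_f) (simp add: nn_integral_cmult)
  also have "\<dots> = (\<integral>\<^sup>+x. (\<integral>\<^sup>+y. g y * f (y + T x) \<partial>lborel) \<partial>lborel)"
    by (rule lborel_pair.Fubini'[symmetric]) measurable
  also have "\<dots> = (\<integral>\<^sup>+y. (\<integral>\<^sup>+x. g (y - T x) * f y \<partial>lborel) \<partial>lborel)"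
    unfolding translate_g by (rule lborel_pair.Fubini') measurable
  also have "\<dots> = (\<integral>\<^sup>+y. f y * (\<integral>\<^sup>+x. g (y - T x) \<partial>lborel) \<partial>lborel)"
    by (simp add: nn_integral_cmult mult.commute)
  finally show ?thesis .
qed

lemma emeasure_unit_ball: "emeasure lborel (ball (0::'a::euclidean_space) 1) \<noteq> 0"
    "emeasure lborel (ball (0::'a::euclidean_space) 1) \<noteq> \<infinity>"
proof -
  have "0 < unit_ball_vol (real DIM('a))" by (simp add: unit_ball_vol_pos)
  then have "unit_ball_vol (real DIM('a)) \<noteq> 0" by linarith
  then show "emeasure lborel (ball (0::'a::euclidean_space) 1) \<noteq> 0"
    "emeasure lborel (ball (0::'a::euclidean_space) 1) \<noteq> \<infinity>"
    by (simp_all add: emeasure_ball)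
qed

lemma lborel_distr_orthogonal:
  fixes T :: "'a::euclidean_space \<Rightarrow> 'a"
  assumes T: "orthogonal_transformation T"
  shows "distr lborel borel T = lborel"
proof (rule measure_eqI)
  fix A assume "A \<in> sets (distr lborel borel T)"
  then have A [measurable]: "A \<in> sets borel" by simp
  have linear: "linear T" and surj: "surj T"
    using T by (simp_all add: orthogonal_transformation_linear orthogonal_transformation_surj)
  have [measurable]: "T \<in> borel_measurable borel" using linear by (rule borel_measurable_linear)
  let ?B = "ball 0 1 :: 'a set"
  have [measurable]: "ball c 1 \<in> sets borel" for c :: 'a by (rule borel_open[OF open_ball])
  have "norm (y - T x) = norm (inv T y - x)" for x y
    using orthogonal_transformation_norm[OF T, of "inv T y - x"]
    by (simp add: linear_diff[OF linear] surj_f_inv_f[OF surj])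
  then have preimage: "(\<integral>\<^sup>+x. indicator ?B (y - T x) \<partial>lborel) = (\<integral>\<^sup>+x. indicator (ball (inv T y) 1) x \<partial>lborel)" for y
    by (intro nn_integral_cong) (simp add: indicator_def dist_norm norm_minus_commute)
  have "(\<integral>\<^sup>+y. indicator ?B y \<partial>lborel) * (\<integral>\<^sup>+x. indicator A (T x) \<partial>lborel)
      = (\<integral>\<^sup>+y. indicator A y * (\<integral>\<^sup>+x. indicator ?B (y - T x) \<partial>lborel) \<partial>lborel)"
    by (rule nn_integral_mult_linear_image[OF linear surj]) measurable
  then have "emeasure lborel ?B * (\<integral>\<^sup>+x. indicator A (T x) \<partial>lborel) = emeasure lborel ?B * emeasure lborel A"
    unfolding preimage by (simp add: emeasure_ball nn_integral_multc mult.commute)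
  then have "(\<integral>\<^sup>+x. indicator A (T x) \<partial>lborel) = emeasure lborel A"
    using emeasure_unit_ball[where 'a='a] by (simp add: ennreal_mult_cancel_left)
  then show "emeasure (distr lborel borel T) A = emeasure lborel A"
    by (simp flip: nn_integral_distr[of T lborel borel "indicator A"])
qed simp

definition sphere_measure :: "'a::euclidean_space measure" where
  "sphere_measure = distr (uniform_measure lborel (ball 0 1)) borel (\<lambda>x. (1 / norm x) *\<^sub>R x)"

lemma sets_sphere_measure [simp, measurable_cong]: "sets sphere_measure = sets borel"
  and space_sphere_measure [simp]: "space sphere_measure = UNIV"
  by (simp_all add: sphere_measure_def)

lemma measurable_normalize [measurable]: "(\<lambda>x::'a::euclidean_space. (1 / norm x) *\<^sub>R x) \<in> borel_measurable borel"
  by measurable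

lemma emeasure_sphere_measure:
  fixes A :: "'a::euclidean_space set"
  assumes [measurable]: "A \<in> sets borel"
  shows "emeasure sphere_measure A
    = emeasure lborel (ball 0 1 \<inter> {x. (1 / norm x) *\<^sub>R x \<in> A}) / emeasure lborel (ball (0::'a) 1)"
  unfolding sphere_measure_def
  by (subst emeasure_distr) (auto simp: vimage_def)

lemma emeasure_sphere_measure_UNIV: "emeasure sphere_measure (UNIV :: 'a::euclidean_space set) = 1"
  using emeasure_unit_ball[where 'a='a] by (simp add: emeasure_sphere_measure ennreal_divide_self less_top)

interpretation sphere_measure: finite_measure "sphere_measure :: 'a::euclidean_space measure"
  by (rule finite_measureI) (simp add: emeasure_sphere_measure_UNIV)

lemma AE_sphere_measure: "AE w in sphere_measure. norm (w::'a::euclidean_space) = 1"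
proof -
  have "emeasure sphere_measure (- sphere (0::'a) 1) \<le> emeasure lborel {0::'a} / emeasure lborel (ball (0::'a) 1)"
    by (subst emeasure_sphere_measure) (auto intro!: divide_right_mono_ennreal emeasure_mono)
  then have "- sphere (0::'a) 1 \<in> null_sets sphere_measure" by auto
  then show ?thesis by (rule AE_I') auto
qed

lemma sphere_measure_distr_orthogonal:
  fixes T :: "'a::euclidean_space \<Rightarrow> 'a"
  assumes T: "orthogonal_transformation T"
  shows "distr sphere_measure borel T = sphere_measure"
proof (rule measure_eqI)
  fix A assume "A \<in> sets (distr sphere_measure borel T)"
  then have A [measurable]: "A \<in> sets borel" by simp
  have linear: "linear T" using T by (rule orthogonal_transformation_linear)
  then have T_measurable [measurable]: "T \<in> borel_measurable borel" by (rule borel_measurable_linear)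
  let ?cone = "ball 0 1 \<inter> {x. (1 / norm x) *\<^sub>R x \<in> A}"
  have "emeasure (distr sphere_measure borel T) A = emeasure sphere_measure (T -` A)"
    by (subst emeasure_distr) auto
  also have "\<dots> = emeasure lborel (ball 0 1 \<inter> {x. (1 / norm x) *\<^sub>R x \<in> T -` A}) / emeasure lborel (ball (0::'a) 1)"
    by (rule emeasure_sphere_measure) (rule measurable_sets_borel[OF T_measurable A])
  also have "ball 0 1 \<inter> {x. (1 / norm x) *\<^sub>R x \<in> T -` A} = T -` ?cone"
    by (auto simp: orthogonal_transformation_norm[OF T] linear_scale[OF linear])
  also have "emeasure lborel (T -` ?cone) = emeasure (distr lborel borel T) ?cone"
    by (subst emeasure_distr) auto
  also have "\<dots> / emeasure lborel (ball (0::'a) 1) = emeasure sphere_measure A"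
    by (simp add: lborel_distr_orthogonal[OF T] emeasure_sphere_measure)
  finally show "emeasure (distr sphere_measure borel T) A = emeasure sphere_measure A" .
qed simp

lemma continuous_on_compact_bound:
  fixes h :: "'a::topological_space \<Rightarrow> 'b::real_normed_vector"
  assumes "compact K" "continuous_on K h"
  obtains B where "0 \<le> B" "\<And>x. x \<in> K \<Longrightarrow> norm (h x) \<le> B"
proof -
  have "bounded (h ` K)" using assms by (intro compact_imp_bounded compact_continuous_image)
  then obtain B where "0 < B" "\<forall>y\<in>h ` K. norm y \<le> B" unfolding bounded_pos by blast
  then show ?thesis by (intro that[of B]) auto
qed

definition sphere_integral :: "('a::euclidean_space \<Rightarrow> real) \<Rightarrow> real" where
  "sphere_integral h = (LINT w:sphere 0 1|sphere_measure. h w)"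

lemma borel_measurable_indicator_sphere:
  "continuous_on (sphere 0 1) h \<Longrightarrow> (\<lambda>w. indicator (sphere 0 1) w *\<^sub>R h w) \<in> borel_measurable borel"
  for h :: "'a::euclidean_space \<Rightarrow> real"
  by (intro borel_measurable_continuous_on_indicator) auto

lemma set_integrable_sphere:
  assumes "continuous_on (sphere 0 1) h"
  shows "set_integrable sphere_measure (sphere 0 1) (h :: 'a::euclidean_space \<Rightarrow> real)"
proof -
  obtain B where "0 \<le> B" "\<And>w. w \<in> sphere 0 1 \<Longrightarrow> norm (h w) \<le> B"
    using continuous_on_compact_bound[OF compact_sphere assms] by blast
  then show ?thesis
    unfolding set_integrable_def using borel_measurable_indicator_sphere[OF assms]
    by (intro sphere_measure.integrable_const_bound[where B=B]) (auto intro!: AE_I2 simp: indicator_def)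
qed

lemma sphere_integral_add:
  "continuous_on (sphere 0 1) f \<Longrightarrow> continuous_on (sphere 0 1) g
    \<Longrightarrow> sphere_integral (\<lambda>w. f w + g w) = sphere_integral f + sphere_integral g"
  unfolding sphere_integral_def by (intro set_integral_add set_integrable_sphere)

lemma sphere_integral_diff:
  "continuous_on (sphere 0 1) f \<Longrightarrow> continuous_on (sphere 0 1) g
    \<Longrightarrow> sphere_integral (\<lambda>w. f w - g w) = sphere_integral f - sphere_integral g"
  unfolding sphere_integral_def by (intro set_integral_diff set_integrable_sphere)

lemma sphere_integral_cmult: "sphere_integral (\<lambda>w. c * f w) = c * sphere_integral f"
  unfolding sphere_integral_def by (rule set_integral_mult_right)

lemma sphere_integral_zero [simp]: "sphere_integral (\<lambda>w. 0) = 0"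
  by (simp add: sphere_integral_def)

lemma sphere_integral_minus: "sphere_integral (\<lambda>w. - f w) = - sphere_integral f"
  using sphere_integral_cmult[of "-1" f] by simp

lemma sphere_integral_sum:
  "(\<And>i. i \<in> I \<Longrightarrow> continuous_on (sphere 0 1) (f i))
    \<Longrightarrow> sphere_integral (\<lambda>w. \<Sum>i\<in>I. f i w) = (\<Sum>i\<in>I. sphere_integral (f i))"
  by (induction I rule: infinite_finite_induct) (auto simp: sphere_integral_add continuous_on_sum)

lemma sphere_integral_cong: "(\<And>w. norm w = 1 \<Longrightarrow> f w = g w) \<Longrightarrow> sphere_integral f = sphere_integral g"
  unfolding sphere_integral_def by (rule set_lebesgue_integral_cong) auto

lemma sphere_integral_mono:
  "continuous_on (sphere 0 1) f \<Longrightarrow> continuous_on (sphere 0 1) g \<Longrightarrow> (\<And>w. norm w = 1 \<Longrightarrow> f w \<le> g w)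
    \<Longrightarrow> sphere_integral f \<le> sphere_integral g"
  unfolding sphere_integral_def by (intro set_integral_mono set_integrable_sphere) auto

lemma sphere_integral_eq_lebesgue_integral:
  assumes "h \<in> borel_measurable borel"
  shows "sphere_integral h = (LINT w|sphere_measure. h w)"
  unfolding sphere_integral_def set_lebesgue_integral_def
  using AE_sphere_measure assms by (intro integral_cong_AE) (auto simp: indicator_def)

lemma sphere_integral_const: "sphere_integral (\<lambda>w::'a::euclidean_space. c) = c"
  using emeasure_sphere_measure_UNIV[where 'a='a]
  by (simp add: sphere_integral_eq_lebesgue_integral measure_def)

lemma sphere_integral_nonneg: "(\<And>w. norm w = 1 \<Longrightarrow> 0 \<le> f w) \<Longrightarrow> 0 \<le> sphere_integral f"
  unfolding sphere_integral_def set_lebesgue_integral_def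
  by (intro Bochner_Integration.integral_nonneg) (auto simp: indicator_def)

lemma abs_sphere_integral_le:
  fixes f :: "'a::euclidean_space \<Rightarrow> real"
  assumes "continuous_on (sphere 0 1) f" "\<And>w. norm w = 1 \<Longrightarrow> \<bar>f w\<bar> \<le> B"
  shows "\<bar>sphere_integral f\<bar> \<le> B"
proof -
  have "sphere_integral f \<le> sphere_integral (\<lambda>w::'a. B)" "sphere_integral (\<lambda>w::'a. - B) \<le> sphere_integral f"
    using assms(2) by (auto intro!: sphere_integral_mono assms(1) simp: abs_le_iff minus_le_iff)
  then show ?thesis by (simp add: sphere_integral_const)
qed

lemma sphere_integral_orthogonal:
  fixes T :: "'a::euclidean_space \<Rightarrow> 'a"
  assumes T: "orthogonal_transformation T" and h: "continuous_on (sphere 0 1) h"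
  shows "sphere_integral (\<lambda>w. h (T w)) = sphere_integral h"
proof -
  have [measurable]: "T \<in> borel_measurable borel"
    using T by (intro borel_measurable_linear orthogonal_transformation_linear)
  have "sphere_integral h = (LINT w|distr sphere_measure borel T. indicator (sphere 0 1) w *\<^sub>R h w)"
    by (simp add: sphere_integral_def set_lebesgue_integral_def sphere_measure_distr_orthogonal[OF T])
  also have "\<dots> = (LINT w|sphere_measure. indicator (sphere 0 1) (T w) *\<^sub>R h (T w))"
    using borel_measurable_indicator_sphere[OF h] by (intro integral_distr) auto
  also have "\<dots> = sphere_integral (\<lambda>w. h (T w))"
    by (simp add: sphere_integral_def set_lebesgue_integral_def indicator_def orthogonal_transformation_norm[OF T])
  finally show ?thesis by simp
qed

lemma dist_normalize_le:
  fixes x y :: "'a::real_inner"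
  assumes "x \<noteq> 0" "norm y = 1" "0 < r"
  shows "norm ((1 / norm x) *\<^sub>R x - y) \<le> 2 * norm (x - r *\<^sub>R y) / r"
proof -
  have "(1 / norm x) *\<^sub>R x - y = (1 / r) *\<^sub>R (((r - norm x) / norm x) *\<^sub>R x + (x - r *\<^sub>R y))"
    using assms by (simp add: algebra_simps diff_divide_distrib)
  also have "norm \<dots> \<le> (1 / r) * (norm (((r - norm x) / norm x) *\<^sub>R x) + norm (x - r *\<^sub>R y))"
    using mult_left_mono[OF norm_triangle_ineq[of "((r - norm x) / norm x) *\<^sub>R x" "x - r *\<^sub>R y"], of "1 / r"]
      assms(3) by simp
  also have "norm (((r - norm x) / norm x) *\<^sub>R x) = \<bar>norm (r *\<^sub>R y) - norm x\<bar>"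
    using assms by simp
  also have "\<dots> \<le> norm (x - r *\<^sub>R y)"
    by (metis norm_minus_commute norm_triangle_ineq3)
  finally show ?thesis using assms by (simp add: divide_simps mult.commute)
qed

lemma measure_sphere_measure_ball_ge:
  fixes y :: "'a::euclidean_space"
  assumes y: "norm y = 1" and d: "0 < d" "d \<le> 1"
  shows "(d / 4) ^ DIM('a) \<le> measure sphere_measure (ball y d)"
proof -
  have cone: "ball ((1/2) *\<^sub>R y) (d / 4) \<subseteq> ball 0 1 \<inter> {x. (1 / norm x) *\<^sub>R x \<in> ball y d}"
  proof
    fix x assume "x \<in> ball ((1/2) *\<^sub>R y) (d / 4)"
    then have close: "norm (x - (1/2) *\<^sub>R y) < d / 4" by (simp add: dist_norm norm_minus_commute)
    have "\<bar>norm x - 1/2\<bar> \<le> norm (x - (1/2) *\<^sub>R y)"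
      using norm_triangle_ineq3[of x "(1/2) *\<^sub>R y"] y by simp
    then have x: "norm x < 1" "x \<noteq> 0" using close d by auto
    have "norm ((1 / norm x) *\<^sub>R x - y) \<le> 2 * norm (x - (1/2) *\<^sub>R y) / (1/2)"
      using x y by (intro dist_normalize_le) auto
    also have "\<dots> < d" using close by simp
    finally show "x \<in> ball 0 1 \<inter> {x. (1 / norm x) *\<^sub>R x \<in> ball y d}"
      using x by (simp add: dist_norm norm_minus_commute)
  qed
  have vol: "unit_ball_vol (real DIM('a)) > 0" by (simp add: unit_ball_vol_pos)
  have "ennreal ((d / 4) ^ DIM('a)) = emeasure lborel (ball ((1/2) *\<^sub>R y) (d / 4)) / emeasure lborel (ball (0::'a) 1)"
    using d vol less_imp_neq[OF vol] by (simp add: emeasure_ball divide_ennreal)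
  also have "\<dots> \<le> emeasure sphere_measure (ball y d)"
    unfolding emeasure_sphere_measure[OF borel_open[OF open_ball]]
    using measurable_sets_borel[OF measurable_normalize borel_open[OF open_ball], of y d]
    by (intro divide_right_mono_ennreal emeasure_mono cone) (auto simp: vimage_def)
  finally show ?thesis
    unfolding sphere_measure.emeasure_eq_measure by (simp add: ennreal_le_iff)
qed

lemma sphere_integral_lower_bound:
  fixes h :: "'a::euclidean_space \<Rightarrow> real"
  assumes h: "continuous_on (sphere 0 1) h" "\<And>w. norm w = 1 \<Longrightarrow> 0 \<le> h w"
    and y: "norm y = 1" and d: "0 < d" "d \<le> 1" and c: "0 \<le> c"
    and low: "\<And>w. norm w = 1 \<Longrightarrow> dist y w < d \<Longrightarrow> c \<le> h w"
  shows "c * (d / 4) ^ DIM('a) \<le> sphere_integral h"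
proof -
  have "c * (d / 4) ^ DIM('a) \<le> c * measure sphere_measure (ball y d)"
    using measure_sphere_measure_ball_ge[OF y d] c by (rule mult_left_mono)
  also have "\<dots> = (LINT w|sphere_measure. c * indicator (ball y d) w)" by simp
  also have "\<dots> \<le> (LINT w|sphere_measure. indicator (sphere 0 1) w *\<^sub>R h w)"
  proof (rule integral_mono_AE)
    show "integrable sphere_measure (\<lambda>w. indicator (sphere 0 1) w *\<^sub>R h w)"
      using set_integrable_sphere[OF h(1)] by (simp add: set_integrable_def)
    show "AE w in sphere_measure. c * indicator (ball y d) w \<le> indicator (sphere 0 1) w *\<^sub>R h w"
      using AE_sphere_measure by eventually_elim (auto simp: indicator_def h(2) low)
  qed (auto simp: integrable_real_indicator sphere_measure.emeasure_eq_measure)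
  also have "\<dots> = sphere_integral h" by (simp add: sphere_integral_def set_lebesgue_integral_def)
  finally show ?thesis .
qed

lemma sphere_integral_eq_0_imp:
  fixes h :: "'a::euclidean_space \<Rightarrow> real"
  assumes h: "continuous_on (sphere 0 1) h" "\<And>w. norm w = 1 \<Longrightarrow> 0 \<le> h w" and integral: "sphere_integral h = 0"
    and y: "norm y = 1"
  shows "h y = 0"
proof (rule ccontr)
  assume "h y \<noteq> 0"
  then have pos: "0 < h y" using h(2)[OF y] by simp
  obtain d where d: "0 < d" "\<And>w. norm w = 1 \<Longrightarrow> dist w y < d \<Longrightarrow> dist (h w) (h y) < h y / 2"
    using h(1)[unfolded continuous_on_iff, rule_format, of y "h y / 2"] y pos by auto
  have "h y / 2 * (min d 1 / 4) ^ DIM('a) \<le> sphere_integral h"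
  proof (rule sphere_integral_lower_bound[OF h y])
    fix w :: 'a assume "norm w = 1" "dist y w < min d 1"
    then have "\<bar>h w - h y\<bar> < h y / 2" using d(2)[of w] by (simp add: dist_commute dist_real_def)
    then show "h y / 2 \<le> h w" by linarith
  qed (use d pos in auto)
  moreover have "0 < h y / 2 * (min d 1 / 4) ^ DIM('a)" using pos d(1) by simp
  ultimately show False using integral by simp
qed

lemma uniform_measure_unit_ball_eq_density:
  "uniform_measure lborel (ball (0::'a::euclidean_space) 1)
    = density lborel (\<lambda>x. ennreal (indicator (ball 0 1) x / measure lborel (ball (0::'a) 1)))"
  unfolding uniform_measure_def
  by (intro arg_cong[of _ _ "density lborel"] ext)
    (auto simp: indicator_def emeasure_eq_ennreal_measure emeasure_unit_ball[simplified] divide_ennreal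
      ennreal_1[symmetric] simp del: ennreal_1)

lemma sphere_integral_eq_ball_average:
  fixes h :: "'a::euclidean_space \<Rightarrow> real"
  assumes [measurable]: "h \<in> borel_measurable borel"
  shows "sphere_integral h
    = (LINT x|lborel. indicator (ball 0 1) x * h ((1 / norm x) *\<^sub>R x)) / measure lborel (ball (0::'a) 1)"
proof -
  have [measurable]: "ball (0::'a) 1 \<in> sets borel" by (rule borel_open[OF open_ball])
  have "sphere_integral h = (LINT w|sphere_measure. h w)"
    using assms by (rule sphere_integral_eq_lebesgue_integral)
  also have "\<dots> = (LINT x|uniform_measure lborel (ball (0::'a) 1). h ((1 / norm x) *\<^sub>R x))"
    unfolding sphere_measure_def by (rule integral_distr) auto
  also have "\<dots> = (LINT x|lborel.
      (indicator (ball (0::'a) 1) x / measure lborel (ball (0::'a) 1)) *\<^sub>R h ((1 / norm x) *\<^sub>R x))"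
    unfolding uniform_measure_unit_ball_eq_density by (rule integral_density) auto
  finally show ?thesis by simp
qed

lemma L2_norm_S_eq:
  fixes g :: "real ^ 'n::{finite,linorder} \<Rightarrow> 'n clif"
  assumes "continuous_on UNIV g"
  shows "L2_norm_S g = sqrt (sphere_integral (\<lambda>w. (norm (g w))\<^sup>2))"
proof -
  have [measurable]: "g \<in> borel_measurable borel"
    using assms by (rule borel_measurable_continuous_onI)
  show ?thesis by (simp add: sphere_integral_eq_ball_average L2_norm_S_def)
qed

lemma L2_norm_S_nonneg: "continuous_on UNIV g \<Longrightarrow> 0 \<le> L2_norm_S g"
  by (simp add: L2_norm_S_eq sphere_integral_nonneg)

lemma L2_norm_S_power2: "continuous_on UNIV g \<Longrightarrow> (L2_norm_S g)\<^sup>2 = sphere_integral (\<lambda>w. (norm (g w))\<^sup>2)"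
  by (simp add: L2_norm_S_eq sphere_integral_nonneg)

lemma integrable_indicator_compact_times:
  fixes K :: "'a::euclidean_space \<times> 'b::euclidean_space \<Rightarrow> real"
  assumes "sigma_finite_measure M" "sets M = sets borel" "emeasure M A < \<infinity>" "compact A"
    and "sigma_finite_measure N" "sets N = sets borel" "emeasure N B < \<infinity>" "compact B"
    and K: "continuous_on (A \<times> B) K"
  shows "integrable (M \<Otimes>\<^sub>M N) (\<lambda>x. indicator (A \<times> B) x *\<^sub>R K x)"
proof -
  interpret N: sigma_finite_measure N by fact
  have sets [measurable]: "A \<in> sets M" "B \<in> sets N"
    using assms by (simp_all add: borel_closed compact_imp_closed)
  obtain C where C: "\<And>x. x \<in> A \<times> B \<Longrightarrow> norm (K x) \<le> C"
    using continuous_on_compact_bound[OF compact_Times[OF \<open>compact A\<close> \<open>compact B\<close>] K] by blast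
  have "sets (M \<Otimes>\<^sub>M N) = sets (borel :: ('a \<times> 'b) measure)"
    using assms by (simp add: borel_prod[symmetric] cong: sets_pair_measure_cong)
  moreover have "(\<lambda>x. indicator (A \<times> B) x *\<^sub>R K x) \<in> borel_measurable borel"
    using assms by (intro borel_measurable_continuous_on_indicator borel_closed closed_Times compact_imp_closed)
  ultimately have measurable: "(\<lambda>x. indicator (A \<times> B) x *\<^sub>R K x) \<in> borel_measurable (M \<Otimes>\<^sub>M N)"
    using measurable_cong_sets by blast
  show ?thesis
  proof (rule integrableI_bounded_set[where A="A \<times> B" and B=C])
    show "emeasure (M \<Otimes>\<^sub>M N) (A \<times> B) < \<infinity>"
      unfolding N.emeasure_pair_measure_Times[OF sets] using assms(3,7) by (simp add: ennreal_mult_less_top)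
    show "(\<lambda>x. indicator (A \<times> B) x *\<^sub>R K x) \<in> borel_measurable (M \<Otimes>\<^sub>M N)" by (rule measurable)
  qed (use C in \<open>auto intro!: AE_I2 simp: indicator_def\<close>)
qed

lemma sphere_integral_integral_swap:
  fixes K :: "real \<Rightarrow> 'a::euclidean_space \<Rightarrow> real"
  assumes K: "continuous_on ({a..b} \<times> sphere 0 1) (\<lambda>(t, w). K t w)"
  shows "((\<lambda>t. sphere_integral (K t)) has_integral sphere_integral (\<lambda>w. integral {a..b} (\<lambda>t. K t w))) {a..b}"
proof -
  interpret pair_sigma_finite lborel "sphere_measure :: 'a measure"
    by (intro pair_sigma_finite.intro lborel.sigma_finite_measure_axioms sphere_measure.sigma_finite_measure_axioms)
  define H where "H t w = indicator ({a..b} \<times> sphere (0::'a) 1) (t, w) *\<^sub>R K t w" for t w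
  have "integrable (lborel \<Otimes>\<^sub>M (sphere_measure :: 'a measure))
      (\<lambda>x. indicator ({a..b} \<times> sphere 0 1) x *\<^sub>R (\<lambda>(t, w). K t w) x)"
    by (rule integrable_indicator_compact_times[OF _ _ _ _ _ _ _ _ K])
      (auto simp: emeasure_lborel_Icc_eq sphere_measure.emeasure_eq_measure
        lborel.sigma_finite_measure_axioms sphere_measure.sigma_finite_measure_axioms)
  then have H: "integrable (lborel \<Otimes>\<^sub>M (sphere_measure :: 'a measure)) (case_prod H)"
    by (simp add: H_def[abs_def] split_def)
  have over_interval: "(LINT t|lborel. H t w) = indicator (sphere 0 1) w *\<^sub>R integral {a..b} (\<lambda>t. K t w)" for w
  proof (cases "w \<in> sphere 0 1")
    case True
    have "continuous_on {a..b} (\<lambda>t. K t w)"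
      by (rule continuous_on_compose2[OF K, of _ "\<lambda>t. (t, w)", simplified])
          (use True in \<open>auto intro!: continuous_intros\<close>)
    from set_borel_integral_eq_integral(2)[OF borel_integrable_atLeastAtMost'[OF this]]
    show ?thesis using True by (simp add: H_def set_lebesgue_integral_def indicator_def)
  qed (simp add: H_def indicator_def)
  have over_sphere: "(LINT w|sphere_measure. H t w) = indicator {a..b} t *\<^sub>R sphere_integral (K t)" for t
    by (cases "t \<in> {a..b}") (auto simp: H_def sphere_integral_def set_lebesgue_integral_def indicator_def)
  have "set_integrable lborel {a..b} (\<lambda>t. sphere_integral (K t))"
    unfolding set_integrable_def over_sphere[symmetric] by (rule integrable_fst[OF H])
  from set_borel_integral_eq_integral[OF this]
  have "((\<lambda>t. sphere_integral (K t)) has_integral (LINT t|lborel. LINT w|sphere_measure. H t w)) {a..b}"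
    by (simp add: over_sphere set_lebesgue_integral_def integrable_integral)
  also have "(LINT t|lborel. LINT w|sphere_measure. H t w) = (LINT w|sphere_measure. LINT t|lborel. H t w)"
    by (rule Fubini_integral[OF H, symmetric])
  finally show ?thesis
    unfolding over_interval by (simp add: sphere_integral_def set_lebesgue_integral_def)
qed

definition plane_rotation :: "'n::finite \<Rightarrow> 'n \<Rightarrow> real \<Rightarrow> real ^ 'n \<Rightarrow> (real, 'n) vec" where
  "plane_rotation i j t x = x + ((cos t - 1) * x $ i - sin t * x $ j) *\<^sub>R axis i 1
                   + ((cos t - 1) * x $ j + sin t * x $ i) *\<^sub>R axis j 1"

definition rotation_field :: "'n::finite \<Rightarrow> 'n \<Rightarrow> real ^ 'n \<Rightarrow> (real, 'n) vec" where
  "rotation_field i j x = x $ i *\<^sub>R axis j 1 - x $ j *\<^sub>R axis i 1"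

lemma plane_rotation_0 [simp]: "plane_rotation i j 0 x = x"
  by (simp add: plane_rotation_def)

lemma norm_plane_rotation:
  assumes "i \<noteq> j"
  shows "norm (plane_rotation i j t x) = norm x"
proof -
  let ?a = "(cos t - 1) * x $ i - sin t * x $ j" and ?b = "(cos t - 1) * x $ j + sin t * x $ i"
  have inner_axes: "inner (axis i 1) (axis i (1::real)) = 1" "inner (axis j 1) (axis j (1::real)) = 1"
    "inner (axis i 1) (axis j (1::real)) = 0" "inner (axis j 1) (axis i (1::real)) = 0"
    "inner x (axis l 1) = x $ l" "inner (axis l 1) x = x $ l" for l
    using assms by (simp_all only: inner_axis_axis) (simp_all add: inner_axis inner_axis')
  have "inner (plane_rotation i j t x) (plane_rotation i j t x)
      = inner x x + 2 * ?a * x $ i + 2 * ?b * x $ j + ?a\<^sup>2 + ?b\<^sup>2"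
    by (simp add: plane_rotation_def inner_add_left inner_add_right inner_axes power2_eq_square algebra_simps)
  also have "\<dots> = inner x x + ((sin t)\<^sup>2 + (cos t)\<^sup>2 - 1) * ((x $ i)\<^sup>2 + (x $ j)\<^sup>2)"
  proof -
    have "e + 2 * ((c - 1) * p - s * q) * p + 2 * ((c - 1) * q + s * p) * q + ((c - 1) * p - s * q)\<^sup>2
      + ((c - 1) * q + s * p)\<^sup>2 = e + (s\<^sup>2 + c\<^sup>2 - 1) * (p\<^sup>2 + q\<^sup>2)" for c s p q e :: real
      by (simp add: power2_eq_square algebra_simps)
    then show ?thesis .
  qed
  also have "\<dots> = inner x x" by simp
  finally show ?thesis by (simp add: norm_eq_sqrt_inner)
qed

lemma orthogonal_transformation_plane_rotation:
  assumes "i \<noteq> j"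
  shows "orthogonal_transformation (plane_rotation i j t)"
  unfolding orthogonal_transformation
proof (intro conjI allI norm_plane_rotation assms)
  show "linear (plane_rotation i j t)"
    by (rule linearI) (simp_all add: plane_rotation_def algebra_simps)
qed

lemma has_vector_derivative_plane_rotation:
  assumes "i \<noteq> j"
  shows "((\<lambda>t. plane_rotation i j t x) has_vector_derivative rotation_field i j (plane_rotation i j t x))
      (at t within T)"
proof -
  have "((\<lambda>t. plane_rotation i j t x) has_vector_derivative
      ((- sin t * x $ i - cos t * x $ j) *\<^sub>R axis i 1 + (- sin t * x $ j + cos t * x $ i) *\<^sub>R axis j 1))
          (at t within T)"
    unfolding plane_rotation_def
    by (auto intro!: derivative_eq_intros simp: algebra_simps)
  moreover have "rotation_field i j (plane_rotation i j t x)
    = (- sin t * x $ i - cos t * x $ j) *\<^sub>R axis i 1 + (- sin t * x $ j + cos t * x $ i) *\<^sub>R axis j 1"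
    using assms by (simp add: rotation_field_def plane_rotation_def axis_def algebra_simps)
  ultimately show ?thesis by simp
qed

text \<open>The integral over the sphere of $h\circ R_1-h=\int_0^1 k\circ R_t\,dt$ vanishes, where $R_t$ is the rotation flow
  and $k$ the derivative of $h$ along it, and by invariance all the $k\circ R_t$ have the same integral.\<close>

lemma sphere_integral_rotation_derivative:
  fixes h :: "real ^ 'n \<Rightarrow> real"
  assumes h: "\<And>w. norm w = 1 \<Longrightarrow> (h has_derivative h' w) (at w)" and "i \<noteq> j"
    and cont: "continuous_on (sphere 0 1) (\<lambda>w. h' w (rotation_field i j w))"
  shows "sphere_integral (\<lambda>w. h' w (rotation_field i j w)) = 0"
proof -
  let ?R = "plane_rotation i j"
  define k where "k w = h' w (rotation_field i j w)" for w
  have norm_R: "norm (?R t x) = norm x" for t x using \<open>i \<noteq> j\<close> by (rule norm_plane_rotation)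
  note orth = orthogonal_transformation_plane_rotation[OF \<open>i \<noteq> j\<close>]
  have h_cont: "continuous_on (sphere 0 1) h"
    using has_derivative_continuous[OF h] by (auto intro!: continuous_at_imp_continuous_on)
  have hR_cont: "continuous_on (sphere 0 1) (\<lambda>w. h (?R t w))" for t
    by (rule continuous_on_compose2[OF h_cont linear_continuous_on])
      (auto simp: norm_R linear_conv_bounded_linear[symmetric] intro: orthogonal_transformation_linear orth)
  have kR_cont: "continuous_on ({0..1} \<times> sphere 0 1) (\<lambda>(t, w). k (?R t w))"
    unfolding split_def k_def
    by (rule continuous_on_compose2[OF cont]) (auto simp: plane_rotation_def norm_R[unfolded plane_rotation_def]
        intro!: continuous_intros)
  have deriv: "((\<lambda>t. h (?R t w)) has_vector_derivative k (?R t w)) (at t within T)" if "norm w = 1" for w t T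
    using vector_derivative_diff_chain_within[OF has_vector_derivative_plane_rotation[OF \<open>i \<noteq> j\<close>, of w t T]
        has_derivative_at_withinI[OF h]] that norm_R by (simp add: o_def k_def)
  have "integral {0..1} (\<lambda>t. k (?R t w)) = h (?R 1 w) - h (?R 0 w)" if "norm w = 1" for w
    using deriv[OF that] by (intro integral_unique fundamental_theorem_of_calculus) auto
  then have "sphere_integral (\<lambda>w. integral {0..1} (\<lambda>t. k (?R t w))) = sphere_integral (\<lambda>w. h (?R 1 w) - h w)"
    by (intro sphere_integral_cong) simp
  also have "\<dots> = 0"
    using sphere_integral_orthogonal[OF orth h_cont, of 1] by (simp add: sphere_integral_diff hR_cont h_cont)
  finally have "((\<lambda>t::real. sphere_integral k) has_integral 0) {0..1}"
    using sphere_integral_integral_swap[OF kR_cont] sphere_integral_orthogonal[OF orth cont]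
    by (simp add: k_def[abs_def])
  moreover have "((\<lambda>t::real. sphere_integral k) has_integral sphere_integral k) {0..1}"
    using has_integral_const_real[of "sphere_integral k" 0 1] by simp
  ultimately have "sphere_integral k = 0" by (rule has_integral_unique[rotated])
  then show ?thesis by (simp add: k_def[abs_def])
qed

section \<open>The spherical Dirac operator\<close>

definition sphere_inner :: "('a::euclidean_space \<Rightarrow> 'b::real_inner) \<Rightarrow> ('a \<Rightarrow> 'b) \<Rightarrow> real" where
  "sphere_inner f g = sphere_integral (\<lambda>w. inner (f w) (g w))"

lemma sphere_inner_cong:
  "(\<And>w. norm w = 1 \<Longrightarrow> f w = f' w) \<Longrightarrow> (\<And>w. norm w = 1 \<Longrightarrow> g w = g' w) \<Longrightarrow> sphere_inner f g = sphere_inner f' g'"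
  unfolding sphere_inner_def by (rule sphere_integral_cong) simp

lemma sphere_inner_commute: "sphere_inner f g = sphere_inner g f"
  by (simp add: sphere_inner_def inner_commute)

lemma sphere_inner_scaleR_right: "sphere_inner f (\<lambda>w. c *\<^sub>R g w) = c * sphere_inner f g"
  by (simp add: sphere_inner_def sphere_integral_cmult)

lemma sphere_inner_scaleR_left: "sphere_inner (\<lambda>w. c *\<^sub>R f w) g = c * sphere_inner f g"
  by (simp add: sphere_inner_def sphere_integral_cmult)

lemma sphere_inner_minus_right: "sphere_inner f (\<lambda>w. - g w) = - sphere_inner f g"
  by (simp add: sphere_inner_def sphere_integral_minus)

lemma sphere_inner_add_right:
  "continuous_on (sphere 0 1) f \<Longrightarrow> continuous_on (sphere 0 1) g \<Longrightarrow> continuous_on (sphere 0 1) h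
    \<Longrightarrow> sphere_inner f (\<lambda>w. g w + h w) = sphere_inner f g + sphere_inner f h"
  unfolding sphere_inner_def inner_add_right by (intro sphere_integral_add continuous_intros)

lemma sphere_inner_add_left:
  "continuous_on (sphere 0 1) f \<Longrightarrow> continuous_on (sphere 0 1) g \<Longrightarrow> continuous_on (sphere 0 1) h
    \<Longrightarrow> sphere_inner (\<lambda>w. g w + h w) f = sphere_inner g f + sphere_inner h f"
  by (subst (1 2 3) sphere_inner_commute) (rule sphere_inner_add_right)

lemma sphere_inner_diff_right:
  "continuous_on (sphere 0 1) f \<Longrightarrow> continuous_on (sphere 0 1) g \<Longrightarrow> continuous_on (sphere 0 1) h
    \<Longrightarrow> sphere_inner f (\<lambda>w. g w - h w) = sphere_inner f g - sphere_inner f h"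
  unfolding sphere_inner_def inner_diff_right by (intro sphere_integral_diff continuous_intros)

lemma sphere_inner_diff_left:
  "continuous_on (sphere 0 1) f \<Longrightarrow> continuous_on (sphere 0 1) g \<Longrightarrow> continuous_on (sphere 0 1) h
    \<Longrightarrow> sphere_inner (\<lambda>w. g w - h w) f = sphere_inner g f - sphere_inner h f"
  by (subst (1 2 3) sphere_inner_commute) (rule sphere_inner_diff_right)

lemma sphere_inner_sum_right:
  "continuous_on (sphere 0 1) f \<Longrightarrow> (\<And>i. i \<in> I \<Longrightarrow> continuous_on (sphere 0 1) (g i))
    \<Longrightarrow> sphere_inner f (\<lambda>w. \<Sum>i\<in>I. g i w) = (\<Sum>i\<in>I. sphere_inner f (g i))"
  unfolding sphere_inner_def inner_sum_right by (intro sphere_integral_sum continuous_intros)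

lemma sphere_inner_sum_left:
  "continuous_on (sphere 0 1) f \<Longrightarrow> (\<And>i. i \<in> I \<Longrightarrow> continuous_on (sphere 0 1) (g i))
    \<Longrightarrow> sphere_inner (\<lambda>w. \<Sum>i\<in>I. g i w) f = (\<Sum>i\<in>I. sphere_inner (g i) f)"
  by (subst (1 2) sphere_inner_commute) (rule sphere_inner_sum_right)

lemma abs_sphere_inner_le:
  assumes "continuous_on (sphere 0 1) f" "continuous_on (sphere 0 1) g"
    and "\<And>w. norm w = 1 \<Longrightarrow> norm (f w) \<le> A" "\<And>w. norm w = 1 \<Longrightarrow> norm (g w) \<le> B"
  shows "\<bar>sphere_inner f g\<bar> \<le> A * B"
  unfolding sphere_inner_def
proof (rule abs_sphere_integral_le)
  show "continuous_on (sphere 0 1) (\<lambda>w. inner (f w) (g w))" by (intro continuous_intros assms)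
  fix w :: 'a assume w: "norm w = 1"
  have "norm (f w) * norm (g w) \<le> A * B"
    using assms(3,4)[OF w] norm_ge_zero order_trans by (intro mult_mono) blast+
  then show "\<bar>inner (f w) (g w)\<bar> \<le> A * B"
    using Cauchy_Schwarz_ineq2 order_trans by blast
qed

lemma sphere_inner_self_eq_0_imp:
  assumes "continuous_on (sphere 0 1) f" "sphere_inner f f = 0" "norm w = 1"
  shows "f w = 0"
proof -
  have "inner (f w) (f w) = 0"
    by (rule sphere_integral_eq_0_imp[of "\<lambda>w. inner (f w) (f w)"])
      (use assms in \<open>auto simp: sphere_inner_def intro!: continuous_intros\<close>)
  then show ?thesis by simp
qed

definition C1_sphere :: "(real ^ 'n::finite \<Rightarrow> 'b::real_normed_vector) \<Rightarrow> bool" where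
  "C1_sphere F \<longleftrightarrow> (\<forall>w. norm w = 1 \<longrightarrow> F differentiable at w) \<and> (\<forall>i. continuous_on (sphere 0 1) (partial_deriv F i))"

lemma C1_sphere_continuous: "C1_sphere F \<Longrightarrow> continuous_on (sphere 0 1) F"
  unfolding C1_sphere_def
  by (intro continuous_at_imp_continuous_on ballI differentiable_imp_continuous_within) simp

lemma C1_sphere_hom_poly:
  assumes "hom_poly k P"
  shows "C1_sphere P"
proof -
  have "continuous_on (sphere 0 1) (partial_deriv P i)" for i
    using hom_poly_partial_deriv_cases[OF assms, of i] by (cases "k = 0") (auto intro: hom_poly_continuous_on)
  then show ?thesis using hom_poly_differentiable[OF assms] by (simp add: C1_sphere_def)
qed

definition angular_deriv :: "'n \<Rightarrow> 'n \<Rightarrow> (real ^ 'n::finite \<Rightarrow> 'b::real_normed_vector) \<Rightarrow> (real, 'n) vec \<Rightarrow> 'b" where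
  "angular_deriv i j F x = x $ i *\<^sub>R partial_deriv F j x - x $ j *\<^sub>R partial_deriv F i x"

lemma angular_deriv_same [simp]: "angular_deriv i i F x = 0"
  by (simp add: angular_deriv_def)

lemma frechet_derivative_rotation_field:
  assumes "F differentiable at x"
  shows "frechet_derivative F (at x) (rotation_field i j x) = angular_deriv i j F x"
proof -
  have "linear (frechet_derivative F (at x))" using assms by (rule linear_frechet_derivative)
  then show ?thesis
    by (simp add: rotation_field_def angular_deriv_def partial_deriv_def linear_diff linear_scale)
qed

lemma angular_deriv_linear:
  "bounded_linear L \<Longrightarrow> F differentiable at x \<Longrightarrow> angular_deriv i j (\<lambda>x. L (F x)) x = L (angular_deriv i j F x)"
  by (simp add: angular_deriv_def partial_deriv_linear linear_diff linear_scale bounded_linear.linear)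

lemma C1_sphere_linear:
  assumes L: "bounded_linear L" and F: "C1_sphere F"
  shows "C1_sphere (\<lambda>x. L (F x))"
  unfolding C1_sphere_def
proof (intro conjI allI impI)
  show "(\<lambda>x. L (F x)) differentiable at w" if "norm w = 1" for w
    using F that bounded_linear.has_derivative[OF L] unfolding C1_sphere_def differentiable_def by blast
  have "continuous_on (sphere 0 1) (\<lambda>w. L (partial_deriv F i w))" for i
    using F by (intro bounded_linear.continuous_on[OF L]) (simp add: C1_sphere_def)
  then show "continuous_on (sphere 0 1) (partial_deriv (\<lambda>x. L (F x)) i)" for i
    by (rule continuous_on_eq) (use F in \<open>simp add: C1_sphere_def partial_deriv_linear[OF L]\<close>)
qed

lemma continuous_on_angular_deriv: "C1_sphere F \<Longrightarrow> continuous_on (sphere 0 1) (angular_deriv i j F)"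
  unfolding angular_deriv_def[abs_def] C1_sphere_def by (intro continuous_intros) auto

lemma angular_deriv_by_parts:
  fixes F G :: "real ^ 'n::finite \<Rightarrow> 'b::real_inner"
  assumes F: "C1_sphere F" and G: "C1_sphere G"
  shows "sphere_inner (angular_deriv i j F) G = - sphere_inner F (angular_deriv i j G)"
proof (cases "i = j")
  case True
  then show ?thesis by (simp add: sphere_inner_def)
next
  case False
  note cont = C1_sphere_continuous[OF F] C1_sphere_continuous[OF G]
    continuous_on_angular_deriv[OF F] continuous_on_angular_deriv[OF G]
  define h' where
    "h' w v = inner (F w) (frechet_derivative G (at w) v) + inner (frechet_derivative F (at w) v) (G w)" for w v
  have deriv: "((\<lambda>w. inner (F w) (G w)) has_derivative h' w) (at w)" if "norm w = 1" for w
    unfolding h'_def using F G that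
    by (intro has_derivative_inner has_derivative_frechet) (auto simp: C1_sphere_def)
  have h'_rotation: "h' w (rotation_field i j w)
      = inner (F w) (angular_deriv i j G w) + inner (angular_deriv i j F w) (G w)"
    if "norm w = 1" for w
    using F G that unfolding h'_def by (simp add: C1_sphere_def frechet_derivative_rotation_field)
  have "continuous_on (sphere 0 1) (\<lambda>w. inner (F w) (angular_deriv i j G w) + inner (angular_deriv i j F w) (G w))"
    by (intro continuous_intros cont)
  then have "continuous_on (sphere 0 1) (\<lambda>w. h' w (rotation_field i j w))"
    by (rule continuous_on_eq) (simp add: h'_rotation)
  then have "sphere_integral (\<lambda>w. h' w (rotation_field i j w)) = 0"
    by (rule sphere_integral_rotation_derivative[OF _ False, rotated]) (rule deriv)
  also have "sphere_integral (\<lambda>w. h' w (rotation_field i j w)) =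
      sphere_integral (\<lambda>w. inner (F w) (angular_deriv i j G w) + inner (angular_deriv i j F w) (G w))"
    by (rule sphere_integral_cong) (rule h'_rotation)
  also have "\<dots> = sphere_inner F (angular_deriv i j G) + sphere_inner (angular_deriv i j F) G"
    unfolding sphere_inner_def by (intro sphere_integral_add continuous_intros cont)
  finally show ?thesis by simp
qed

definition spherical_dirac :: "(real ^ 'n::{finite,linorder} \<Rightarrow> 'n clif) \<Rightarrow> (real, 'n) vec \<Rightarrow> 'n clif" where
  "spherical_dirac F x = - (cl_vec x \<star> dirac F x) - euler F x"

lemma spherical_dirac_eq_angular:
  "spherical_dirac F x = - ((1/2) *\<^sub>R (\<Sum>i\<in>UNIV. \<Sum>j\<in>UNIV. cl_e i \<star> (cl_e j \<star> angular_deriv i j F x)))"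
proof -
  have "(\<Sum>j\<in>UNIV. cl_e i \<star> (cl_e j \<star> angular_deriv i j F x))
      = x $ i *\<^sub>R (cl_e i \<star> dirac F x) - cl_e i \<star> (cl_vec x \<star> partial_deriv F i x)" for i
    unfolding cl_vec_mult[of x]
    by (simp add: angular_deriv_def dirac_def cl_mult.diff_right cl_mult.scaleR_right cl_mult.sum_right
        sum_subtractf scaleR_sum_right)
  then have "(\<Sum>i\<in>UNIV. \<Sum>j\<in>UNIV. cl_e i \<star> (cl_e j \<star> angular_deriv i j F x))
      = cl_vec x \<star> dirac F x - (\<Sum>i\<in>UNIV. cl_e i \<star> (cl_vec x \<star> partial_deriv F i x))"
    by (simp add: sum_subtractf cl_vec_mult)
  also have "(\<Sum>i\<in>UNIV. cl_e i \<star> (cl_vec x \<star> partial_deriv F i x)) = - (cl_vec x \<star> dirac F x) - 2 *\<^sub>R euler F x"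
    by (simp add: cl_e_cl_vec_mult sum_subtractf sum_negf dirac_def euler_def cl_mult.sum_right scaleR_sum_right)
  finally show ?thesis by (simp add: spherical_dirac_def algebra_simps flip: scaleR_2)
qed

lemma bivector_angular_deriv_symmetric:
  fixes F G :: "real ^ 'n::{finite,linorder} \<Rightarrow> 'n clif"
  assumes F: "C1_sphere F" and G: "C1_sphere G"
  shows "sphere_inner (\<lambda>w. cl_e i \<star> (cl_e j \<star> angular_deriv i j F w)) G
    = sphere_inner F (\<lambda>w. cl_e i \<star> (cl_e j \<star> angular_deriv i j G w))"
proof (cases "i = j")
  case True
  then show ?thesis by (simp add: sphere_inner_def cl_mult.zero_right)
next
  case False
  have bounded: "bounded_linear (\<lambda>y. cl_e j \<star> (cl_e i \<star> y))"
    by (intro bounded_linear_compose[OF cl_mult.bounded_linear_right cl_mult.bounded_linear_right])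
  have "sphere_inner (\<lambda>w. cl_e i \<star> (cl_e j \<star> angular_deriv i j F w)) G
      = sphere_inner (angular_deriv i j F) (\<lambda>w. cl_e j \<star> (cl_e i \<star> G w))"
    by (simp add: sphere_inner_def inner_cl_e_mult)
  also have "\<dots> = - sphere_inner F (angular_deriv i j (\<lambda>w. cl_e j \<star> (cl_e i \<star> G w)))"
    by (rule angular_deriv_by_parts[OF F C1_sphere_linear[OF bounded G]])
  also have "\<dots> = - sphere_inner F (\<lambda>w. - (cl_e i \<star> (cl_e j \<star> angular_deriv i j G w)))"
  proof (intro arg_cong[of _ _ uminus] sphere_inner_cong refl)
    fix w :: "(real, 'n) vec" assume "norm w = 1"
    then have "angular_deriv i j (\<lambda>w. cl_e j \<star> (cl_e i \<star> G w)) w = cl_e j \<star> (cl_e i \<star> angular_deriv i j G w)"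
      using G by (intro angular_deriv_linear[OF bounded]) (simp add: C1_sphere_def)
    then show "angular_deriv i j (\<lambda>w. cl_e j \<star> (cl_e i \<star> G w)) w = - (cl_e i \<star> (cl_e j \<star> angular_deriv i j G w))"
      using cl_e_anticommute[of i j "angular_deriv i j G w"] False by (simp add: add_eq_0_iff)
  qed
  finally show ?thesis by (simp add: sphere_inner_minus_right)
qed

lemma spherical_dirac_symmetric:
  fixes F G :: "real ^ 'n::{finite,linorder} \<Rightarrow> 'n clif"
  assumes F: "C1_sphere F" and G: "C1_sphere G"
  shows "sphere_inner (spherical_dirac F) G = sphere_inner F (spherical_dirac G)"
proof -
  note cont = C1_sphere_continuous[OF F] C1_sphere_continuous[OF G]
    continuous_on_angular_deriv[OF F] continuous_on_angular_deriv[OF G]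
  have "sphere_inner (spherical_dirac F) G = (- 1/2) *
      (\<Sum>i\<in>UNIV. \<Sum>j\<in>UNIV. sphere_inner (\<lambda>w. cl_e i \<star> (cl_e j \<star> angular_deriv i j F w)) G)"
    unfolding spherical_dirac_eq_angular[abs_def] scaleR_minus_left[symmetric] sphere_inner_scaleR_left
    by (subst sphere_inner_sum_left, intro cont, intro continuous_intros cont,
        subst sphere_inner_sum_left, intro cont, intro continuous_intros cont) simp
  also have "\<dots> = (- 1/2) *
      (\<Sum>i\<in>UNIV. \<Sum>j\<in>UNIV. sphere_inner F (\<lambda>w. cl_e i \<star> (cl_e j \<star> angular_deriv i j G w)))"
    by (simp only: bivector_angular_deriv_symmetric[OF F G])
  also have "\<dots> = sphere_inner F (spherical_dirac G)"
    unfolding spherical_dirac_eq_angular[abs_def] scaleR_minus_left[symmetric] sphere_inner_scaleR_right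
    by (subst sphere_inner_sum_right, intro cont, intro continuous_intros cont,
        subst sphere_inner_sum_right, intro cont, intro continuous_intros cont) simp
  finally show ?thesis .
qed

definition sph_monogenic :: "nat \<Rightarrow> (real ^ 'n::{finite,linorder} \<Rightarrow> 'n clif) \<Rightarrow> (real, 'n) vec \<Rightarrow> 'n clif" where
  "sph_monogenic k P = (if even k then P else vec_mult P)"

definition dirac_eigenvalue :: "nat \<Rightarrow> nat \<Rightarrow> real" where
  "dirac_eigenvalue n k = (if even k then - real k else real n + real k - 1)"

lemma slice_act_i_power:
  assumes "norm w = 1"
  shows "slice_act w (\<i> ^ k) (P w) = (-1) ^ (k div 2) *\<^sub>R sph_monogenic k P w"
proof (cases "even k")
  case True
  then have "\<i> ^ k = of_real ((-1) ^ (k div 2))" by (elim evenE) (simp add: power_mult)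
  then show ?thesis using True unfolding sph_monogenic_def by (simp only: slice_act_of_real if_True)
next
  case False
  then have "\<i> ^ k = of_real ((-1) ^ (k div 2)) * \<i>" by (elim oddE) (simp add: power_mult power_add)
  then show ?thesis using False unfolding sph_monogenic_def
    by (simp only: slice_act_mult[OF assms] slice_act_of_real slice_act_ii if_False vec_mult_def)
qed

lemma sph_monogenic_scaleR: "sph_monogenic k (\<lambda>w. c *\<^sub>R P w) = (\<lambda>w. c *\<^sub>R sph_monogenic k P w)"
  by (auto simp: sph_monogenic_def vec_mult_def cl_mult.scaleR_right fun_eq_iff)

lemma sph_monogenic_diff: "sph_monogenic k (\<lambda>w. P w - Q w) = (\<lambda>w. sph_monogenic k P w - sph_monogenic k Q w)"
  by (auto simp: sph_monogenic_def vec_mult_def cl_mult.diff_right fun_eq_iff)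

lemma norm_sph_monogenic: "norm w = 1 \<Longrightarrow> norm (sph_monogenic k P w) = norm (P w)"
  by (simp add: sph_monogenic_def vec_mult_def norm_cl_vec_mult)

lemma hom_poly_sph_monogenic: "hom_poly k P \<Longrightarrow> hom_poly (if even k then k else Suc k) (sph_monogenic k P)"
  by (auto simp: sph_monogenic_def intro: hom_poly_vec_mult)

lemma continuous_on_sph_monogenic: "monogenic_hom k P \<Longrightarrow> continuous_on S (sph_monogenic k P)"
  by (rule hom_poly_continuous_on[OF hom_poly_sph_monogenic[OF monogenic_hom_imp_hom_poly]])

lemma C1_sphere_sph_monogenic: "monogenic_hom k P \<Longrightarrow> C1_sphere (sph_monogenic k P)"
  by (rule C1_sphere_hom_poly[OF hom_poly_sph_monogenic[OF monogenic_hom_imp_hom_poly]])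

lemma spherical_dirac_sph_monogenic:
  fixes P :: "real ^ 'n::{finite,linorder} \<Rightarrow> 'n clif"
  assumes "monogenic_hom k P"
  shows "spherical_dirac (sph_monogenic k P) = (\<lambda>x. dirac_eigenvalue CARD('n) k *\<^sub>R sph_monogenic k P x)"
proof
  fix x
  have P: "hom_poly k P" "dirac P x = 0" using assms by (auto simp: monogenic_hom_iff)
  show "spherical_dirac (sph_monogenic k P) x = dirac_eigenvalue CARD('n) k *\<^sub>R sph_monogenic k P x"
  proof (cases "even k")
    case True
    then show ?thesis
      using P by (simp add: spherical_dirac_def sph_monogenic_def dirac_eigenvalue_def euler_hom_poly
          cl_mult.zero_right)
  next
    case False
    have "dirac (vec_mult P) x = - ((real CARD('n) + 2 * real k) *\<^sub>R P x)"
      using dirac_vec_mult_funpow[OF assms, of 0 x]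
      by (simp add: fischer_const_def scaleR_left_diff_distrib scaleR_add_left)
    then have "spherical_dirac (vec_mult P) x
        = (real CARD('n) + 2 * real k) *\<^sub>R vec_mult P x - real (Suc k) *\<^sub>R vec_mult P x"
      using euler_hom_poly[OF hom_poly_vec_mult[OF P(1)], of x]
      by (simp add: spherical_dirac_def cl_mult.minus_right cl_mult.scaleR_right vec_mult_def)
    also have "\<dots> = (real CARD('n) + 2 * real k - real (Suc k)) *\<^sub>R vec_mult P x"
      by (simp only: scaleR_left_diff_distrib)
    finally show ?thesis using False by (simp add: sph_monogenic_def dirac_eigenvalue_def algebra_simps)
  qed
qed

lemma dirac_eigenvalue_inj: "0 < n \<Longrightarrow> dirac_eigenvalue n k = dirac_eigenvalue n l \<Longrightarrow> k = l"
  by (auto simp: dirac_eigenvalue_def split: if_splits)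

lemma abs_dirac_eigenvalue_ge: "0 < n \<Longrightarrow> real k \<le> \<bar>dirac_eigenvalue n k\<bar>"
  by (auto simp: dirac_eigenvalue_def)

lemma sphere_inner_spherical_dirac_funpow:
  fixes F :: "real ^ 'n::{finite,linorder} \<Rightarrow> 'n clif"
  assumes "\<And>l. l < m \<Longrightarrow> C1_sphere ((spherical_dirac ^^ l) F)" and Q: "monogenic_hom k Q"
  shows "sphere_inner ((spherical_dirac ^^ m) F) (sph_monogenic k Q)
    = dirac_eigenvalue CARD('n) k ^ m * sphere_inner F (sph_monogenic k Q)"
  using assms(1)
proof (induction m)
  case (Suc m)
  have "sphere_inner ((spherical_dirac ^^ Suc m) F) (sph_monogenic k Q)
      = sphere_inner ((spherical_dirac ^^ m) F) (spherical_dirac (sph_monogenic k Q))"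
    using spherical_dirac_symmetric[OF Suc.prems C1_sphere_sph_monogenic[OF Q]] by simp
  also have "\<dots> = dirac_eigenvalue CARD('n) k * sphere_inner ((spherical_dirac ^^ m) F) (sph_monogenic k Q)"
    by (simp add: spherical_dirac_sph_monogenic[OF Q] sphere_inner_scaleR_right)
  finally show ?case using Suc by simp
qed simp

lemma sph_monogenic_orthogonal:
  fixes P Q :: "real ^ 'n::{finite,linorder} \<Rightarrow> 'n clif"
  assumes P: "monogenic_hom k P" and Q: "monogenic_hom l Q" and "k \<noteq> l"
  shows "sphere_inner (sph_monogenic k P) (sph_monogenic l Q) = 0"
proof -
  have "dirac_eigenvalue CARD('n) k * sphere_inner (sph_monogenic k P) (sph_monogenic l Q)
      = dirac_eigenvalue CARD('n) l * sphere_inner (sph_monogenic k P) (sph_monogenic l Q)"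
    using spherical_dirac_symmetric[OF C1_sphere_sph_monogenic[OF P] C1_sphere_sph_monogenic[OF Q]]
    by (simp add: spherical_dirac_sph_monogenic[OF P] spherical_dirac_sph_monogenic[OF Q]
        sphere_inner_scaleR_left sphere_inner_scaleR_right)
  then show ?thesis using dirac_eigenvalue_inj[of "CARD('n)" k l] \<open>k \<noteq> l\<close> by auto
qed

section \<open>Fourier coefficients\<close>

lemma continuous_on_cis [continuous_intros]: "continuous_on S f \<Longrightarrow> continuous_on S (\<lambda>x. cis (f x))"
  unfolding cis_conv_exp by (intro continuous_intros)

lemma has_vector_derivative_cis:
  "((\<lambda>\<theta>. cis (c * \<theta>)) has_vector_derivative (\<i> * of_real c * cis (c * \<theta>))) (at \<theta> within S)"
proof -
  have "((\<lambda>z. exp (\<i> * of_real c * z)) has_field_derivative \<i> * of_real c * exp (\<i> * of_real c * of_real \<theta>))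
      (at (of_real \<theta>))"
    by (auto intro!: derivative_eq_intros)
  from has_vector_derivative_real_field[OF this] show ?thesis
    by (simp add: cis_conv_exp mult_ac has_vector_derivative_at_within)
qed

lemma has_vector_derivative_slice_act_cis:
  "((\<lambda>\<theta>. slice_act w (cis (c * \<theta>)) x) has_vector_derivative slice_act w (\<i> * of_real c * cis (c * \<theta>)) x)
      (at \<theta> within S)"
  by (rule bounded_linear.has_vector_derivative[OF slice_act.bounded_linear_left has_vector_derivative_cis])

definition fourier_coeff :: "real ^ 'n::{finite,linorder} \<Rightarrow> int \<Rightarrow> (real \<Rightarrow> 'n clif) \<Rightarrow> 'n clif" where
  "fourier_coeff w m T
    = (1 / (2 * pi)) *\<^sub>R integral {0..2 * pi} (\<lambda>\<theta>. slice_act w (cis (- (real_of_int m * \<theta>))) (T \<theta>))"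

lemma fourier_integrable:
  "continuous_on {0..2 * pi} T \<Longrightarrow> (\<lambda>\<theta>. slice_act w (cis (- (real_of_int m * \<theta>))) (T \<theta>)) integrable_on {0..2 * pi}"
  by (intro integrable_continuous_real continuous_intros)

lemma fourier_coeff_add:
  "continuous_on {0..2 * pi} T \<Longrightarrow> continuous_on {0..2 * pi} U
    \<Longrightarrow> fourier_coeff w m (\<lambda>\<theta>. T \<theta> + U \<theta>) = fourier_coeff w m T + fourier_coeff w m U"
  unfolding fourier_coeff_def by (simp add: slice_act.add_right integral_add fourier_integrable scaleR_add_right)

lemma fourier_coeff_diff:
  "continuous_on {0..2 * pi} T \<Longrightarrow> continuous_on {0..2 * pi} U
    \<Longrightarrow> fourier_coeff w m (\<lambda>\<theta>. T \<theta> - U \<theta>) = fourier_coeff w m T - fourier_coeff w m U"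
  unfolding fourier_coeff_def by (simp add: slice_act.diff_right integral_diff fourier_integrable scaleR_diff_right)

lemma fourier_coeff_scaleR: "fourier_coeff w m (\<lambda>\<theta>. c *\<^sub>R T \<theta>) = c *\<^sub>R fourier_coeff w m T"
  unfolding fourier_coeff_def by (simp add: slice_act.scaleR_right)

lemma fourier_coeff_zero: "fourier_coeff w m (\<lambda>\<theta>. 0) = 0"
  unfolding fourier_coeff_def by (simp add: slice_act.zero_right)

lemma fourier_coeff_sum:
  "(\<And>i. i \<in> A \<Longrightarrow> continuous_on {0..2 * pi} (T i))
    \<Longrightarrow> fourier_coeff w m (\<lambda>\<theta>. \<Sum>i\<in>A. T i \<theta>) = (\<Sum>i\<in>A. fourier_coeff w m (T i))"
  by (induction A rule: infinite_finite_induct)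
    (simp_all add: fourier_coeff_zero fourier_coeff_add continuous_on_sum)

lemma fourier_coeff_slice_act:
  assumes w: "norm w = 1" and T: "continuous_on {0..2 * pi} T"
  shows "fourier_coeff w m (\<lambda>\<theta>. slice_act w z (T \<theta>)) = slice_act w z (fourier_coeff w m T)"
proof -
  have "slice_act w (cis \<phi>) (slice_act w z x) = slice_act w z (slice_act w (cis \<phi>) x)" for \<phi> x
    by (simp add: mult.commute flip: slice_act_mult[OF w])
  then show ?thesis
    using integral_linear[OF fourier_integrable[OF T, of w m] slice_act.bounded_linear_right, of w z]
    by (simp add: fourier_coeff_def slice_act.scaleR_right o_def)
qed

lemma fourier_coeff_shift:
  assumes w: "norm w = 1"
  shows "fourier_coeff w m (\<lambda>\<theta>. slice_act w (cis (real_of_int l * \<theta>)) (T \<theta>)) = fourier_coeff w (m - l) T"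
  unfolding fourier_coeff_def by (simp add: cis_mult algebra_simps flip: slice_act_mult[OF w])

lemma norm_fourier_coeff_le:
  assumes "continuous_on {0..2 * pi} T" "\<And>\<theta>. \<theta> \<in> {0..2 * pi} \<Longrightarrow> norm (T \<theta>) \<le> M" "norm w = 1"
  shows "norm (fourier_coeff w m T) \<le> M"
proof -
  have "norm (integral {0..2 * pi} (\<lambda>\<theta>. slice_act w (cis (- (real_of_int m * \<theta>))) (T \<theta>))) \<le> M * (2 * pi - 0)"
    using assms by (intro integral_bound continuous_intros) (auto simp: norm_slice_act)
  then show ?thesis by (simp add: fourier_coeff_def field_simps)
qed

lemma integral_slice_act_cis:
  assumes "norm w = 1"
  shows "integral {0..2 * pi} (\<lambda>\<theta>. slice_act w (cis (real_of_int m * \<theta>)) x) = (if m = 0 then (2 * pi) *\<^sub>R x else 0)"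
proof (cases "m = 0")
  case False
  let ?G = "\<lambda>\<theta>. slice_act w (cis (real_of_int m * \<theta>)) (slice_act w (1 / (\<i> * of_int m)) x)"
  have "((\<lambda>\<theta>. slice_act w (cis (real_of_int m * \<theta>)) x) has_integral (?G (2 * pi) - ?G 0)) {0..2 * pi}"
  proof (rule fundamental_theorem_of_calculus)
    fix \<theta> :: real
    show "(?G has_vector_derivative slice_act w (cis (real_of_int m * \<theta>)) x) (at \<theta> within {0..2 * pi})"
      using has_vector_derivative_slice_act_cis[of w "real_of_int m" "slice_act w (1 / (\<i> * of_int m)) x" \<theta>] False
      by (simp flip: slice_act_mult[OF assms])
  qed simp
  moreover have "cis (real_of_int m * (2 * pi)) = 1"
    using cis_multiple_2pi[of "real_of_int m"] by (simp add: mult_ac)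
  ultimately show ?thesis using False by (simp add: integral_unique)
qed simp

lemma fourier_coeff_cis:
  assumes "norm w = 1"
  shows "fourier_coeff w m (\<lambda>\<theta>. slice_act w (cis (real_of_int l * \<theta>)) x) = (if m = l then x else 0)"
proof -
  have "fourier_coeff w (m - l) (\<lambda>\<theta>. x) = (if m = l then x else 0)"
    using integral_slice_act_cis[OF assms, of "l - m" x] by (simp add: fourier_coeff_def algebra_simps)
  then show ?thesis by (simp add: fourier_coeff_shift[OF assms])
qed

lemma scaleR_trig_eq_slice_act:
  assumes w: "norm w = 1"
  shows "(a * cos \<theta> + b * sin \<theta>) *\<^sub>R x
    = slice_act w (cis \<theta>) (slice_act w (Complex (a / 2) (- b / 2)) x)
    + slice_act w (cis (- \<theta>)) (slice_act w (Complex (a / 2) (b / 2)) x)"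
proof -
  have "of_real (a * cos \<theta> + b * sin \<theta>) = cis \<theta> * Complex (a / 2) (- b / 2) + cis (- \<theta>) * Complex (a / 2) (b / 2)"
    by (simp add: complex_eq_iff)
  then show ?thesis
    by (metis slice_act.add_left slice_act_mult[OF w] slice_act_of_real)
qed

section \<open>Bounds for homogeneous polynomials on the sphere\<close>

definition trig_poly :: "real ^ 'n::{finite,linorder} \<Rightarrow> nat \<Rightarrow> (real \<Rightarrow> 'n clif) \<Rightarrow> bool" where
  "trig_poly w k T \<longleftrightarrow> (\<exists>c. T = (\<lambda>\<theta>. \<Sum>m\<in>{- int k..int k}. slice_act w (cis (real_of_int m * \<theta>)) (c m)))"

lemma trig_poly_cis:
  assumes "\<bar>l\<bar> \<le> int k"
  shows "trig_poly w k (\<lambda>\<theta>. slice_act w (cis (real_of_int l * \<theta>)) x)"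
  unfolding trig_poly_def
  by (rule exI[of _ "\<lambda>m. if m = l then x else 0"])
    (use assms in \<open>simp add: fun_eq_iff if_distrib[of "slice_act w _"] slice_act.zero_right abs_le_iff cong: if_cong\<close>)

lemma trig_poly_const: "trig_poly w k (\<lambda>\<theta>. x)"
  using trig_poly_cis[of 0 k w x] by simp

lemma trig_poly_add:
  assumes "trig_poly w k T" "trig_poly w k U"
  shows "trig_poly w k (\<lambda>\<theta>. T \<theta> + U \<theta>)"
proof -
  obtain c d where "T = (\<lambda>\<theta>. \<Sum>m\<in>{- int k..int k}. slice_act w (cis (real_of_int m * \<theta>)) (c m))"
    and "U = (\<lambda>\<theta>. \<Sum>m\<in>{- int k..int k}. slice_act w (cis (real_of_int m * \<theta>)) (d m))"
    using assms by (auto simp: trig_poly_def)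
  then show ?thesis
    unfolding trig_poly_def by (intro exI[of _ "\<lambda>m. c m + d m"]) (simp add: slice_act.add_right sum.distrib)
qed

lemma trig_poly_sum: "(\<And>i. i \<in> A \<Longrightarrow> trig_poly w k (T i)) \<Longrightarrow> trig_poly w k (\<lambda>\<theta>. \<Sum>i\<in>A. T i \<theta>)"
  by (induction A rule: infinite_finite_induct) (auto intro: trig_poly_const trig_poly_add)

lemma trig_poly_mult_trig:
  assumes w: "norm w = 1" and T: "trig_poly w k T"
  shows "trig_poly w (Suc k) (\<lambda>\<theta>. (a * cos \<theta> + b * sin \<theta>) *\<^sub>R T \<theta>)"
proof -
  obtain c where c: "T = (\<lambda>\<theta>. \<Sum>m\<in>{- int k..int k}. slice_act w (cis (real_of_int m * \<theta>)) (c m))"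
    using T by (auto simp: trig_poly_def)
  have shift: "slice_act w (cis \<phi>) (slice_act w z (slice_act w (cis (real_of_int m * \<theta>)) x))
      = slice_act w (cis (real_of_int m * \<theta> + \<phi>)) (slice_act w z x)" for \<phi> z m \<theta> x
    by (simp add: mult_ac flip: slice_act_mult[OF w] cis_mult)
  have "(a * cos \<theta> + b * sin \<theta>) *\<^sub>R T \<theta> = (\<Sum>m\<in>{- int k..int k}.
      slice_act w (cis (real_of_int (m + 1) * \<theta>)) (slice_act w (Complex (a / 2) (- b / 2)) (c m))
      + slice_act w (cis (real_of_int (m - 1) * \<theta>)) (slice_act w (Complex (a / 2) (b / 2)) (c m)))" for \<theta>
    unfolding c scaleR_sum_right scaleR_trig_eq_slice_act[OF w] shift
    by (intro sum.cong refl) (simp add: algebra_simps)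
  moreover have "trig_poly w (Suc k) (\<lambda>\<theta>. \<Sum>m\<in>{- int k..int k}.
      slice_act w (cis (real_of_int (m + 1) * \<theta>)) (slice_act w (Complex (a / 2) (- b / 2)) (c m))
      + slice_act w (cis (real_of_int (m - 1) * \<theta>)) (slice_act w (Complex (a / 2) (b / 2)) (c m)))"
    by (intro trig_poly_sum trig_poly_add trig_poly_cis) auto
  ultimately show ?thesis by simp
qed

lemma trig_poly_hom_poly:
  assumes "hom_poly k P" "norm w = 1"
  shows "trig_poly w k (\<lambda>\<theta>. P (cos \<theta> *\<^sub>R u + sin \<theta> *\<^sub>R v))"
  using assms(1)
proof (induction rule: hom_poly_induct)
  case (coord k i P)
  from trig_poly_mult_trig[OF assms(2) coord(2), of "u $ i" "v $ i"] show ?case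
    by (simp add: mult.commute)
qed (auto intro: trig_poly_const trig_poly_add)

lemma trig_poly_derivative_bound:
  assumes T: "trig_poly w k T" and w: "norm w = 1" and M: "\<And>\<theta>. norm (T \<theta>) \<le> M"
    and D: "(T has_vector_derivative D) (at 0)"
  shows "norm D \<le> real (2 * k + 1) * real k * M"
proof -
  let ?I = "{- int k..int k}"
  obtain c where c: "T = (\<lambda>\<theta>. \<Sum>m\<in>?I. slice_act w (cis (real_of_int m * \<theta>)) (c m))"
    using T by (auto simp: trig_poly_def)
  have "(T has_vector_derivative
      (\<Sum>m\<in>?I. slice_act w (\<i> * of_real (real_of_int m) * cis (real_of_int m * 0)) (c m))) (at 0)"
    unfolding c by (intro has_vector_derivative_sum has_vector_derivative_slice_act_cis)
  then have "D = (\<Sum>m\<in>?I. slice_act w (\<i> * of_int m) (c m))"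
    using D vector_derivative_unique_at by fastforce
  also have "norm \<dots> \<le> (\<Sum>m\<in>?I. real k * M)"
  proof (rule sum_norm_le)
    fix m assume m: "m \<in> ?I"
    have "fourier_coeff w m T = c m"
      using m unfolding c by (subst fourier_coeff_sum) (auto simp: fourier_coeff_cis[OF w] intro!: continuous_intros)
    moreover have "continuous_on {0..2 * pi} T" unfolding c by (intro continuous_intros)
    ultimately have "norm (c m) \<le> M" using norm_fourier_coeff_le[of T M w m] M w by simp
    moreover have "\<bar>real_of_int m\<bar> \<le> real k" using m by auto
    ultimately show "norm (slice_act w (\<i> * of_int m) (c m)) \<le> real k * M"
      by (simp add: norm_slice_act[OF w] norm_mult mult_mono)
  qed
  also have "\<dots> = real (2 * k + 1) * real k * M" by simp
  finally show ?thesis .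
qed

text \<open>A weak Markov--Bernstein inequality: tangential derivatives are derivatives of trigonometric
  polynomials along great circles, whose coefficients are bounded by the supremum; the radial
  derivative is given by Euler's identity.\<close>

lemma norm_derivative_hom_poly_tangent:
  fixes P :: "real ^ 'n::{finite,linorder} \<Rightarrow> 'n clif"
  assumes P: "hom_poly k P" and M: "\<And>y. norm y = 1 \<Longrightarrow> norm (P y) \<le> M" and w: "norm w = 1"
    and v: "inner w v = 0"
  shows "norm (frechet_derivative P (at w) v) \<le> real (2 * k + 1) * real k * M * norm v"
proof -
  let ?D = "frechet_derivative P (at w)"
  note differentiable = hom_poly_differentiable[OF P, of w]
  have unit: "norm (?D z) \<le> real (2 * k + 1) * real k * M" if z: "norm z = 1" "inner w z = 0" for z
  proof (rule trig_poly_derivative_bound[OF trig_poly_hom_poly[OF P w, of w z] w])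
    fix \<theta>
    have "inner (cos \<theta> *\<^sub>R w + sin \<theta> *\<^sub>R z) (cos \<theta> *\<^sub>R w + sin \<theta> *\<^sub>R z)
        = (cos \<theta>)\<^sup>2 * inner w w + (sin \<theta>)\<^sup>2 * inner z z"
      using z by (simp add: inner_add_left inner_add_right inner_commute power2_eq_square)
    also have "\<dots> = 1" using w z by (simp add: norm_eq_1)
    finally show "norm (P (cos \<theta> *\<^sub>R w + sin \<theta> *\<^sub>R z)) \<le> M" by (intro M) (simp add: norm_eq_1)
  next
    have "((\<lambda>\<theta>. cos \<theta> *\<^sub>R w + sin \<theta> *\<^sub>R z) has_vector_derivative z) (at 0)"
      by (auto intro!: derivative_eq_intros)
    from vector_derivative_diff_chain_within[OF this, of P ?D] has_derivative_frechet[OF differentiable]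
    show "((\<lambda>\<theta>. P (cos \<theta> *\<^sub>R w + sin \<theta> *\<^sub>R z)) has_vector_derivative ?D z) (at 0)"
      by (simp add: o_def has_derivative_at_withinI)
  qed
  have linear: "linear ?D" using differentiable by (rule linear_frechet_derivative)
  show ?thesis
  proof (cases "v = 0")
    case False
    then have "norm (?D ((1 / norm v) *\<^sub>R v)) \<le> real (2 * k + 1) * real k * M"
      using v by (intro unit) auto
    then show ?thesis using False by (simp add: linear_scale[OF linear] field_simps)
  qed (simp add: linear_0[OF linear])
qed

lemma norm_derivative_hom_poly_sphere:
  fixes P :: "real ^ 'n::{finite,linorder} \<Rightarrow> 'n clif"
  assumes P: "hom_poly k P" and M: "\<And>y. norm y = 1 \<Longrightarrow> norm (P y) \<le> M" and w: "norm w = 1"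
  shows "norm (frechet_derivative P (at w) v) \<le> 2 * (real k + 1)\<^sup>2 * M * norm v"
proof -
  let ?D = "frechet_derivative P (at w)"
  note differentiable = hom_poly_differentiable[OF P, of w]
  have linear: "linear ?D" using differentiable by (rule linear_frechet_derivative)
  have M_nonneg: "0 \<le> M" using M[OF w] norm_ge_zero order_trans by blast
  define c where "c = inner v w"
  define u where "u = v - c *\<^sub>R w"
  have orth: "inner w u = 0" using w by (simp add: u_def c_def inner_diff_right norm_eq_1 inner_commute)
  have "norm u ^ 2 = norm v ^ 2 - c\<^sup>2"
    using w unfolding power2_norm_eq_inner
    by (simp add: u_def c_def inner_diff_left inner_diff_right inner_commute power2_eq_square norm_eq_1)
  then have "norm u ^ 2 \<le> norm v ^ 2" by (metis diff_le_eq le_add_same_cancel1 zero_le_power2)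
  then have norm_u: "norm u \<le> norm v" by (rule power2_le_imp_le) simp
  have norm_c: "\<bar>c\<bar> \<le> norm v" using Cauchy_Schwarz_ineq2[of v w] w by (simp add: c_def)
  have radial: "?D w = real k *\<^sub>R P w"
    using euler_hom_poly[OF P, of w]
    by (simp add: frechet_derivative_eq_sum_partial_deriv[OF differentiable] euler_def)
  have "?D v = ?D u + c *\<^sub>R ?D w"
    by (simp add: u_def linear_diff[OF linear] linear_scale[OF linear])
  then have "norm (?D v) \<le> norm (?D u) + \<bar>c\<bar> * (real k * norm (P w))"
    using norm_triangle_ineq[of "?D u" "c *\<^sub>R ?D w"] by (simp add: radial abs_mult)
  also have "\<dots> \<le> real (2 * k + 1) * real k * M * norm v + norm v * (real k * M)"
  proof (rule add_mono)
    show "norm (?D u) \<le> real (2 * k + 1) * real k * M * norm v"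
      using norm_derivative_hom_poly_tangent[OF P M w orth] norm_u M_nonneg
      by (meson mult_left_mono mult_nonneg_nonneg of_nat_0_le_iff order_trans)
  qed (use norm_c M[OF w] in \<open>intro mult_mono, auto\<close>)
  also have "\<dots> = (2 * (real k)\<^sup>2 + 2 * real k) * (M * norm v)" by (simp add: power2_eq_square algebra_simps)
  also have "\<dots> \<le> 2 * (real k + 1)\<^sup>2 * (M * norm v)"
    using M_nonneg by (intro mult_right_mono) (simp_all add: power2_eq_square algebra_simps)
  finally show ?thesis by (simp add: mult.assoc)
qed

lemma norm_derivative_hom_poly_cball:
  fixes P :: "real ^ 'n::{finite,linorder} \<Rightarrow> 'n clif"
  assumes P: "hom_poly k P" and M: "\<And>y. norm y = 1 \<Longrightarrow> norm (P y) \<le> M" and z: "norm z \<le> 1"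
  shows "norm (frechet_derivative P (at z) v) \<le> 2 * (real k + 1)\<^sup>2 * M * norm v"
proof -
  let ?B = "2 * (real k + 1)\<^sup>2 * M * norm v"
  let ?D = "\<lambda>x. \<Sum>i\<in>UNIV. v $ i *\<^sub>R partial_deriv P i x"
  have derivative_eq: "frechet_derivative P (at x) v = ?D x" for x
    using hom_poly_differentiable[OF P] by (rule frechet_derivative_eq_sum_partial_deriv)
  have sphere: "norm (?D y) \<le> ?B" if "norm y = 1" for y
    using norm_derivative_hom_poly_sphere[OF P _ that, of M v] M unfolding derivative_eq by blast
  obtain y :: "(real, 'n) vec" where "norm y = 1" using vector_choose_size[of 1] by auto
  from sphere[OF this] have B_nonneg: "0 \<le> ?B" using norm_ge_zero order_trans by blast
  have "norm (?D z) \<le> ?B"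
  proof (cases k)
    case 0
    then show ?thesis using P B_nonneg by (simp add: hom_poly_0_partial_deriv)
  next
    case (Suc l)
    have "hom_poly l ?D" using P Suc by (auto intro!: hom_poly_sum hom_poly_scaleR hom_poly_partial_deriv)
    from norm_hom_poly_le[OF this sphere] have "norm (?D z) \<le> ?B * norm z ^ l" by blast
    also have "\<dots> \<le> ?B * 1" using B_nonneg z by (intro mult_left_mono) (auto simp: power_le_one)
    finally show ?thesis by simp
  qed
  then show ?thesis unfolding derivative_eq .
qed

lemma hom_poly_lipschitz:
  fixes P :: "real ^ 'n::{finite,linorder} \<Rightarrow> 'n clif"
  assumes P: "hom_poly k P" and M: "\<And>y. norm y = 1 \<Longrightarrow> norm (P y) \<le> M" and "norm x \<le> 1" "norm y \<le> 1"
  shows "norm (P x - P y) \<le> 2 * (real k + 1)\<^sup>2 * M * norm (x - y)"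
proof (rule differentiable_bound)
  show "convex (cball (0::(real, 'n) vec) 1)" by simp
  show "(P has_derivative frechet_derivative P (at z)) (at z within cball 0 1)" for z
    by (rule has_derivative_at_withinI[OF has_derivative_frechet[OF hom_poly_differentiable[OF P]]])
  show "onorm (frechet_derivative P (at z)) \<le> 2 * (real k + 1)\<^sup>2 * M" if "z \<in> cball 0 1" for z
    using that by (intro onorm_le norm_derivative_hom_poly_cball[OF P M]) auto
qed (use assms in auto)

lemma bdd_above_norm_sphere:
  fixes g :: "'a::euclidean_space \<Rightarrow> 'b::real_normed_vector"
  assumes "continuous_on (sphere 0 1) g"
  shows "bdd_above ((\<lambda>w. norm (g w)) ` sphere 0 1)"
proof -
  obtain B where "\<And>w. w \<in> sphere 0 1 \<Longrightarrow> norm (g w) \<le> B"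
    using continuous_on_compact_bound[OF compact_sphere assms] by blast
  then show ?thesis by (rule bdd_aboveI2)
qed

lemma unit_sphere_nonempty: "sphere (0::'a::euclidean_space) 1 \<noteq> {}"
  using vector_choose_size[of 1, where 'a='a] by auto

lemma norm_le_sup_norm_S: "continuous_on (sphere 0 1) g \<Longrightarrow> norm w = 1 \<Longrightarrow> norm (g w) \<le> sup_norm_S g"
  unfolding sup_norm_S_def by (intro cSUP_upper bdd_above_norm_sphere) auto

lemma sup_norm_S_le: "(\<And>w. norm w = 1 \<Longrightarrow> norm (g w) \<le> M) \<Longrightarrow> sup_norm_S g \<le> M"
  unfolding sup_norm_S_def using unit_sphere_nonempty by (intro cSUP_least) auto

lemma sup_norm_S_nonneg:
  assumes "continuous_on (sphere 0 1) g"
  shows "0 \<le> sup_norm_S g"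
proof -
  obtain w :: "(real, 'a) vec" where "norm w = 1" using vector_choose_size[of 1] by auto
  then show ?thesis using norm_le_sup_norm_S[OF assms] norm_ge_zero order_trans by blast
qed

lemma sup_norm_S_attained:
  assumes "continuous_on (sphere 0 1) g"
  obtains w where "norm w = 1" "sup_norm_S g = norm (g w)"
proof -
  have "continuous_on (sphere 0 1) (\<lambda>w. norm (g w))" using assms by (intro continuous_intros)
  then obtain w where "w \<in> sphere 0 1" "\<forall>y\<in>sphere 0 1. norm (g y) \<le> norm (g w)"
    using continuous_attains_sup[OF compact_sphere unit_sphere_nonempty] by blast
  moreover from this have "sup_norm_S g = norm (g w)"
    unfolding sup_norm_S_def by (intro cSup_eq_maximum) auto
  ultimately show ?thesis by (intro that[of w]) auto
qed

lemma L2_norm_S_le_sup_norm_S: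
  assumes "continuous_on UNIV g"
  shows "L2_norm_S g \<le> sup_norm_S g"
proof -
  have cont: "continuous_on (sphere 0 1) g" using assms continuous_on_subset by blast
  have "(L2_norm_S g)\<^sup>2 \<le> (sup_norm_S g)\<^sup>2"
    unfolding L2_norm_S_power2[OF assms]
    using abs_sphere_integral_le[of "\<lambda>w. (norm (g w))\<^sup>2" "(sup_norm_S g)\<^sup>2"] cont norm_le_sup_norm_S[OF cont]
    by (fastforce intro!: continuous_intros power_mono)
  then show ?thesis using sup_norm_S_nonneg[OF cont] by (rule power2_le_imp_le)
qed

text \<open>By the Lipschitz bound, $|P|$ exceeds half its maximum on a spherical cap of radius $1/(4(k+1)^2)$.\<close>

lemma sup_norm_S_le_L2_norm_S:
  fixes P :: "real ^ 'n::{finite,linorder} \<Rightarrow> 'n clif"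
  assumes P: "hom_poly k P"
  shows "sup_norm_S P \<le> 2 * 4 ^ CARD('n) * (real k + 1) ^ CARD('n) * L2_norm_S P"
proof -
  have cont: "continuous_on S P" for S using P by (rule hom_poly_continuous_on)
  define M where "M = sup_norm_S P"
  have M: "norm (P y) \<le> M" if "norm y = 1" for y
    using norm_le_sup_norm_S[OF cont that] by (simp add: M_def)
  obtain w where w: "norm w = 1" "norm (P w) = M"
    using sup_norm_S_attained[OF cont] unfolding M_def by metis
  define d where "d = 1 / (4 * (real k + 1)\<^sup>2)"
  have square: "1 \<le> (real k + 1)\<^sup>2" by simp
  then have "1 \<le> 4 * (real k + 1)\<^sup>2" by linarith
  then have d: "0 < d" "d \<le> 1" by (auto simp: d_def)
  have cap: "(M / 2)\<^sup>2 \<le> (norm (P y))\<^sup>2" if y: "norm y = 1" "dist w y < d" for y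
  proof -
    have "norm (P w - P y) \<le> 2 * (real k + 1)\<^sup>2 * M * norm (w - y)"
      using w y by (intro hom_poly_lipschitz[OF P M]) auto
    also have "\<dots> \<le> 2 * (real k + 1)\<^sup>2 * M * d"
      using y w(2)[symmetric] by (intro mult_left_mono) (auto simp: dist_norm)
    also have "\<dots> = M / 2" using square by (simp add: d_def field_simps)
    finally have "M / 2 \<le> norm (P y)"
      using norm_triangle_ineq2[of "P w" "P y"] by (simp add: w(2))
    then show ?thesis by (intro power_mono) (auto simp: w(2)[symmetric])
  qed
  have "(M / 2)\<^sup>2 * (d / 4) ^ DIM((real, 'n) vec) \<le> (L2_norm_S P)\<^sup>2"
    unfolding L2_norm_S_power2[OF cont]
    using cap d by (intro sphere_integral_lower_bound[OF _ _ w(1)] continuous_intros cont) auto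
  moreover have "d / 4 = 1 / (4 * (real k + 1))\<^sup>2" unfolding power_mult_distrib by (simp add: d_def)
  ultimately have "M\<^sup>2 \<le> 4 * (L2_norm_S P)\<^sup>2 * ((4 * (real k + 1))\<^sup>2) ^ CARD('n)"
    by (simp add: power_one_over power_divide pos_divide_le_eq mult_ac)
  also have "\<dots> = (2 * (4 * (real k + 1)) ^ CARD('n) * L2_norm_S P)\<^sup>2"
    by (simp only: power_mult_distrib mult_ac flip: power_mult) simp
  finally have "M \<le> 2 * (4 * (real k + 1)) ^ CARD('n) * L2_norm_S P"
    by (rule power2_le_imp_le) (simp add: L2_norm_S_nonneg[OF cont])
  then show ?thesis by (simp only: M_def power_mult_distrib mult.assoc)
qed

section \<open>Completeness of the spherical monogenics\<close>

lemma sphere_inner_linear_combination_eq_0: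
  assumes "continuous_on (sphere 0 1) f" "\<And>i. i \<in> I \<Longrightarrow> continuous_on (sphere 0 1) (b i)"
    and "\<And>i. i \<in> I \<Longrightarrow> sphere_inner f (b i) = 0"
  shows "sphere_inner f (\<lambda>w. \<Sum>i\<in>I. c i *\<^sub>R b i w) = 0"
  using assms by (subst sphere_inner_sum_right) (auto simp: sphere_inner_scaleR_right intro!: continuous_intros)

lemma sphere_projection_line:
  assumes e: "continuous_on (sphere 0 1) e" and f: "continuous_on (sphere 0 1) f"
  shows "\<exists>t. sphere_inner (\<lambda>w. f w - t *\<^sub>R e w) e = 0"
proof -
  have diff: "sphere_inner (\<lambda>w. f w - t *\<^sub>R e w) e = sphere_inner f e - t * sphere_inner e e" for t
    using e f by (subst sphere_inner_diff_left) (auto simp: sphere_inner_scaleR_left intro!: continuous_intros)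
  show ?thesis
  proof (cases "sphere_inner e e = 0")
    case True
    have "sphere_inner f e = sphere_inner f (\<lambda>w. 0)"
      by (intro sphere_inner_cong refl sphere_inner_self_eq_0_imp[OF e True])
    then show ?thesis using True unfolding diff by (simp add: sphere_inner_def)
  next
    case False
    then show ?thesis unfolding diff by (intro exI[of _ "sphere_inner f e / sphere_inner e e"]) simp
  qed
qed

lemma scaleR_sum_insert_eliminate:
  fixes b :: "'i \<Rightarrow> 'b::real_vector"
  assumes "finite I" "k \<notin> I"
  shows "(\<Sum>i\<in>insert k I. (if i = k then t else c i - t * d i) *\<^sub>R b i)
    = (\<Sum>i\<in>I. c i *\<^sub>R b i) + t *\<^sub>R (b k - (\<Sum>i\<in>I. d i *\<^sub>R b i))"
proof -
  have "(\<Sum>i\<in>I. (if i = k then t else c i - t * d i) *\<^sub>R b i) = (\<Sum>i\<in>I. c i *\<^sub>R b i - t *\<^sub>R (d i *\<^sub>R b i))"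
    using assms(2) by (intro sum.cong refl) (auto simp: scaleR_left_diff_distrib)
  then show ?thesis using assms by (simp add: sum_subtractf scaleR_sum_right algebra_simps)
qed

text \<open>Gram--Schmidt: the new vector is first made orthogonal to the previous ones.\<close>

lemma sphere_projection_exists:
  assumes "finite I" "\<And>i. i \<in> I \<Longrightarrow> continuous_on (sphere 0 1) (b i)" "continuous_on (sphere 0 1) f"
  shows "\<exists>c. \<forall>j\<in>I. sphere_inner (\<lambda>w. f w - (\<Sum>i\<in>I. c i *\<^sub>R b i w)) (b j) = 0"
  using assms
proof (induction I arbitrary: f rule: finite_induct)
  case (insert k I)
  have b: "continuous_on (sphere 0 1) (b i)" if "i \<in> insert k I" for i using insert.prems(1) that .
  then have comb: "continuous_on (sphere 0 1) (\<lambda>w. \<Sum>i\<in>I. c i *\<^sub>R b i w)" for c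
    by (intro continuous_intros) auto
  have "\<exists>c. \<forall>j\<in>I. sphere_inner (\<lambda>w. h w - (\<Sum>i\<in>I. c i *\<^sub>R b i w)) (b j) = 0" if "continuous_on (sphere 0 1) h" for h
    using insert.IH[OF _ that] b by blast
  from this[OF insert.prems(2)] this[OF b[of k]] obtain c d
    where c: "\<And>j. j \<in> I \<Longrightarrow> sphere_inner (\<lambda>w. f w - (\<Sum>i\<in>I. c i *\<^sub>R b i w)) (b j) = 0"
      and d: "\<And>j. j \<in> I \<Longrightarrow> sphere_inner (\<lambda>w. b k w - (\<Sum>i\<in>I. d i *\<^sub>R b i w)) (b j) = 0"
    by auto
  define e where "e w = b k w - (\<Sum>i\<in>I. d i *\<^sub>R b i w)" for w
  define g where "g w = f w - (\<Sum>i\<in>I. c i *\<^sub>R b i w)" for w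
  have cont: "continuous_on (sphere 0 1) e" "continuous_on (sphere 0 1) g"
    unfolding e_def g_def by (intro continuous_intros comb b insert.prems(2), simp)+
  obtain t where t: "sphere_inner (\<lambda>w. g w - t *\<^sub>R e w) e = 0"
    using sphere_projection_line[OF cont] by blast
  define r where "r w = g w - t *\<^sub>R e w" for w
  have r: "continuous_on (sphere 0 1) r" unfolding r_def by (intro continuous_intros cont)
  have orth: "sphere_inner r (b j) = 0" if "j \<in> I" for j
  proof -
    have "sphere_inner g (b j) = 0" "sphere_inner e (b j) = 0"
      using c[OF that] d[OF that] by (simp_all add: g_def[abs_def] e_def[abs_def])
    then show ?thesis
      using b[of j] cont that unfolding r_def
      by (subst sphere_inner_diff_left) (auto simp: sphere_inner_scaleR_left intro!: continuous_intros)
  qed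
  have comb_orth: "sphere_inner r (\<lambda>w. \<Sum>i\<in>I. d i *\<^sub>R b i w) = 0"
    by (intro sphere_inner_linear_combination_eq_0 r orth b insertI2)
  have "sphere_inner r (b k) = sphere_inner r (\<lambda>w. e w + (\<Sum>i\<in>I. d i *\<^sub>R b i w))" by (simp add: e_def)
  also have "\<dots> = 0"
    using t comb_orth r cont comb by (subst sphere_inner_add_right) (auto simp: r_def[abs_def])
  finally have "\<forall>j\<in>insert k I. sphere_inner r (b j) = 0" using orth by blast
  moreover have "f w - (\<Sum>i\<in>insert k I. (if i = k then t else c i - t * d i) *\<^sub>R b i w) = r w" for w
    unfolding scaleR_sum_insert_eliminate[OF insert.hyps] by (simp add: r_def e_def g_def)
  ultimately show ?case by (intro exI[of _ "\<lambda>i. if i = k then t else c i - t * d i"]) simp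
qed auto

lemma hom_poly_eq_combination:
  fixes H :: "real ^ 'n::{finite,linorder} \<Rightarrow> 'n clif"
  assumes "hom_poly d H"
  obtains c where "H = (\<lambda>x. \<Sum>i\<in>{\<alpha>. sum \<alpha> UNIV = d} \<times> Basis. c i *\<^sub>R (monomial (fst i) x *\<^sub>R snd i))"
proof -
  obtain a where a: "H = (\<lambda>x. \<Sum>\<alpha> | sum \<alpha> UNIV = d. monomial \<alpha> x *\<^sub>R a \<alpha>)"
    using assms by (auto simp: hom_poly_iff_monomials)
  have "monomial \<alpha> x *\<^sub>R a \<alpha> = (\<Sum>e\<in>Basis. inner (a \<alpha>) e *\<^sub>R (monomial \<alpha> x *\<^sub>R e))" for \<alpha> x
    by (subst euclidean_representation[of "a \<alpha>", symmetric]) (simp only: scaleR_sum_right scaleR_left_commute)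
  then have "H = (\<lambda>x. \<Sum>i\<in>{\<alpha>. sum \<alpha> UNIV = d} \<times> Basis. inner (a (fst i)) (snd i) *\<^sub>R (monomial (fst i) x *\<^sub>R snd i))"
    by (simp add: a sum.cartesian_product split_def)
  then show ?thesis by (rule that)
qed

lemma sphere_projection_hom_poly:
  fixes f :: "real ^ 'n::{finite,linorder} \<Rightarrow> 'n clif"
  assumes f: "continuous_on (sphere 0 1) f"
  obtains q where "hom_poly d q" "\<And>H. hom_poly d H \<Longrightarrow> sphere_inner f H = sphere_inner q H"
proof -
  define I where "I = {\<alpha> :: 'n \<Rightarrow> nat. sum \<alpha> UNIV = d} \<times> (Basis :: 'n clif set)"
  define b where "b i x = monomial (fst i) x *\<^sub>R (snd i :: 'n clif)" for i and x :: "(real, 'n) vec"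
  have finite: "finite I" unfolding I_def by (intro finite_cartesian_product finite_multi_index finite_Basis)
  have hom: "hom_poly d (b i)" if "i \<in> I" for i
    using that hom_poly_monomial by (auto simp: I_def b_def[abs_def])
  have cont: "continuous_on (sphere 0 1) (b i)" if "i \<in> I" for i using hom[OF that] by (rule hom_poly_continuous_on)
  obtain c where c: "\<And>j. j \<in> I \<Longrightarrow> sphere_inner (\<lambda>w. f w - (\<Sum>i\<in>I. c i *\<^sub>R b i w)) (b j) = 0"
    using sphere_projection_exists[of I b f] finite cont f by blast
  define q where "q w = (\<Sum>i\<in>I. c i *\<^sub>R b i w)" for w
  have q: "hom_poly d q" unfolding q_def[abs_def] by (intro hom_poly_sum hom_poly_scaleR hom)
  note q_cont = hom_poly_continuous_on[OF q, of "sphere 0 1"]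
  have "sphere_inner f H = sphere_inner q H" if H: "hom_poly d H" for H
  proof -
    obtain h where h: "H = (\<lambda>x. \<Sum>i\<in>I. h i *\<^sub>R b i x)"
      using hom_poly_eq_combination[OF H] unfolding I_def b_def by blast
    have "sphere_inner (\<lambda>w. f w - q w) H = 0"
      unfolding h q_def by (intro sphere_inner_linear_combination_eq_0 cont c continuous_intros f)
    then show ?thesis
      using sphere_inner_diff_left[OF hom_poly_continuous_on[OF H] f q_cont] by simp
  qed
  with q show ?thesis by (rule that)
qed

lemma vec_mult_funpow_sph_monogenic:
  assumes "norm w = 1" "even (s + l)"
  shows "(vec_mult ^^ s) Q w = (-1) ^ (s div 2) *\<^sub>R sph_monogenic l Q w"
  using assms vec_mult_funpow_sphere[OF assms(1), of s Q] slice_act_i_power[OF assms(1), of s Q]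
  by (auto simp: sph_monogenic_def)

lemma even_hom_poly_sphere_decomposition:
  fixes H :: "real ^ 'n::{finite,linorder} \<Rightarrow> 'n clif"
  assumes "hom_poly d H" "even d"
  obtains Q where "\<And>k. k \<le> d \<Longrightarrow> monogenic_hom k (Q k)"
    "\<And>w. norm w = 1 \<Longrightarrow> H w = (\<Sum>k\<le>d. sph_monogenic k (Q k) w)"
proof -
  obtain R where R: "\<And>s. s \<le> d \<Longrightarrow> monogenic_hom (d - s) (R s)" "H = (\<lambda>x. \<Sum>s\<le>d. (vec_mult ^^ s) (R s) x)"
    using fischer_decomposition[OF assms(1)] by blast
  define Q where "Q k = (\<lambda>x. (-1) ^ ((d - k) div 2) *\<^sub>R R (d - k) x)" for k
  have "H w = (\<Sum>k\<le>d. sph_monogenic k (Q k) w)" if w: "norm w = 1" for w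
  proof -
    have "H w = (\<Sum>k\<le>d. (vec_mult ^^ (d - k)) (R (d - k)) w)"
      unfolding R(2) by (rule sum.reindex_bij_witness[of _ "\<lambda>k. d - k" "\<lambda>s. d - s"]) auto
    also have "\<dots> = (\<Sum>k\<le>d. sph_monogenic k (Q k) w)"
      using assms(2) by (intro sum.cong refl)
        (simp add: vec_mult_funpow_sph_monogenic[OF w] Q_def sph_monogenic_scaleR)
    finally show ?thesis .
  qed
  moreover have "monogenic_hom k (Q k)" if "k \<le> d" for k
    unfolding Q_def using R(1)[of "d - k"] that by (intro monogenic_hom_scaleR) simp
  ultimately show ?thesis by (intro that)
qed

lemma spherical_projection:
  fixes f :: "real ^ 'n::{finite,linorder} \<Rightarrow> 'n clif"
  assumes f: "continuous_on (sphere 0 1) f"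
  obtains P where "monogenic_hom k P"
    "\<And>Q. monogenic_hom k Q \<Longrightarrow> sphere_inner f (sph_monogenic k Q)
        = sphere_inner (sph_monogenic k P) (sph_monogenic k Q)"
proof -
  define d where "d = (if even k then k else Suc k)"
  have d: "even d" "k \<le> d" by (auto simp: d_def)
  obtain q where q: "hom_poly d q" "\<And>H. hom_poly d H \<Longrightarrow> sphere_inner f H = sphere_inner q H"
    using sphere_projection_hom_poly[OF f] by blast
  obtain P where P: "\<And>l. l \<le> d \<Longrightarrow> monogenic_hom l (P l)"
    "\<And>w. norm w = 1 \<Longrightarrow> q w = (\<Sum>l\<le>d. sph_monogenic l (P l) w)"
    using even_hom_poly_sphere_decomposition[OF q(1) d(1)] by blast
  have "sphere_inner f (sph_monogenic k Q) = sphere_inner (sph_monogenic k (P k)) (sph_monogenic k Q)"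
    if Q: "monogenic_hom k Q" for Q
  proof -
    have "sphere_inner f (sph_monogenic k Q) = sphere_inner q (sph_monogenic k Q)"
      by (rule q(2)) (use hom_poly_sph_monogenic[OF monogenic_hom_imp_hom_poly[OF Q]] in \<open>simp add: d_def\<close>)
    also have "\<dots> = sphere_inner (\<lambda>w. \<Sum>l\<le>d. sph_monogenic l (P l) w) (sph_monogenic k Q)"
      by (intro sphere_inner_cong P(2) refl)
    also have "\<dots> = (\<Sum>l\<le>d. sphere_inner (sph_monogenic l (P l)) (sph_monogenic k Q))"
      using P(1) Q by (intro sphere_inner_sum_left continuous_on_sph_monogenic) auto
    also have "\<dots> = (\<Sum>l\<le>d. if l = k then sphere_inner (sph_monogenic k (P k)) (sph_monogenic k Q) else 0)"
      using sph_monogenic_orthogonal[OF P(1) Q] by (intro sum.cong refl) auto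
    also have "\<dots> = sphere_inner (sph_monogenic k (P k)) (sph_monogenic k Q)"
      using d(2) by simp
    finally show ?thesis .
  qed
  with P(1)[OF d(2)] show ?thesis by (rule that)
qed

lemma norm_le_mult_imp_eq_0:
  fixes x :: "'a::real_normed_vector"
  assumes "\<And>e::real. 0 < e \<Longrightarrow> e \<le> 1 \<Longrightarrow> norm x \<le> A * e"
  shows "x = 0"
proof -
  have "((\<lambda>e. A * e) \<longlongrightarrow> A * 0) (at_right 0)" by (intro tendsto_intros)
  moreover have "\<forall>\<^sub>F e in at_right 0. norm x \<le> A * e"
    unfolding eventually_at_right_field using assms by (intro exI[of _ 1]) auto
  ultimately have "norm x \<le> A * 0" by (rule tendsto_lowerbound) simp
  then show ?thesis by simp
qed

lemma orthogonal_to_polynomials_imp_square_0: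
  fixes g :: "'a::euclidean_space \<Rightarrow> 'b::euclidean_space" and L :: "('a \<Rightarrow> real) \<Rightarrow> real"
  assumes K: "compact K" and g: "continuous_on K g"
    and diff: "\<And>f h. continuous_on K f \<Longrightarrow> continuous_on K h \<Longrightarrow> L (\<lambda>x. f x - h x) = L f - L h"
    and bound: "\<And>f B. continuous_on K f \<Longrightarrow> (\<And>x. x \<in> K \<Longrightarrow> \<bar>f x\<bar> \<le> B) \<Longrightarrow> \<bar>L f\<bar> \<le> C * B"
    and orth: "\<And>p. polynomial_function p \<Longrightarrow> L (\<lambda>x. inner (g x) (p x)) = 0"
  shows "L (\<lambda>x. inner (g x) (g x)) = 0"
proof -
  obtain B where B: "0 \<le> B" "\<And>x. x \<in> K \<Longrightarrow> norm (g x) \<le> B"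
    using continuous_on_compact_bound[OF K g] by blast
  have "norm (L (\<lambda>x. inner (g x) (g x))) \<le> (C * B) * e" if e: "0 < e" for e
  proof -
    obtain p where p: "polynomial_function p" "\<And>x. x \<in> K \<Longrightarrow> norm (g x - p x) < e"
      using Stone_Weierstrass_polynomial_function[OF K g e] by auto
    have p_cont: "continuous_on K p" by (rule continuous_on_polymonial_function[OF p(1)])
    have "L (\<lambda>x. inner (g x) (g x)) = L (\<lambda>x. inner (g x) (g x - p x))"
      using orth[OF p(1)] by (simp add: inner_diff_right diff continuous_on_inner g p_cont)
    also have "norm \<dots> \<le> C * (B * e)"
      unfolding real_norm_def
    proof (rule bound)
      show "continuous_on K (\<lambda>x. inner (g x) (g x - p x))" by (intro continuous_intros g p_cont)
      fix x assume x: "x \<in> K"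
      have "\<bar>inner (g x) (g x - p x)\<bar> \<le> norm (g x) * norm (g x - p x)" by (rule Cauchy_Schwarz_ineq2)
      also have "\<dots> \<le> B * e" using B p(2)[OF x] x by (intro mult_mono) auto
      finally show "\<bar>inner (g x) (g x - p x)\<bar> \<le> B * e" .
    qed
    finally show ?thesis by (simp add: mult.assoc)
  qed
  then show ?thesis by (intro norm_le_mult_imp_eq_0) blast
qed

lemma sphere_inner_even_odd:
  fixes g :: "'a::euclidean_space \<Rightarrow> 'b::real_inner"
  assumes g: "continuous_on (sphere 0 1) g" "\<And>w. norm w = 1 \<Longrightarrow> g (- w) = g w"
    and h: "continuous_on (sphere 0 1) h" "\<And>w. norm w = 1 \<Longrightarrow> h (- w) = - h w"
  shows "sphere_inner g h = 0"
proof -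
  have "continuous_on (sphere 0 1) (\<lambda>w. inner (g w) (h w))" by (intro continuous_intros g h)
  moreover have "orthogonal_transformation (uminus :: 'a \<Rightarrow> _)"
    by (simp add: orthogonal_transformation linear_uminus)
  ultimately have "sphere_inner g h = sphere_inner (\<lambda>w. g (- w)) (\<lambda>w. h (- w))"
    unfolding sphere_inner_def by (intro sphere_integral_orthogonal[symmetric])
  also have "\<dots> = sphere_inner g (\<lambda>w. - h w)" by (intro sphere_inner_cong g(2) h(2))
  finally show ?thesis by (simp add: sphere_inner_minus_right)
qed

lemma sphere_inner_hom_poly_eq_0:
  fixes g :: "real ^ 'n::{finite,linorder} \<Rightarrow> 'n clif"
  assumes g: "continuous_on (sphere 0 1) g" and even: "\<And>w. norm w = 1 \<Longrightarrow> g (- w) = g w"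
    and orth: "\<And>k Q. monogenic_hom k Q \<Longrightarrow> sphere_inner g (sph_monogenic k Q) = 0" and H: "hom_poly d H"
  shows "sphere_inner g H = 0"
proof (cases "even d")
  case True
  obtain Q where Q: "\<And>k. k \<le> d \<Longrightarrow> monogenic_hom k (Q k)"
    "\<And>w. norm w = 1 \<Longrightarrow> H w = (\<Sum>k\<le>d. sph_monogenic k (Q k) w)"
    using even_hom_poly_sphere_decomposition[OF H True] by blast
  have "sphere_inner g H = sphere_inner g (\<lambda>w. \<Sum>k\<le>d. sph_monogenic k (Q k) w)"
    by (intro sphere_inner_cong Q(2) refl)
  also have "\<dots> = (\<Sum>k\<le>d. sphere_inner g (sph_monogenic k (Q k)))"
    using Q(1) by (intro sphere_inner_sum_right g continuous_on_sph_monogenic) auto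
  finally show ?thesis using Q(1) orth by simp
next
  case False
  then show ?thesis
    using hom_poly_uminus_arg[OF H]
    by (intro sphere_inner_even_odd g even hom_poly_continuous_on[OF H]) auto
qed

lemma spherical_completeness:
  fixes g :: "real ^ 'n::{finite,linorder} \<Rightarrow> 'n clif"
  assumes g: "continuous_on (sphere 0 1) g" and even: "\<And>w. norm w = 1 \<Longrightarrow> g (- w) = g w"
    and orth: "\<And>k Q. monogenic_hom k Q \<Longrightarrow> sphere_inner g (sph_monogenic k Q) = 0" and y: "norm y = 1"
  shows "g y = 0"
proof -
  have "continuous_on (sphere 0 1) p \<and> sphere_inner g p = 0" if "sum_of_hom_polys p" for p
    using that
  proof induction
    case (hom k P)
    then show ?case using sphere_inner_hom_poly_eq_0[OF g even orth] hom_poly_continuous_on by blast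
  next
    case (add P Q)
    then show ?case using g by (simp add: sphere_inner_add_right continuous_on_add)
  qed
  then have "sphere_inner g p = 0" if "polynomial_function p" for p
    using sum_of_hom_polys_polynomial[OF that] by blast
  then have "sphere_integral (\<lambda>w. inner (g w) (g w)) = 0"
    by (intro orthogonal_to_polynomials_imp_square_0[where L=sphere_integral and C=1, OF compact_sphere g])
      (auto simp: sphere_integral_diff sphere_inner_def intro!: abs_sphere_integral_le)
  then show ?thesis using sphere_inner_self_eq_0_imp[OF g _ y] by (simp add: sphere_inner_def)
qed

section \<open>Smooth functions and smoothly convergent series\<close>

lemma has_derivative_cong_open:
  assumes "open S" "x \<in> S" "\<And>y. y \<in> S \<Longrightarrow> f y = g y"
  shows "(f has_derivative D) (at x) \<longleftrightarrow> (g has_derivative D) (at x)"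
  using has_derivative_transform_within_open[of f D x UNIV S g]
    has_derivative_transform_within_open[of g D x UNIV S f] assms
  by auto

lemma smooth_k_cong:
  assumes S: "open S" and agree: "\<And>x. x \<in> S \<Longrightarrow> f x = g x" and f: "smooth_k k S f"
  shows "smooth_k k S g"
  using agree f
proof (induction k arbitrary: f g)
  case 0
  then show ?case using continuous_on_cong[of S S f g] by simp
next
  case (Suc k)
  note cong = has_derivative_cong_open[OF S _ Suc.prems(1)]
  have "g differentiable_on S"
    using Suc.prems(2) cong by (simp add: differentiable_on_eq_differentiable_at[OF S] differentiable_def)
  moreover have "smooth_k k S (\<lambda>x. frechet_derivative g (at x) v)" if "v \<in> Basis" for v
  proof (rule Suc.IH)
    show "smooth_k k S (\<lambda>x. frechet_derivative f (at x) v)" using Suc.prems(2) that by simp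
    show "frechet_derivative f (at x) v = frechet_derivative g (at x) v" if "x \<in> S" for x
      using cong[OF that] by (simp add: frechet_derivative_def)
  qed
  ultimately show ?case by simp
qed

lemma smooth_k_SucI:
  assumes S: "open S" and D: "\<And>x. x \<in> S \<Longrightarrow> (f has_derivative D x) (at x)"
    and k: "\<And>v. v \<in> Basis \<Longrightarrow> smooth_k k S (\<lambda>x. D x v)"
  shows "smooth_k (Suc k) S f"
proof -
  have "f differentiable_on S"
    unfolding differentiable_on_eq_differentiable_at[OF S] using D by (auto simp: differentiable_def)
  moreover have "smooth_k k S (\<lambda>x. frechet_derivative f (at x) v)" if "v \<in> Basis" for v
    using frechet_derivative_at[OF D] by (intro smooth_k_cong[OF S _ k[OF that]]) auto
  ultimately show ?thesis by simp
qed

lemma smooth_k_Suc_has_derivative: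
  "smooth_k (Suc k) S f \<Longrightarrow> open S \<Longrightarrow> x \<in> S \<Longrightarrow> (f has_derivative frechet_derivative f (at x)) (at x)"
  by (simp add: differentiable_on_eq_differentiable_at frechet_derivative_works)

lemma smooth_on_has_derivative:
  assumes "smooth_on S f" "open S" "x \<in> S"
  shows "(f has_derivative frechet_derivative f (at x)) (at x)"
proof -
  have "smooth_k (Suc 0) S f" using assms(1) unfolding smooth_on_def by blast
  then show ?thesis using assms(2,3) by (rule smooth_k_Suc_has_derivative)
qed

lemma smooth_on_cong:
  assumes "open S" "\<And>x. x \<in> S \<Longrightarrow> f x = g x" "smooth_on S f"
  shows "smooth_on S g"
  using assms smooth_k_cong unfolding smooth_on_def by blast

lemma smooth_on_continuous: "smooth_on S f \<Longrightarrow> continuous_on S f"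
  unfolding smooth_on_def by (drule spec[of _ 0]) simp

lemma smooth_on_derivative: "smooth_on S f \<Longrightarrow> v \<in> Basis \<Longrightarrow> smooth_on S (\<lambda>x. frechet_derivative f (at x) v)"
  unfolding smooth_on_def by (rule allI, drule_tac x="Suc k" in spec) simp

lemma smooth_k_linear:
  assumes S: "open S" and L: "bounded_linear L" and f: "smooth_k k S f"
  shows "smooth_k k S (\<lambda>x. L (f x))"
  using f
proof (induction k arbitrary: f)
  case 0
  then show ?case using bounded_linear.continuous_on[OF L] by simp
next
  case (Suc k)
  show ?case
    by (rule smooth_k_SucI[OF S bounded_linear.has_derivative[OF L smooth_k_Suc_has_derivative[OF Suc.prems S]]])
      (use Suc in auto)
qed

lemma smooth_k_add:
  assumes S: "open S" and f: "smooth_k k S f" and g: "smooth_k k S g"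
  shows "smooth_k k S (\<lambda>x. f x + g x)"
  using f g
proof (induction k arbitrary: f g)
  case 0
  then show ?case by (auto intro: continuous_on_add)
next
  case (Suc k)
  show ?case
    by (rule smooth_k_SucI[OF S has_derivative_add[OF Suc.prems[THEN smooth_k_Suc_has_derivative[OF _ S]]]])
      (use Suc in auto)
qed

lemma smooth_k_const: "open S \<Longrightarrow> smooth_k k S (\<lambda>x. c)"
proof (induction k arbitrary: c)
  case (Suc k)
  show ?case by (rule smooth_k_SucI[OF Suc.prems has_derivative_const]) (rule Suc.IH[OF Suc.prems])
qed simp

lemma smooth_on_linear: "open S \<Longrightarrow> bounded_linear L \<Longrightarrow> smooth_on S f \<Longrightarrow> smooth_on S (\<lambda>x. L (f x))"
  by (simp add: smooth_on_def smooth_k_linear)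

lemma smooth_on_add: "open S \<Longrightarrow> smooth_on S f \<Longrightarrow> smooth_on S g \<Longrightarrow> smooth_on S (\<lambda>x. f x + g x)"
  by (simp add: smooth_on_def smooth_k_add)

lemma smooth_on_const: "open S \<Longrightarrow> smooth_on S (\<lambda>x. c)"
  by (simp add: smooth_on_def smooth_k_const)

lemma smooth_on_sum: "open S \<Longrightarrow> (\<And>i. i \<in> A \<Longrightarrow> smooth_on S (f i)) \<Longrightarrow> smooth_on S (\<lambda>x. \<Sum>i\<in>A. f i x)"
  by (induction A rule: infinite_finite_induct) (simp_all add: smooth_on_add smooth_on_const)

lemma smooth_on_linear_scaleR:
  fixes c :: "'a::euclidean_space \<Rightarrow> real"
  assumes S: "open S" and c: "bounded_linear c" and f: "smooth_on S f"
  shows "smooth_on S (\<lambda>x. c x *\<^sub>R f x)"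
  unfolding smooth_on_def
proof
  fix k show "smooth_k k S (\<lambda>x. c x *\<^sub>R f x)"
    using f
  proof (induction k arbitrary: f)
    case 0
    then show ?case
      using smooth_on_continuous bounded_linear.continuous_on[OF c continuous_on_id]
      by (auto intro!: continuous_intros)
  next
    case (Suc k)
    show ?case
    proof (rule smooth_k_SucI[OF S has_derivative_scaleR[OF bounded_linear.has_derivative[OF c has_derivative_ident]
            smooth_on_has_derivative[OF Suc.prems S]]])
      fix v :: 'a assume v: "v \<in> Basis"
      have "smooth_k k S (\<lambda>x. c v *\<^sub>R f x)"
        using smooth_on_linear[OF S bounded_linear_scaleR_right Suc.prems] unfolding smooth_on_def by blast
      with Suc.IH[OF smooth_on_derivative[OF Suc.prems v]]
      show "smooth_k k S (\<lambda>x. c x *\<^sub>R frechet_derivative f (at x) v + c v *\<^sub>R f x)"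
        by (rule smooth_k_add[OF S])
    qed
  qed
qed

definition locally_summable :: "'a::metric_space set \<Rightarrow> (nat \<Rightarrow> 'a \<Rightarrow> 'b::real_normed_vector) \<Rightarrow> bool" where
  "locally_summable W f \<longleftrightarrow> (\<forall>x\<in>W. \<exists>e>0. \<exists>M. summable M \<and> (\<forall>y\<in>ball x e. \<forall>n. norm (f n y) \<le> M n))"

lemma locally_summableD:
  "locally_summable W f \<Longrightarrow> x \<in> W \<Longrightarrow> \<exists>e>0. \<exists>M. summable M \<and> (\<forall>y\<in>ball x e. \<forall>n. norm (f n y) \<le> M n)"
  by (simp add: locally_summable_def)

lemma locally_summable_summable:
  fixes f :: "nat \<Rightarrow> 'a::metric_space \<Rightarrow> 'b::banach"
  assumes "locally_summable W f" "x \<in> W"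
  shows "summable (\<lambda>n. f n x)"
proof -
  obtain e M where "0 < e" "summable M" "\<And>y n. y \<in> ball x e \<Longrightarrow> norm (f n y) \<le> M n"
    using locally_summableD[OF assms] by blast
  then have "norm (f n x) \<le> M n" for n by simp
  then show ?thesis by (rule summable_comparison_test'[OF \<open>summable M\<close>, of 0])
qed

lemma locally_summable_continuous:
  fixes f :: "nat \<Rightarrow> 'a::metric_space \<Rightarrow> 'b::banach"
  assumes W: "open W" and f: "locally_summable W f" and cont: "\<And>n. continuous_on W (f n)"
  shows "continuous_on W (\<lambda>x. \<Sum>n. f n x)"
  unfolding continuous_on_eq_continuous_at[OF W]
proof
  fix x assume x: "x \<in> W"
  obtain e M where e: "0 < e" "summable M" "\<And>y n. y \<in> ball x e \<Longrightarrow> norm (f n y) \<le> M n"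
    using locally_summableD[OF f x] by blast
  have "uniform_limit (ball x e \<inter> W) (\<lambda>n x. \<Sum>i<n. f i x) (\<lambda>x. \<Sum>n. f n x) sequentially"
    by (rule Weierstrass_m_test[OF _ e(2)]) (use e(3) in auto)
  then have "continuous_on (ball x e \<inter> W) (\<lambda>x. \<Sum>n. f n x)"
    by (rule uniform_limit_theorem[rotated])
      (auto intro!: always_eventually continuous_on_sum continuous_on_subset[OF cont])
  moreover have "open (ball x e \<inter> W)" using W by auto
  ultimately show "isCont (\<lambda>x. \<Sum>n. f n x) x"
    using x e(1) by (simp add: continuous_on_eq_continuous_at)
qed

lemma locally_summable_sum_norm:
  fixes f :: "'i \<Rightarrow> nat \<Rightarrow> 'a::metric_space \<Rightarrow> 'b::real_normed_vector"
  assumes "finite I" "\<And>i. i \<in> I \<Longrightarrow> locally_summable W (f i)"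
  shows "locally_summable W (\<lambda>n x. \<Sum>i\<in>I. norm (f i n x))"
  using assms
proof (induction I rule: finite_induct)
  case empty
  show ?case unfolding locally_summable_def by (auto intro!: exI[of _ "\<lambda>_. 0"] exI[of _ 1])
next
  case (insert i I)
  show ?case
    unfolding locally_summable_def
  proof
    fix x assume x: "x \<in> W"
    obtain e M where e: "0 < e" "summable M" "\<And>y n. y \<in> ball x e \<Longrightarrow> norm (f i n y) \<le> M n"
      using locally_summableD[OF insert.prems x, of i] by blast
    obtain e' M' where e': "0 < e'" "summable M'"
      "\<And>y n. y \<in> ball x e' \<Longrightarrow> norm (\<Sum>i\<in>I. norm (f i n y)) \<le> M' n"
      using locally_summableD[OF insert.IH[OF insert.prems] x] by blast
    have "norm (\<Sum>i\<in>insert i I. norm (f i n y)) \<le> M n + M' n" if "y \<in> ball x (min e e')" for y n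
      using e(3)[of y n] e'(3)[of y n] insert.hyps that by (simp add: abs_of_nonneg sum_nonneg)
    then show "\<exists>e>0. \<exists>M. summable M \<and> (\<forall>y\<in>ball x e. \<forall>n. norm (\<Sum>i\<in>insert i I. norm (f i n y)) \<le> M n)"
      using e e' by (intro exI[of _ "min e e'"] exI[of _ "\<lambda>n. M n + M' n"]) (auto intro: summable_add)
  qed
qed

lemma norm_linear_le_sum_Basis:
  fixes L :: "'a::euclidean_space \<Rightarrow> 'b::real_normed_vector"
  assumes "linear L"
  shows "norm (L v) \<le> (\<Sum>b\<in>Basis. norm (L b)) * norm v"
proof -
  have "L v = L (\<Sum>b\<in>Basis. inner v b *\<^sub>R b)" by (simp only: euclidean_representation)
  also have "\<dots> = (\<Sum>b\<in>Basis. inner v b *\<^sub>R L b)" by (simp add: linear_sum[OF assms] linear_scale[OF assms])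
  also have "norm \<dots> \<le> (\<Sum>b\<in>Basis. norm (L b) * norm v)"
    by (intro sum_norm_le) (simp add: mult.commute[of _ "norm (L _)"] mult_left_mono Basis_le_norm)
  finally show ?thesis by (simp add: sum_distrib_right)
qed

lemma norm_suminf_tail_le:
  fixes a :: "nat \<Rightarrow> 'a::banach"
  assumes M: "summable M" and a: "\<And>i. norm (a i) \<le> M i"
  shows "norm ((\<Sum>i<n. a i) - suminf a) \<le> (\<Sum>i. M (i + n))"
proof -
  have "summable a" using summable_comparison_test'[OF M, of 0 a] a by simp
  then have "norm ((\<Sum>i<n. a i) - suminf a) = norm (\<Sum>i. a (i + n))"
    by (simp add: suminf_minus_initial_segment norm_minus_commute)
  also have "\<dots> \<le> (\<Sum>i. M (i + n))"
    using a by (intro norm_suminf_le summable_ignore_initial_segment M) auto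
  finally show ?thesis .
qed

lemma has_derivative_suminf_dominated:
  fixes f :: "nat \<Rightarrow> 'a::real_normed_vector \<Rightarrow> 'b::banach"
  assumes S: "convex S" "open S" "x \<in> S" and deriv: "\<And>n y. y \<in> S \<Longrightarrow> (f n has_derivative D n y) (at y)"
    and M: "summable M" "\<And>n y v. y \<in> S \<Longrightarrow> norm (D n y v) \<le> M n * norm v" and f: "summable (\<lambda>n. f n x)"
  shows "((\<lambda>y. \<Sum>n. f n y) has_derivative (\<lambda>v. \<Sum>n. D n x v)) (at x)"
proof -
  have "\<exists>g. \<forall>y\<in>S. (\<lambda>n. f n y) sums g y \<and> (g has_derivative (\<lambda>v. \<Sum>n. D n y v)) (at y within S)"
  proof (rule has_derivative_series[OF S(1) _ _ S(3)])
    show "(f n has_derivative D n y) (at y within S)" if "y \<in> S" for n y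
      using deriv[OF that] by (rule has_derivative_at_withinI)
    show "(\<lambda>n. f n x) sums (\<Sum>n. f n x)" using f by (rule summable_sums)
    fix \<epsilon> :: real assume "0 < \<epsilon>"
    then obtain N where N: "\<And>n. N \<le> n \<Longrightarrow> norm (\<Sum>i. M (i + n)) < \<epsilon>"
      using suminf_exist_split[OF _ M(1)] by blast
    have "norm ((\<Sum>i<n. D i y h) - (\<Sum>i. D i y h)) \<le> \<epsilon> * norm h" if "N \<le> n" "y \<in> S" for n y h
    proof -
      have "norm ((\<Sum>i<n. D i y h) - (\<Sum>i. D i y h)) \<le> (\<Sum>i. M (i + n) * norm h)"
        using M(1) M(2)[OF that(2)] by (intro norm_suminf_tail_le summable_mult2)
      also have "\<dots> = (\<Sum>i. M (i + n)) * norm h"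
        by (intro suminf_mult2[symmetric] summable_ignore_initial_segment M(1))
      also have "\<dots> \<le> \<epsilon> * norm h" using N[OF that(1)] by (intro mult_right_mono) auto
      finally show ?thesis .
    qed
    then show "\<forall>\<^sub>F n in sequentially. \<forall>y\<in>S. \<forall>h. norm ((\<Sum>i<n. D i y h) - (\<Sum>i. D i y h)) \<le> \<epsilon> * norm h"
      by (intro eventually_sequentiallyI[of N]) blast
  qed
  then obtain g where g: "\<And>y. y \<in> S \<Longrightarrow> (\<lambda>n. f n y) sums g y" "(g has_derivative (\<lambda>v. \<Sum>n. D n x v)) (at x within S)"
    using S(3) by blast
  have "(g has_derivative (\<lambda>v. \<Sum>n. D n x v)) (at x)" using g(2) by (simp only: at_within_open[OF S(3,2)])
  then show ?thesis
    by (rule has_derivative_transform_within_open[OF _ S(2,3)]) (simp add: sums_unique[OF g(1)])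
qed

lemma has_derivative_suminf:
  fixes f :: "nat \<Rightarrow> 'a::euclidean_space \<Rightarrow> 'b::banach"
  assumes W: "open W" and deriv: "\<And>n x. x \<in> W \<Longrightarrow> (f n has_derivative D n x) (at x)"
    and f: "locally_summable W f" and Df: "\<And>b. b \<in> Basis \<Longrightarrow> locally_summable W (\<lambda>n x. D n x b)" and x: "x \<in> W"
  shows "((\<lambda>x. \<Sum>n. f n x) has_derivative (\<lambda>v. \<Sum>n. D n x v)) (at x)"
proof -
  obtain e M where e: "0 < e" "summable M" "\<And>y n. y \<in> ball x e \<Longrightarrow> norm (\<Sum>b\<in>Basis. norm (D n y b)) \<le> M n"
    using locally_summableD[OF locally_summable_sum_norm[of Basis W "\<lambda>b n x. D n x b"] x] Df by auto
  obtain e' where e': "0 < e'" "ball x e' \<subseteq> W" using W x openE by blast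
  define S where "S = ball x (min e e')"
  have S: "convex S" "open S" "x \<in> S" "S \<subseteq> W" using e e' by (auto simp: S_def)
  show ?thesis
  proof (rule has_derivative_suminf_dominated[OF S(1-3) deriv e(2)])
    show "norm (D n y v) \<le> M n * norm v" if "y \<in> S" for n y v
    proof -
      have "norm (D n y v) \<le> (\<Sum>b\<in>Basis. norm (D n y b)) * norm v"
        using deriv[of y n] S(4) that by (intro norm_linear_le_sum_Basis has_derivative_linear) blast
      also have "\<dots> \<le> M n * norm v"
        using e(3)[of y n] that by (intro mult_right_mono) (auto simp: S_def)
      finally show ?thesis .
    qed
    show "summable (\<lambda>n. f n x)" by (rule locally_summable_summable[OF f x])
  qed (use S(4) in blast)
qed

lemma smooth_on_suminf:
  fixes \<C> :: "(nat \<Rightarrow> 'a::euclidean_space \<Rightarrow> 'b::euclidean_space) \<Rightarrow> bool"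
  assumes W: "open W" and sum: "\<And>f. \<C> f \<Longrightarrow> locally_summable W f"
    and deriv: "\<And>f. \<C> f \<Longrightarrow> \<exists>D. (\<forall>n. \<forall>x\<in>W. (f n has_derivative D n x) (at x)) \<and> (\<forall>b\<in>Basis. \<C> (\<lambda>n x. D n x b))"
    and f: "\<C> f"
  shows "smooth_on W (\<lambda>x. \<Sum>n. f n x)"
  unfolding smooth_on_def
proof
  fix k show "smooth_k k W (\<lambda>x. \<Sum>n. f n x)"
    using f
  proof (induction k arbitrary: f)
    case 0
    obtain D where "\<And>n x. x \<in> W \<Longrightarrow> (f n has_derivative D n x) (at x)" using deriv[OF 0] by blast
    then have "continuous_on W (f n)" for n
      using has_derivative_continuous by (intro continuous_at_imp_continuous_on) blast
    then show ?case using locally_summable_continuous[OF W sum[OF 0]] by simp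
  next
    case (Suc k)
    obtain D where D: "\<And>n x. x \<in> W \<Longrightarrow> (f n has_derivative D n x) (at x)" "\<And>b. b \<in> Basis \<Longrightarrow> \<C> (\<lambda>n x. D n x b)"
      using deriv[OF Suc.prems] by blast
    show ?case
      by (rule smooth_k_SucI[OF W has_derivative_suminf[OF W D(1) sum[OF Suc.prems] sum[OF D(2)]]])
        (auto intro: Suc.IH D(2))
  qed
qed

section \<open>Sums of rapidly decreasing expansions are slice monogenic\<close>

type_synonym 'n slice_function = "real \<times> real \<times> (real ^ 'n) \<Rightarrow> 'n clif"
type_synonym 'n coeff_family = "nat \<Rightarrow> int \<Rightarrow> real ^ 'n \<Rightarrow> 'n clif"

definition index_enum :: "nat \<Rightarrow> int \<times> nat" where
  "index_enum = from_nat_into UNIV"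

lemma bij_index_enum: "bij index_enum"
proof -
  have "infinite (UNIV :: (int \<times> nat) set)" by (simp add: finite_prod)
  then show ?thesis unfolding index_enum_def by (intro bij_betw_from_nat_into) auto
qed

definition index_weight :: "int \<times> nat \<Rightarrow> real" where
  "index_weight = (\<lambda>(j, k). (1/2) ^ nat \<bar>j\<bar> / (real k + 1)\<^sup>2)"

lemma index_weight_nonneg: "0 \<le> index_weight jk"
  by (simp add: index_weight_def split_def)

lemma summable_inverse_squares: "summable (\<lambda>k. C / (real k + 1)\<^sup>2)"
proof -
  have "summable (\<lambda>k. 1 / (real (Suc k))\<^sup>2)"
    using summable_Suc_iff[of "\<lambda>k. inverse ((real k)\<^sup>2)"] inverse_power_summable[of 2, where 'a=real]
    by (simp add: inverse_eq_divide)
  from summable_mult[OF this, of C] show ?thesis by (simp add: add.commute)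
qed

lemma summable_on_half_powers: "(\<lambda>j::int. (1/2::real) ^ nat \<bar>j\<bar>) summable_on UNIV"
proof -
  have geometric: "(\<lambda>n. (1/2::real) ^ n) summable_on UNIV"
    by (intro norm_summable_imp_summable_on) (simp add: summable_geometric)
  have "(\<lambda>j::int. (1/2::real) ^ nat \<bar>j\<bar>) summable_on range int"
    by (subst summable_on_reindex) (use geometric in \<open>auto simp: o_def\<close>)
  moreover have "(\<lambda>j::int. (1/2::real) ^ nat \<bar>j\<bar>) summable_on range (\<lambda>n. - int (Suc n))"
  proof (subst summable_on_reindex)
    show "((\<lambda>j::int. (1/2::real) ^ nat \<bar>j\<bar>) \<circ> (\<lambda>n. - int (Suc n))) summable_on UNIV"
      using summable_on_cmult_right[OF geometric, of "1/2"] by (simp add: o_def nat_add_distrib)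
  qed (auto simp: inj_on_def)
  moreover have "j \<in> range int \<union> range (\<lambda>n. - int (Suc n))" for j by (cases j) auto
  then have "(UNIV :: int set) = range int \<union> range (\<lambda>n. - int (Suc n))" by blast
  moreover have "range int \<inter> range (\<lambda>n. - int (Suc n)) = {}" by auto
  ultimately show ?thesis using summable_on_Un_disjoint by metis
qed

lemma index_weight_summable_on: "index_weight summable_on UNIV"
proof -
  have squares: "(\<lambda>k. 1 / (real k + 1)\<^sup>2) summable_on (UNIV :: nat set)"
    using summable_inverse_squares[of 1] by (intro norm_summable_imp_summable_on) simp
  have "(\<lambda>x. norm (index_weight x)) summable_on (Sigma UNIV (\<lambda>_. UNIV))"
    unfolding Infinite_Sum.abs_summable_on_Sigma_iff
  proof (intro conjI ballI)
    show "(\<lambda>k. norm (index_weight (j, k))) summable_on UNIV" for j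
      using summable_on_cmult_right[OF squares, of "(1/2) ^ nat \<bar>j\<bar>"] by (simp add: index_weight_def)
    have "(\<Sum>\<^sub>\<infinity>k. norm (index_weight (j, k))) = (1/2) ^ nat \<bar>j\<bar> * (\<Sum>\<^sub>\<infinity>k. 1 / (real k + 1)\<^sup>2)" for j
      using infsum_cmult_right[OF squares, of "(1/2) ^ nat \<bar>j\<bar>"] by (simp add: index_weight_def)
    then show "(\<lambda>j. norm (\<Sum>\<^sub>\<infinity>k. norm (index_weight (j, k)))) summable_on UNIV"
      using summable_on_cmult_left[OF summable_on_half_powers] by (simp add: abs_mult infsum_nonneg)
  qed
  then show ?thesis by (simp add: index_weight_nonneg)
qed

lemma summable_index_weight: "summable (\<lambda>n. index_weight (index_enum n))"
  using index_weight_summable_on summable_on_reindex_bij_betw[OF bij_index_enum, of index_weight]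
      summable_on_imp_summable
  by blast

lemma locally_summable_index_enum:
  assumes "\<And>x. x \<in> W \<Longrightarrow> \<exists>e>0. \<exists>K. \<forall>y\<in>ball x e. \<forall>jk. norm (f jk y) \<le> K * index_weight jk"
  shows "locally_summable W (\<lambda>n. f (index_enum n))"
  unfolding locally_summable_def
proof
  fix x assume "x \<in> W"
  then obtain e K where "0 < e" "\<And>y jk. y \<in> ball x e \<Longrightarrow> norm (f jk y) \<le> K * index_weight jk"
    using assms by blast
  then show "\<exists>e>0. \<exists>M. summable M \<and> (\<forall>y\<in>ball x e. \<forall>n. norm (f (index_enum n) y) \<le> M n)"
    using summable_mult[OF summable_index_weight]
    by (intro exI[of _ e] conjI exI[of _ "\<lambda>n. K * index_weight (index_enum n)"]) auto
qed

lemma has_sum_index_enum: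
  fixes c :: "int \<times> nat \<Rightarrow> 'a::banach"
  assumes "\<And>jk. norm (c jk) \<le> K * index_weight jk"
  shows "(c has_sum s) UNIV \<longleftrightarrow> (\<lambda>n. c (index_enum n)) sums s"
proof -
  have abs_summable: "summable (\<lambda>n. norm (c (index_enum n)))"
    by (rule summable_comparison_test'[OF summable_mult[OF summable_index_weight, of K], of 0]) (simp add: assms)
  have "((\<lambda>n. c (index_enum n)) has_sum s) UNIV \<longleftrightarrow> (\<lambda>n. c (index_enum n)) sums s"
    by (rule iffI) (erule has_sum_imp_sums, erule norm_summable_imp_has_sum[OF abs_summable])
  then show ?thesis using has_sum_reindex_bij_betw[OF bij_index_enum, of c s] by simp
qed

definition rapidly_decaying :: "(nat \<Rightarrow> int \<Rightarrow> real) \<Rightarrow> bool" where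
  "rapidly_decaying c \<longleftrightarrow> (\<forall>m::nat. \<forall>a>0. \<exists>C>0. \<forall>k j. c k j \<le> C * a ^ nat \<bar>j\<bar> / (real k + 1) ^ m)"

lemma rapidly_decayingD:
  assumes "rapidly_decaying c" "0 < a"
  obtains C where "0 < C" "\<And>k j. c k j \<le> C * a ^ nat \<bar>j\<bar> / (real k + 1) ^ m"
  using assms unfolding rapidly_decaying_def by blast

lemma rapidly_decaying_dominated:
  assumes c: "rapidly_decaying c" and dominated: "\<And>k j. d k j \<le> K * (real k + 1) ^ t * c k j" and K: "0 \<le> K"
  shows "rapidly_decaying d"
  unfolding rapidly_decaying_def
proof (intro allI impI)
  fix m and a :: real assume a: "0 < a"
  obtain C where C: "0 < C" "\<And>k j. c k j \<le> C * a ^ nat \<bar>j\<bar> / (real k + 1) ^ (m + t)"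
    using rapidly_decayingD[OF c a] by blast
  have "d k j \<le> (K * C + 1) * a ^ nat \<bar>j\<bar> / (real k + 1) ^ m" for k j
  proof -
    have "d k j \<le> K * (real k + 1) ^ t * (C * a ^ nat \<bar>j\<bar> / (real k + 1) ^ (m + t))"
      using K C(2) by (intro order_trans[OF dominated] mult_left_mono) auto
    also have "\<dots> = (K * C) * a ^ nat \<bar>j\<bar> / (real k + 1) ^ m" by (simp add: power_add)
    also have "\<dots> \<le> (K * C + 1) * a ^ nat \<bar>j\<bar> / (real k + 1) ^ m"
      using a by (intro divide_right_mono mult_right_mono) auto
    finally show ?thesis .
  qed
  moreover have "0 < K * C + 1" using K C(1) by (intro add_nonneg_pos) auto
  ultimately show "\<exists>C>0. \<forall>k j. d k j \<le> C * a ^ nat \<bar>j\<bar> / (real k + 1) ^ m" by blast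
qed

lemma rapidly_decaying_reindex:
  assumes c: "rapidly_decaying c" and \<sigma>: "\<And>j. nat \<bar>j\<bar> \<le> nat \<bar>\<sigma> j\<bar> + l"
  shows "rapidly_decaying (\<lambda>k j. c k (\<sigma> j))"
  unfolding rapidly_decaying_def
proof (intro allI impI)
  fix m and a :: real assume a: "0 < a"
  define b where "b = min a 1"
  have b: "0 < b" "b \<le> 1" "b \<le> a" using a by (auto simp: b_def)
  obtain C where C: "0 < C" "\<And>k j. c k j \<le> C * b ^ nat \<bar>j\<bar> / (real k + 1) ^ m"
    using rapidly_decayingD[OF c b(1)] by blast
  have "c k (\<sigma> j) \<le> (C / b ^ l) * a ^ nat \<bar>j\<bar> / (real k + 1) ^ m" for k j
  proof -
    have "b ^ nat \<bar>\<sigma> j\<bar> * b ^ l \<le> b ^ nat \<bar>j\<bar>"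
      unfolding power_add[symmetric] using b \<sigma> by (intro power_decreasing) auto
    also have "\<dots> \<le> a ^ nat \<bar>j\<bar>" using b by (intro power_mono) auto
    finally have "b ^ nat \<bar>\<sigma> j\<bar> \<le> a ^ nat \<bar>j\<bar> / b ^ l" using b by (simp add: pos_le_divide_eq)
    then have "C * b ^ nat \<bar>\<sigma> j\<bar> / (real k + 1) ^ m \<le> C * (a ^ nat \<bar>j\<bar> / b ^ l) / (real k + 1) ^ m"
      using C(1) by (intro divide_right_mono mult_left_mono) auto
    then show ?thesis using C(2)[of k "\<sigma> j"] by simp
  qed
  moreover have "0 < C / b ^ l" using b C(1) by simp
  ultimately show "\<exists>C>0. \<forall>k j. c k (\<sigma> j) \<le> C * a ^ nat \<bar>j\<bar> / (real k + 1) ^ m" by blast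
qed

definition rapid_family :: "nat \<Rightarrow> 'n::{finite,linorder} coeff_family \<Rightarrow> bool" where
  "rapid_family t G \<longleftrightarrow> (\<forall>k j. hom_poly (k + t) (G k j)) \<and> rapidly_decaying (\<lambda>k j. sup_norm_S (G k j))"

lemma rapid_family_hom_poly: "rapid_family t G \<Longrightarrow> hom_poly (k + t) (G k j)"
  and rapid_family_decay: "rapid_family t G \<Longrightarrow> rapidly_decaying (\<lambda>k j. sup_norm_S (G k j))"
  by (simp_all add: rapid_family_def)

lemma rapid_family_continuous: "rapid_family t G \<Longrightarrow> continuous_on S (G k j)"
  by (rule hom_poly_continuous_on[OF rapid_family_hom_poly])

lemma rapid_family_dominated:
  assumes G: "rapid_family s G" and hom: "\<And>k j. hom_poly (k + t) (H k j)" and K: "0 \<le> K"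
    and dominated: "\<And>k j w. norm w = 1 \<Longrightarrow> norm (H k j w) \<le> K * (real k + 1) ^ d * sup_norm_S (G k j)"
  shows "rapid_family t H"
proof -
  have "sup_norm_S (H k j) \<le> K * (real k + 1) ^ d * sup_norm_S (G k j)" for k j
    by (intro sup_norm_S_le dominated)
  then show ?thesis
    unfolding rapid_family_def
    by (intro conjI allI hom rapidly_decaying_dominated[OF rapid_family_decay[OF G] _ K])
qed

lemma rapid_family_same_norm:
  assumes G: "rapid_family s G" and hom: "\<And>k j. hom_poly (k + t) (H k j)"
    and norm_le: "\<And>k j w. norm w = 1 \<Longrightarrow> norm (H k j w) \<le> norm (G k j w)"
  shows "rapid_family t H"
proof (rule rapid_family_dominated[OF G hom zero_le_one, where d=0])
  show "norm (H k j w) \<le> 1 * (real k + 1) ^ 0 * sup_norm_S (G k j)" if "norm w = 1" for k j w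
    using norm_le[OF that, of k j] norm_le_sup_norm_S[OF rapid_family_continuous[OF G] that, of k j] by simp
qed

lemma rapid_family_vec_mult:
  assumes P: "rapid_family 0 P"
  shows "rapid_family 1 (\<lambda>k j. vec_mult (P k j))"
proof (rule rapid_family_same_norm[OF P])
  show "hom_poly (k + 1) (vec_mult (P k j))" for k j
    using hom_poly_vec_mult[OF rapid_family_hom_poly[OF P]] by simp
qed (simp add: vec_mult_def norm_cl_vec_mult)

definition holomorphic_family :: "complex set \<Rightarrow> (int \<Rightarrow> nat \<Rightarrow> complex \<Rightarrow> complex) \<Rightarrow> bool" where
  "holomorphic_family U u \<longleftrightarrow> (\<forall>j k. u j k holomorphic_on U) \<and>
     (\<forall>z\<in>U. \<exists>e>0. \<exists>C\<ge>0. \<exists>B\<ge>0. \<forall>j k. \<forall>x\<in>ball z e. norm (u j k x) \<le> C * B ^ nat \<bar>j\<bar>)"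

lemma holomorphic_family_holomorphic: "holomorphic_family U u \<Longrightarrow> u j k holomorphic_on U"
  by (simp add: holomorphic_family_def)

lemma holomorphic_family_bound:
  assumes "holomorphic_family U u" "z \<in> U"
  obtains e C B where "0 < e" "0 \<le> C" "0 \<le> B" "\<And>j k x. x \<in> ball z e \<Longrightarrow> norm (u j k x) \<le> C * B ^ nat \<bar>j\<bar>"
  using assms unfolding holomorphic_family_def by meson

lemma holomorphic_family_has_derivative:
  assumes "holomorphic_family U u" "open U" "z \<in> U"
  shows "(u j k has_derivative (\<lambda>h. deriv (u j k) z * h)) (at z)"
  using holomorphic_derivI[OF holomorphic_family_holomorphic[OF assms(1)] assms(2,3)]
  by (simp add: has_field_derivative_def)

lemma norm_deriv_le_cball:
  assumes r: "0 < r" and holo: "f holomorphic_on cball x r" and B: "\<And>y. y \<in> cball x r \<Longrightarrow> norm (f y) \<le> B"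
  shows "norm (deriv f x) \<le> B / r"
proof -
  have "norm ((deriv ^^ 1) f x) \<le> fact 1 * B / r ^ 1"
  proof (rule Cauchy_inequality[OF _ _ r])
    show "f holomorphic_on ball x r" using holo by (rule holomorphic_on_subset) auto
    show "continuous_on (cball x r) f" using holo by (rule holomorphic_on_imp_continuous_on)
    show "norm (f y) \<le> B" if "norm (x - y) = r" for y using that by (intro B) (simp add: dist_norm)
  qed
  then show ?thesis by simp
qed

lemma holomorphic_family_deriv:
  assumes U: "open U" and u: "holomorphic_family U u"
  shows "holomorphic_family U (\<lambda>j k. deriv (u j k))"
  unfolding holomorphic_family_def
proof (intro conjI allI ballI)
  show "deriv (u j k) holomorphic_on U" for j k
    using holomorphic_family_holomorphic[OF u] U by (rule holomorphic_deriv)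
  fix z assume z: "z \<in> U"
  obtain e C B where e: "0 < e" "0 \<le> C" "0 \<le> B" "\<And>j k x. x \<in> ball z e \<Longrightarrow> norm (u j k x) \<le> C * B ^ nat \<bar>j\<bar>"
    using holomorphic_family_bound[OF u z] by blast
  obtain e' where e': "0 < e'" "ball z e' \<subseteq> U" using U z openE by blast
  define r where "r = min e e' / 2"
  have r: "0 < r" using e e' by (simp add: r_def)
  have cball: "cball x r \<subseteq> ball z e \<inter> U" if "x \<in> ball z r" for x
  proof -
    have "cball x r \<subseteq> ball z (r + r)"
    proof
      fix y assume "y \<in> cball x r"
      then show "y \<in> ball z (r + r)" using that dist_triangle[of z y x] by simp
    qed
    moreover have "ball z (r + r) \<subseteq> ball z e \<inter> U" using e' by (auto simp: r_def)
    ultimately show ?thesis by blast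
  qed
  have "norm (deriv (u j k) x) \<le> (C / r) * B ^ nat \<bar>j\<bar>" if x: "x \<in> ball z r" for j k x
  proof -
    have "norm (deriv (u j k) x) \<le> C * B ^ nat \<bar>j\<bar> / r"
      using cball[OF x] by (intro norm_deriv_le_cball[OF r] e(4)
          holomorphic_on_subset[OF holomorphic_family_holomorphic[OF u]]) auto
    then show ?thesis by simp
  qed
  then show "\<exists>e>0. \<exists>C\<ge>0. \<exists>B\<ge>0. \<forall>j k. \<forall>x\<in>ball z e. norm (deriv (u j k) x) \<le> C * B ^ nat \<bar>j\<bar>"
    using r e by (intro exI[of _ r] conjI exI[of _ "C / r"] exI[of _ B]) auto
qed

lemma holomorphic_family_cmult:
  assumes u: "holomorphic_family U u"
  shows "holomorphic_family U (\<lambda>j k z. c * u j k z)"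
  unfolding holomorphic_family_def
proof (intro conjI allI ballI)
  show "(\<lambda>z. c * u j k z) holomorphic_on U" for j k
    by (intro holomorphic_intros holomorphic_family_holomorphic[OF u])
  fix z assume z: "z \<in> U"
  obtain e C B where "0 < e" "0 \<le> C" "0 \<le> B" "\<And>j k x. x \<in> ball z e \<Longrightarrow> norm (u j k x) \<le> C * B ^ nat \<bar>j\<bar>"
    using holomorphic_family_bound[OF u z] by blast
  then show "\<exists>e>0. \<exists>C\<ge>0. \<exists>B\<ge>0. \<forall>j k. \<forall>x\<in>ball z e. norm (c * u j k x) \<le> C * B ^ nat \<bar>j\<bar>"
    by (intro exI[of _ e] conjI exI[of _ "norm c * C"] exI[of _ B])
      (auto simp: norm_mult mult.assoc intro!: mult_left_mono)
qed

lemma holomorphic_rapid_bound: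
  assumes u: "holomorphic_family U u" and G: "rapid_family t G" and z: "z \<in> U"
  obtains e K where "0 < e" "0 \<le> K"
    "\<And>j k x. x \<in> ball z e \<Longrightarrow> norm (u j k x) * sup_norm_S (G k j) \<le> K * index_weight (j, k)"
proof -
  obtain e C B where e: "0 < e" "0 \<le> C" "0 \<le> B" "\<And>j k x. x \<in> ball z e \<Longrightarrow> norm (u j k x) \<le> C * B ^ nat \<bar>j\<bar>"
    using holomorphic_family_bound[OF u z] by blast
  define a where "a = 1 / (2 * (B + 1))"
  have a: "0 < a" "B * a \<le> 1/2" using e(3) by (auto simp: a_def field_simps)
  obtain C' where C': "0 < C'" "\<And>k j. sup_norm_S (G k j) \<le> C' * a ^ nat \<bar>j\<bar> / (real k + 1)\<^sup>2"
    using rapidly_decayingD[OF rapid_family_decay[OF G] a(1), of 2] by blast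
  have "norm (u j k x) * sup_norm_S (G k j) \<le> (C * C') * index_weight (j, k)" if "x \<in> ball z e" for j k x
  proof -
    have "norm (u j k x) * sup_norm_S (G k j) \<le> (C * B ^ nat \<bar>j\<bar>) * (C' * a ^ nat \<bar>j\<bar> / (real k + 1)\<^sup>2)"
      using e(2,3) e(4)[OF that] C'(2) sup_norm_S_nonneg[OF rapid_family_continuous[OF G]] by (intro mult_mono) auto
    also have "\<dots> = (C * C') * ((B * a) ^ nat \<bar>j\<bar> / (real k + 1)\<^sup>2)" by (simp add: power_mult_distrib mult_ac)
    also have "\<dots> \<le> (C * C') * ((1/2) ^ nat \<bar>j\<bar> / (real k + 1)\<^sup>2)"
      using a e C' by (intro mult_left_mono divide_right_mono power_mono) auto
    finally show ?thesis by (simp add: index_weight_def)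
  qed
  then show ?thesis using e C' by (intro that[of e "C * C'"]) auto
qed

text \<open>The partial derivative in direction \<open>i\<close> of $G(y)/|y|^N$ is $(|y|^2\partial_iG(y)-N y_iG(y))/|y|^{N+2}$.\<close>

definition radial_partial :: "nat \<Rightarrow> 'n \<Rightarrow> (real ^ 'n::{finite,linorder} \<Rightarrow> 'n clif) \<Rightarrow> (real, 'n) vec \<Rightarrow> 'n clif" where
  "radial_partial N i G y = (norm y)\<^sup>2 *\<^sub>R partial_deriv G i y - (real N * y $ i) *\<^sub>R G y"

lemma hom_poly_radial_partial:
  assumes G: "hom_poly d G"
  shows "hom_poly (Suc d) (radial_partial N i G)"
proof -
  have "hom_poly (Suc d) (\<lambda>y. (norm y)\<^sup>2 *\<^sub>R partial_deriv G i y)"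
  proof (cases d)
    case 0
    then show ?thesis using G by (simp add: hom_poly_0_partial_deriv hom_poly_zero)
  next
    case (Suc l)
    have "hom_poly (Suc (Suc l)) (\<lambda>y. \<Sum>m\<in>UNIV. y $ m *\<^sub>R (y $ m *\<^sub>R partial_deriv G i y))"
      using G Suc by (intro hom_poly_sum hom_poly_coord hom_poly_partial_deriv) simp
    moreover have "(norm y)\<^sup>2 *\<^sub>R partial_deriv G i y = (\<Sum>m\<in>UNIV. y $ m *\<^sub>R (y $ m *\<^sub>R partial_deriv G i y))" for y
      by (simp add: power2_norm_eq_inner inner_vec_def scaleR_sum_left)
    ultimately show ?thesis using Suc by simp
  qed
  moreover have "hom_poly (Suc d) (\<lambda>y. real N *\<^sub>R (y $ i *\<^sub>R G y))"
    by (intro hom_poly_scaleR hom_poly_coord G)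
  ultimately show ?thesis
    unfolding radial_partial_def[abs_def] using hom_poly_diff[of "Suc d"] by simp
qed

lemma norm_radial_partial_sphere_le:
  fixes G :: "real ^ 'n::{finite,linorder} \<Rightarrow> 'n clif"
  assumes G: "hom_poly d G" and M: "\<And>y. norm y = 1 \<Longrightarrow> norm (G y) \<le> M" and w: "norm w = 1"
  shows "norm (radial_partial N i G w) \<le> (2 * (real d + 1)\<^sup>2 + real N) * M"
proof -
  have "norm (radial_partial N i G w) \<le> norm (partial_deriv G i w) + norm ((real N * w $ i) *\<^sub>R G w)"
    unfolding radial_partial_def w power_one scaleR_one by (rule norm_triangle_ineq4)
  also have "\<dots> \<le> 2 * (real d + 1)\<^sup>2 * M * norm (axis i 1 :: (real, 'n) vec) + (real N * 1) * M"
    unfolding partial_deriv_def norm_scaleR abs_mult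
    using component_le_norm_cart[of w i] w
    by (intro add_mono norm_derivative_hom_poly_sphere G M mult_mono) auto
  also have "\<dots> = (2 * (real d + 1)\<^sup>2 + real N) * M" by (simp add: distrib_right)
  finally show ?thesis .
qed

lemma rapid_family_radial_partial:
  assumes G: "rapid_family t G"
  shows "rapid_family (Suc t) (\<lambda>k j. radial_partial (s + (k + t)) i (G k j))"
proof (rule rapid_family_dominated[OF G])
  show "hom_poly (k + Suc t) (radial_partial (s + (k + t)) i (G k j))" for k j
    using hom_poly_radial_partial[OF rapid_family_hom_poly[OF G]] by simp
  fix k j and w :: "(real, 'a) vec" assume w: "norm w = 1"
  let ?S = "sup_norm_S (G k j)"
  have "real (k + t) + 1 \<le> (real k + 1) * (real t + 1)" by (simp add: algebra_simps)
  then have "(real (k + t) + 1)\<^sup>2 \<le> (real k + 1)\<^sup>2 * (real t + 1)\<^sup>2"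
    unfolding power_mult_distrib[symmetric] by (intro power_mono) auto
  moreover have "real (s + (k + t)) \<le> (real s + real t + 1) * (real k + 1)\<^sup>2"
    by (simp add: power2_eq_square algebra_simps)
  ultimately have "2 * (real (k + t) + 1)\<^sup>2 + real (s + (k + t))
      \<le> 2 * ((real k + 1)\<^sup>2 * (real t + 1)\<^sup>2) + (real s + real t + 1) * (real k + 1)\<^sup>2"
    by linarith
  also have "\<dots> = (2 * (real t + 1)\<^sup>2 + (real s + real t + 1)) * (real k + 1)\<^sup>2" by algebra
  finally have "2 * (real (k + t) + 1)\<^sup>2 + real (s + (k + t))
      \<le> (2 * (real t + 1)\<^sup>2 + (real s + real t + 1)) * (real k + 1)\<^sup>2" .
  then have "(2 * (real (k + t) + 1)\<^sup>2 + real (s + (k + t))) * ?S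
      \<le> (2 * (real t + 1)\<^sup>2 + (real s + real t + 1)) * (real k + 1)\<^sup>2 * ?S"
    using sup_norm_S_nonneg[OF rapid_family_continuous[OF G]] by (rule mult_right_mono)
  then show "norm (radial_partial (s + (k + t)) i (G k j) w)
      \<le> (2 * (real t + 1)\<^sup>2 + (real s + real t + 1)) * (real k + 1)\<^sup>2 * ?S"
    using norm_radial_partial_sphere_le[OF rapid_family_hom_poly[OF G]
        norm_le_sup_norm_S[OF rapid_family_continuous[OF G]] w]
    by (rule order_trans[rotated])
qed simp

definition radial_quotient :: "nat \<Rightarrow> (real ^ 'n::{finite,linorder} \<Rightarrow> 'n clif) \<Rightarrow> (real, 'n) vec \<Rightarrow> 'n clif" where
  "radial_quotient N G y = (1 / norm y ^ N) *\<^sub>R G y"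

lemma has_derivative_inverse_norm_power:
  fixes y :: "'a::real_inner"
  assumes y: "y \<noteq> 0"
  shows "((\<lambda>y. 1 / norm y ^ N) has_derivative (\<lambda>h. - (real N * inner y h) / norm y ^ Suc (Suc N))) (at y)"
proof (cases N)
  case (Suc M)
  have norm: "((\<lambda>x. norm x) has_derivative (\<lambda>h. inner h (sgn y))) (at y)"
    using has_derivative_norm[OF y] by simp
  have "((\<lambda>y. 1 / norm y ^ N) has_derivative
      (\<lambda>h. - (real N * (inner h (sgn y) * norm y ^ (N - 1))) / (norm y ^ N * norm y ^ N))) (at y)"
    using y by (auto intro!: derivative_eq_intros norm simp: fun_eq_iff)
  moreover have "real N * (inner h (sgn y) * norm y ^ (N - 1)) / (norm y ^ N * norm y ^ N)
      = real N * inner y h / norm y ^ Suc (Suc N)" for h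
    using y by (simp add: Suc sgn_div_norm inner_commute divide_simps)
  ultimately show ?thesis by simp
qed simp

lemma has_derivative_radial_quotient:
  fixes y :: "real ^ 'n::{finite,linorder}"
  assumes G: "hom_poly d G" and y: "y \<noteq> 0"
  shows "(radial_quotient N G has_derivative
    (\<lambda>v. \<Sum>i\<in>UNIV. v $ i *\<^sub>R radial_quotient (Suc (Suc N)) (radial_partial N i G) y)) (at y)"
proof -
  note differentiable = hom_poly_differentiable[OF G, of y]
  have "(radial_quotient N G has_derivative (\<lambda>v. (1 / norm y ^ N) *\<^sub>R frechet_derivative G (at y) v
      + (- (real N * inner y v) / norm y ^ Suc (Suc N)) *\<^sub>R G y)) (at y)"
    unfolding radial_quotient_def[abs_def]
    by (rule has_derivative_scaleR[OF has_derivative_inverse_norm_power[OF y]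
        has_derivative_frechet[OF differentiable]])
  moreover have "(1 / norm y ^ N) *\<^sub>R frechet_derivative G (at y) v
      + (- (real N * inner y v) / norm y ^ Suc (Suc N)) *\<^sub>R G y
      = (\<Sum>i\<in>UNIV. v $ i *\<^sub>R radial_quotient (Suc (Suc N)) (radial_partial N i G) y)" for v
  proof -
    have "radial_quotient (Suc (Suc N)) (radial_partial N i G) y = (1 / norm y ^ N) *\<^sub>R partial_deriv G i y
        - (real N * y $ i / norm y ^ Suc (Suc N)) *\<^sub>R G y" for i
      using y by (simp add: radial_quotient_def radial_partial_def scaleR_diff_right power2_eq_square)
    then show ?thesis
      by (simp add: frechet_derivative_eq_sum_partial_deriv[OF differentiable] scaleR_sum_right scaleR_diff_right
          sum_subtractf inner_vec_def mult_ac scaleR_sum_left[symmetric] sum_distrib_left sum_divide_distrib)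
  qed
  ultimately show ?thesis by simp
qed

lemma norm_radial_quotient_le:
  assumes G: "hom_poly d G" and M: "\<And>w. norm w = 1 \<Longrightarrow> norm (G w) \<le> M" and y: "0 < \<rho>" "\<rho> \<le> norm y"
  shows "norm (radial_quotient (s + d) G y) \<le> M / \<rho> ^ s"
proof -
  have y_pos: "0 < norm y" using y by linarith
  have M_nonneg: "0 \<le> M"
    using norm_ge_zero[of "G (axis undefined 1)"] M[of "axis undefined 1"] by (simp add: order_trans[OF norm_ge_zero])
  have "norm (radial_quotient (s + d) G y) \<le> (M * norm y ^ d) / norm y ^ (s + d)"
    using norm_hom_poly_le[OF G M, of y] y_pos by (simp add: radial_quotient_def divide_right_mono)
  also have "\<dots> = M / norm y ^ s" using y_pos by (simp add: power_add)
  also have "\<dots> \<le> M / \<rho> ^ s" using M_nonneg y y_pos by (intro frac_le power_mono) auto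
  finally show ?thesis .
qed

definition smooth_term :: "(int \<Rightarrow> nat \<Rightarrow> complex \<Rightarrow> complex) \<Rightarrow> 'n::{finite,linorder} coeff_family
    \<Rightarrow> nat \<Rightarrow> nat \<Rightarrow> int \<times> nat \<Rightarrow> 'n slice_function" where
  "smooth_term u G s t = (\<lambda>(j, k) (x0, p, y). Re (u j k (Complex x0 p)) *\<^sub>R radial_quotient (s + (k + t)) (G k j) y)"

definition smooth_dom :: "complex set \<Rightarrow> (real \<times> real \<times> (real ^ 'n)) set" where
  "smooth_dom U = {(x0, p, y). Complex x0 p \<in> U \<and> y \<noteq> 0}"

lemma open_smooth_dom: "open U \<Longrightarrow> open (smooth_dom U :: (real \<times> real \<times> (real ^ 'n)) set)"
proof -
  assume U: "open U"
  have "smooth_dom U = (\<lambda>z::real \<times> real \<times> (real ^ 'n). Complex (fst z) (fst (snd z))) -` U \<inter> {z. snd (snd z) \<noteq> 0}"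
    by (auto simp: smooth_dom_def)
  also have "open \<dots>"
    by (intro open_Int open_vimage[OF U] open_Collect_neq continuous_intros)
  finally show ?thesis .
qed

lemma smooth_term_bound:
  fixes G :: "'n::{finite,linorder} coeff_family"
  assumes u: "holomorphic_family U u" and G: "rapid_family t G" and z0: "z0 \<in> smooth_dom U"
  obtains e K where "0 < e" "\<And>z jk. z \<in> ball z0 e \<Longrightarrow> norm (smooth_term u G s t jk z) \<le> K * index_weight jk"
proof -
  obtain x0 p y where z0_eq: "z0 = (x0, p, y)" and U: "Complex x0 p \<in> U" and y: "y \<noteq> 0"
    using z0 by (auto simp: smooth_dom_def)
  obtain e K where e: "0 < e" "0 \<le> K"
    "\<And>j k x. x \<in> ball (Complex x0 p) e \<Longrightarrow> norm (u j k x) * sup_norm_S (G k j) \<le> K * index_weight (j, k)"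
    using holomorphic_rapid_bound[OF u G U] by blast
  define \<rho> where "\<rho> = norm y / 2"
  have \<rho>: "0 < \<rho>" using y by (simp add: \<rho>_def)
  have bound: "norm (smooth_term u G s t jk z) \<le> (K / \<rho> ^ s) * index_weight jk" if z: "z \<in> ball z0 (min e \<rho>)" for z jk
  proof -
    obtain x1 q v where z_eq: "z = (x1, q, v)" by (cases z)
    obtain j k where jk: "jk = (j, k)" by (cases jk)
    have "norm (Complex a b) \<le> norm (a, b, d)" "norm d \<le> norm (a, b, d)" for a b and d :: "(real, 'n) vec"
      by (simp_all add: norm_Pair cmod_def real_sqrt_le_iff real_le_rsqrt)
    from this[where a="x0 - x1" and b="p - q" and d="y - v"]
    have "dist (Complex x0 p) (Complex x1 q) < e" "norm (y - v) < \<rho>"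
      using z by (auto simp: z0_eq z_eq dist_norm complex_diff)
    moreover from this(2) have v: "\<rho> \<le> norm v" using norm_triangle_ineq2[of y v] by (simp add: \<rho>_def)
    ultimately have e_bound: "norm (u j k (Complex x1 q)) * sup_norm_S (G k j) \<le> K * index_weight jk"
      unfolding jk by (intro e(3)) simp
    have "norm (smooth_term u G s t jk z)
        = \<bar>Re (u j k (Complex x1 q))\<bar> * norm (radial_quotient (s + (k + t)) (G k j) v)"
      by (simp add: smooth_term_def z_eq jk)
    also have "\<dots> \<le> norm (u j k (Complex x1 q)) * (sup_norm_S (G k j) / \<rho> ^ s)"
      using norm_le_sup_norm_S[OF rapid_family_continuous[OF G]] v
      by (intro mult_mono abs_Re_le_cmod norm_radial_quotient_le rapid_family_hom_poly[OF G] \<rho>) auto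
    also have "\<dots> \<le> (K * index_weight jk) / \<rho> ^ s"
      using divide_right_mono[OF e_bound] \<rho> by simp
    finally show ?thesis by simp
  qed
  then show ?thesis using e(1) \<rho> by (intro that[of "min e \<rho>" "K / \<rho> ^ s"]) auto
qed

lemma locally_summable_smooth_term:
  assumes "holomorphic_family U u" "rapid_family t G"
  shows "locally_summable (smooth_dom U) (\<lambda>n. smooth_term u G s t (index_enum n))"
  using smooth_term_bound[OF assms] by (intro locally_summable_index_enum) metis

definition smooth_term_deriv :: "(int \<Rightarrow> nat \<Rightarrow> complex \<Rightarrow> complex) \<Rightarrow> 'n::{finite,linorder} coeff_family
    \<Rightarrow> nat \<Rightarrow> nat \<Rightarrow> int \<times> nat \<Rightarrow> real \<times> real \<times> (real, 'n) vec \<Rightarrow> 'n slice_function" where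
  "smooth_term_deriv u G s t = (\<lambda>(j, k) (x0, p, y) (v0, vp, v).
     Re (u j k (Complex x0 p)) *\<^sub>R
       (\<Sum>i\<in>UNIV. v $ i *\<^sub>R radial_quotient (Suc (Suc (s + (k + t)))) (radial_partial (s + (k + t)) i (G k j)) y)
     + Re (deriv (u j k) (Complex x0 p) * Complex v0 vp) *\<^sub>R radial_quotient (s + (k + t)) (G k j) y)"

lemma has_derivative_smooth_term:
  fixes G :: "'n::{finite,linorder} coeff_family"
  assumes U: "open U" and u: "holomorphic_family U u" and G: "rapid_family t G" and z: "z \<in> smooth_dom U"
  shows "(smooth_term u G s t jk has_derivative smooth_term_deriv u G s t jk z) (at z)"
proof -
  obtain x0 p y where z_eq: "z = (x0, p, y)" and in_U: "Complex x0 p \<in> U" and y: "y \<noteq> 0"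
    using z by (auto simp: smooth_dom_def)
  obtain j k where jk: "jk = (j, k)" by (cases jk)
  let ?N = "s + (k + t)"
  let ?C = "\<lambda>v::real \<times> real \<times> (real, 'n) vec. Complex (fst v) (fst (snd v))"
  let ?dR = "\<lambda>v. \<Sum>i\<in>UNIV. v $ i *\<^sub>R radial_quotient (Suc (Suc ?N)) (radial_partial ?N i (G k j)) y"
  have "(?C has_derivative ?C) (at z)"
    unfolding Complex_eq by (auto intro!: derivative_eq_intros)
  from has_derivative_compose[OF this holomorphic_family_has_derivative[OF u U]] in_U
  have "((\<lambda>z. u j k (?C z)) has_derivative (\<lambda>v. deriv (u j k) (?C z) * ?C v)) (at z)"
    by (simp add: z_eq)
  then have complex_factor: "((\<lambda>z. Re (u j k (?C z))) has_derivative (\<lambda>v. Re (deriv (u j k) (?C z) * ?C v))) (at z)"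
    by (rule bounded_linear.has_derivative[OF bounded_linear_Re])
  have "((\<lambda>z::real \<times> real \<times> (real, 'n) vec. snd (snd z)) has_derivative (\<lambda>v. snd (snd v))) (at z)"
    by (auto intro!: derivative_eq_intros)
  moreover have "(radial_quotient ?N (G k j) has_derivative ?dR) (at (snd (snd z)))"
    using has_derivative_radial_quotient[OF rapid_family_hom_poly[OF G] y] by (simp add: z_eq)
  ultimately have vector_factor: "((\<lambda>z::real \<times> real \<times> (real, 'n) vec. radial_quotient ?N (G k j) (snd (snd z)))
      has_derivative (\<lambda>v. ?dR (snd (snd v)))) (at z)"
    by (rule has_derivative_compose)
  have "smooth_term u G s t jk = (\<lambda>z. Re (u j k (?C z)) *\<^sub>R radial_quotient ?N (G k j) (snd (snd z)))"
    by (auto simp: smooth_term_def jk fun_eq_iff)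
  moreover have "smooth_term_deriv u G s t jk z = (\<lambda>v. Re (u j k (?C z)) *\<^sub>R ?dR (snd (snd v))
      + Re (deriv (u j k) (?C z) * ?C v) *\<^sub>R radial_quotient ?N (G k j) (snd (snd z)))"
    by (auto simp: smooth_term_deriv_def jk z_eq fun_eq_iff)
  ultimately show ?thesis using has_derivative_scaleR[OF complex_factor vector_factor] by simp
qed

lemma Basis_real_real_vec_cases:
  fixes b :: "real \<times> real \<times> (real ^ 'n)"
  assumes "b \<in> Basis"
  obtains "b = (1, 0, 0)" | "b = (0, 1, 0)" | i where "b = (0, 0, axis i 1)"
proof -
  have "b = (1, 0, 0) \<or> b = (0, 1, 0) \<or> (\<exists>i. b = (0, 0, axis i 1))"
    using assms by (auto simp: Basis_prod_def Basis_vec_def zero_prod_def)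
  then show ?thesis using that by blast
qed

lemma smooth_term_deriv_Basis:
  "(\<lambda>jk z. smooth_term_deriv u G s t jk z (1, 0, 0)) = smooth_term (\<lambda>j k. deriv (u j k)) G s t"
  "(\<lambda>jk z. smooth_term_deriv u G s t jk z (0, 1, 0)) = smooth_term (\<lambda>j k z. \<i> * deriv (u j k) z) G s t"
  "(\<lambda>jk z. smooth_term_deriv u G s t jk z (0, 0, axis i 1))
    = smooth_term u (\<lambda>k j. radial_partial (s + (k + t)) i (G k j)) (Suc s) (Suc t)"
proof -
  have units: "Complex 1 0 = 1" "Complex 0 0 = 0" "Complex 0 1 = \<i>" by (auto simp: complex_eq_iff)
  show "(\<lambda>jk z. smooth_term_deriv u G s t jk z (1, 0, 0)) = smooth_term (\<lambda>j k. deriv (u j k)) G s t"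
    "(\<lambda>jk z. smooth_term_deriv u G s t jk z (0, 1, 0)) = smooth_term (\<lambda>j k z. \<i> * deriv (u j k) z) G s t"
    by (auto simp: fun_eq_iff smooth_term_deriv_def smooth_term_def units mult.commute)
  have "(\<Sum>l\<in>UNIV. axis i (1::real) $ l *\<^sub>R h l) = h i" for h :: "'a \<Rightarrow> 'a clif"
    by (simp add: axis_def if_distrib if_distribR cong: if_cong)
  then show "(\<lambda>jk z. smooth_term_deriv u G s t jk z (0, 0, axis i 1))
      = smooth_term u (\<lambda>k j. radial_partial (s + (k + t)) i (G k j)) (Suc s) (Suc t)"
    by (auto simp: fun_eq_iff smooth_term_deriv_def smooth_term_def units)
qed

lemma smooth_term_deriv_Basis_family:
  fixes G :: "'n::{finite,linorder} coeff_family"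
  assumes U: "open U" and u: "holomorphic_family U u" and G: "rapid_family t G" and b: "b \<in> Basis"
  shows "\<exists>u' G' s' t'. holomorphic_family U u' \<and> rapid_family t' G' \<and>
    (\<lambda>jk z. smooth_term_deriv u G s t jk z b) = smooth_term u' G' s' t'"
  using b
proof (cases rule: Basis_real_real_vec_cases)
  case 1
  then show ?thesis using smooth_term_deriv_Basis(1) holomorphic_family_deriv[OF U u] G by blast
next
  case 2
  then show ?thesis
    using smooth_term_deriv_Basis(2) holomorphic_family_cmult[OF holomorphic_family_deriv[OF U u]] G by blast
next
  case (3 i)
  then show ?thesis using smooth_term_deriv_Basis(3) rapid_family_radial_partial[OF G] u by blast
qed

lemma smooth_on_smooth_term_sum:
  fixes G :: "'n::{finite,linorder} coeff_family"
  assumes U: "open U" and u: "holomorphic_family U u" and G: "rapid_family t G"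
  shows "smooth_on (smooth_dom U) (\<lambda>z. \<Sum>n. smooth_term u G s t (index_enum n) z)"
proof (rule smooth_on_suminf[where \<C>="\<lambda>f. \<exists>u G s t. holomorphic_family U u \<and> rapid_family t G \<and>
    f = (\<lambda>n. smooth_term u G s t (index_enum n))"])
  show "open (smooth_dom U :: (real \<times> real \<times> (real, 'n) vec) set)" using U by (rule open_smooth_dom)
next
  fix f :: "nat \<Rightarrow> 'n slice_function"
  assume "\<exists>u G s t. holomorphic_family U u \<and> rapid_family t G \<and> f = (\<lambda>n. smooth_term u G s t (index_enum n))"
  then obtain u G s t where f: "holomorphic_family U u" "rapid_family t G"
    "f = (\<lambda>n. smooth_term u G s t (index_enum n))"
    by blast
  then show "locally_summable (smooth_dom U) f" by (simp add: locally_summable_smooth_term)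
  have "\<exists>u' G' s' t'. holomorphic_family U u' \<and> rapid_family t' G' \<and>
      (\<lambda>n z. smooth_term_deriv u G s t (index_enum n) z b) = (\<lambda>n. smooth_term u' G' s' t' (index_enum n))"
    if b: "b \<in> Basis" for b
    using smooth_term_deriv_Basis_family[OF U f(1,2) b, of s] by (metis (no_types))
  then show "\<exists>D. (\<forall>n. \<forall>x\<in>smooth_dom U. (f n has_derivative D n x) (at x)) \<and>
      (\<forall>b\<in>Basis. \<exists>u G s t. holomorphic_family U u \<and> rapid_family t G \<and>
        (\<lambda>n x. D n x b) = (\<lambda>n. smooth_term u G s t (index_enum n)))"
    using has_derivative_smooth_term[OF U f(1,2)] unfolding f(3)
    by (intro exI[of _ "\<lambda>n. smooth_term_deriv u G s t (index_enum n)"]) blast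
next
  show "\<exists>u' G' s' t'. holomorphic_family U u' \<and> rapid_family t' G' \<and>
      (\<lambda>n. smooth_term u G s t (index_enum n)) = (\<lambda>n. smooth_term u' G' s' t' (index_enum n))"
    by (intro exI conjI) (rule u, rule G, rule refl)
qed

definition slice_term :: "(int \<Rightarrow> nat \<Rightarrow> complex \<Rightarrow> complex) \<Rightarrow> 'n::{finite,linorder} coeff_family
    \<Rightarrow> complex \<Rightarrow> (real, 'n) vec \<Rightarrow> int \<times> nat \<Rightarrow> 'n clif" where
  "slice_term u P z w = (\<lambda>(j, k). slice_act w (u j k z) (P k j w))"

definition slice_series :: "(int \<Rightarrow> nat \<Rightarrow> complex \<Rightarrow> complex) \<Rightarrow> 'n::{finite,linorder} coeff_family
    \<Rightarrow> complex \<Rightarrow> (real, 'n) vec \<Rightarrow> 'n clif" where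
  "slice_series u P z w = (\<Sum>n. slice_term u P z w (index_enum n))"

lemma slice_term_bound:
  assumes u: "holomorphic_family U u" and P: "rapid_family 0 P" and z: "z \<in> U"
  obtains e K where "0 < e" "0 \<le> K"
    "\<And>x w jk. x \<in> ball z e \<Longrightarrow> norm w = 1 \<Longrightarrow> norm (slice_term u P x w jk) \<le> K * index_weight jk"
proof -
  obtain e K where e: "0 < e" "0 \<le> K"
    "\<And>j k x. x \<in> ball z e \<Longrightarrow> norm (u j k x) * sup_norm_S (P k j) \<le> K * index_weight (j, k)"
    using holomorphic_rapid_bound[OF u P z] by blast
  have "norm (slice_term u P x w (j, k)) \<le> K * index_weight (j, k)" if "x \<in> ball z e" "norm w = 1" for x w j k
  proof -
    have "norm (slice_term u P x w (j, k)) = norm (u j k x) * norm (P k j w)"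
      by (simp add: slice_term_def norm_slice_act[OF that(2)])
    also have "\<dots> \<le> norm (u j k x) * sup_norm_S (P k j)"
      by (intro mult_left_mono norm_le_sup_norm_S rapid_family_continuous[OF P] that(2)) simp
    also have "\<dots> \<le> K * index_weight (j, k)" by (rule e(3)[OF that(1)])
    finally show ?thesis .
  qed
  with e(1,2) show ?thesis by (intro that[of e K]) auto
qed

lemma locally_summable_slice_term:
  assumes "holomorphic_family U u" "rapid_family 0 P" "norm w = 1"
  shows "locally_summable U (\<lambda>n z. slice_term u P z w (index_enum n))"
  using slice_term_bound[OF assms(1,2)] assms(3)
  by (intro locally_summable_index_enum[of U "\<lambda>jk z. slice_term u P z w jk"]) metis

lemma summable_slice_term:
  "holomorphic_family U u \<Longrightarrow> rapid_family 0 P \<Longrightarrow> z \<in> U \<Longrightarrow> norm w = 1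
    \<Longrightarrow> summable (\<lambda>n. slice_term u P z w (index_enum n))"
  by (rule locally_summable_summable[OF locally_summable_slice_term])

lemma has_sum_slice_series:
  assumes "holomorphic_family U u" "rapid_family 0 P" "z \<in> U" "norm w = 1"
  shows "(slice_term u P z w has_sum slice_series u P z w) UNIV"
proof -
  obtain e K where "0 < e" "\<And>x jk. x \<in> ball z e \<Longrightarrow> norm (slice_term u P x w jk) \<le> K * index_weight jk"
    using slice_term_bound[OF assms(1-3)] assms(4) by metis
  then have "norm (slice_term u P z w jk) \<le> K * index_weight jk" for jk by simp
  then show ?thesis
    using has_sum_index_enum summable_sums[OF summable_slice_term[OF assms]] unfolding slice_series_def by blast
qed

lemma has_derivative_slice_series:
  assumes U: "open U" and u: "holomorphic_family U u" and P: "rapid_family 0 P" and z: "z \<in> U" and w: "norm w = 1"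
  shows "((\<lambda>z. slice_series u P z w) has_derivative
    (\<lambda>h. slice_act w h (slice_series (\<lambda>j k. deriv (u j k)) P z w))) (at z)"
proof -
  note u' = holomorphic_family_deriv[OF U u]
  define D where "D n z h = slice_act w h (slice_term (\<lambda>j k. deriv (u j k)) P z w (index_enum n))" for n z h
  have D_eq: "D n z h = slice_term (\<lambda>j k z. h * deriv (u j k) z) P z w (index_enum n)" for n z h
    by (simp add: D_def slice_term_def split_def slice_act_mult[OF w])
  have "((\<lambda>z. slice_term u P z w (index_enum n)) has_derivative D n z) (at z)" if "z \<in> U" for n z
  proof -
    obtain j k where jk: "index_enum n = (j, k)" by (cases "index_enum n")
    have "((\<lambda>z. slice_act w (u j k z) (P k j w)) has_derivative (\<lambda>h. slice_act w (deriv (u j k) z * h) (P k j w)))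
        (at z)"
      by (rule bounded_linear.has_derivative[OF slice_act.bounded_linear_left
            holomorphic_family_has_derivative[OF u U that]])
    then show ?thesis
      unfolding D_eq[abs_def] by (simp add: slice_term_def jk mult.commute)
  qed
  then have "((\<lambda>z. slice_series u P z w) has_derivative (\<lambda>h. \<Sum>n. D n z h)) (at z)"
    unfolding slice_series_def
  proof (rule has_derivative_suminf[OF U _ locally_summable_slice_term[OF u P w] _ z])
    show "locally_summable U (\<lambda>n z. D n z b)" for b
      unfolding D_eq by (rule locally_summable_slice_term[OF holomorphic_family_cmult[OF u'] P w])
  qed
  also have "(\<lambda>h. \<Sum>n. D n z h) = (\<lambda>h. slice_act w h (slice_series (\<lambda>j k. deriv (u j k)) P z w))"
    unfolding D_def slice_series_def
    by (intro ext bounded_linear.suminf[OF slice_act.bounded_linear_right, symmetric]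
        summable_slice_term[OF u' P z w])
  finally show ?thesis .
qed

lemma has_derivative_complex_partials:
  fixes f :: "real \<times> real \<times> 'a \<Rightarrow> 'b::real_normed_vector"
  assumes f: "((\<lambda>z. f (Re z, Im z, w)) has_derivative L) (at (Complex x0 p))"
  shows "((\<lambda>t. f (t, p, w)) has_vector_derivative L 1) (at x0)"
    and "((\<lambda>t. f (x0, t, w)) has_vector_derivative L \<i>) (at p)"
proof -
  have "((\<lambda>t. Complex t p) has_vector_derivative 1) (at x0)" "((\<lambda>t. Complex x0 t) has_vector_derivative \<i>) (at p)"
    unfolding Complex_eq
    by (auto intro!: derivative_eq_intros has_vector_derivative_of_real
        simp: has_vector_derivative_def scaleR_conv_of_real)
  from this[THEN vector_derivative_diff_chain_within, OF has_derivative_at_withinI[OF f]]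
  show "((\<lambda>t. f (t, p, w)) has_vector_derivative L 1) (at x0)"
    and "((\<lambda>t. f (x0, t, w)) has_vector_derivative L \<i>) (at p)"
    by (simp_all add: o_def)
qed

text \<open>On the sphere, $(a+\underline\omega b)P=aP+b\,\underline\omega P$ is the sum of two terms of the smooth form.\<close>

lemma slice_series_eq_smooth_terms:
  assumes u: "holomorphic_family U u" and P: "rapid_family 0 P" and z: "Complex x0 p \<in> U" and w: "norm w = 1"
  shows "slice_series u P (Complex x0 p) w = (\<Sum>n. smooth_term u P 0 0 (index_enum n) (x0, p, w))
      + (\<Sum>n. smooth_term (\<lambda>j k z. - \<i> * u j k z) (\<lambda>k j. vec_mult (P k j)) 0 1 (index_enum n) (x0, p, w))"
proof -
  have dom: "(x0, p, w) \<in> smooth_dom U" using z w by (auto simp: smooth_dom_def)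
  have term_eq: "slice_term u P (Complex x0 p) w jk = smooth_term u P 0 0 jk (x0, p, w)
      + smooth_term (\<lambda>j k z. - \<i> * u j k z) (\<lambda>k j. vec_mult (P k j)) 0 1 jk (x0, p, w)" for jk
    using w by (cases jk) (simp add: smooth_term_def radial_quotient_def slice_term_def slice_act_def vec_mult_def)
  show ?thesis
    unfolding slice_series_def term_eq
    by (intro suminf_add[symmetric] locally_summable_summable[OF locally_summable_smooth_term dom]
        u P holomorphic_family_cmult rapid_family_vec_mult)
qed

lemma slice_series_slice_monogenic:
  fixes P :: "'n::{finite,linorder} coeff_family"
  assumes U: "open U" and u: "holomorphic_family U u" and P: "rapid_family 0 P"
    and f: "\<And>x0 p w. Complex x0 p \<in> U \<Longrightarrow> norm w = 1 \<Longrightarrow> f (x0, p, w) = slice_series u P (Complex x0 p) w"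
  shows "slice_monogenic {(x0, p). Complex x0 p \<in> U} f"
proof -
  let ?U = "{(x0, p). Complex x0 p \<in> U}"
  define F where "F z = (\<Sum>n. smooth_term u P 0 0 (index_enum n) z)
    + (\<Sum>n. smooth_term (\<lambda>j k z. - \<i> * u j k z) (\<lambda>k j. vec_mult (P k j)) 0 1 (index_enum n) z)" for z
  have "?U = (\<lambda>z. Complex (fst z) (snd z)) -` U" by auto
  then have "open ?U" using open_vimage[OF U, of "\<lambda>z. Complex (fst z) (snd z)"] by (simp add: continuous_intros)
  moreover have "smooth_on (smooth_dom U) F"
    unfolding F_def[abs_def]
    by (intro smooth_on_add open_smooth_dom U smooth_on_smooth_term_sum u P holomorphic_family_cmult
        rapid_family_vec_mult[OF P])
  moreover have "F z = f z" if "z \<in> sdom ?U" for z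
    using that f slice_series_eq_smooth_terms[OF u P] by (auto simp: sdom_def F_def)
  moreover have "sdom ?U \<subseteq> (smooth_dom U :: (real \<times> real \<times> (real, 'n) vec) set)"
    by (auto simp: sdom_def smooth_dom_def)
  ultimately have "open ?U" "smooth_on_sdom ?U f"
    unfolding smooth_on_sdom_def using open_smooth_dom[OF U] by blast+
  moreover have "\<exists>D0 Dp. ((\<lambda>t. f (t, p, w)) has_vector_derivative D0) (at x0) \<and>
      ((\<lambda>t. f (x0, t, w)) has_vector_derivative Dp) (at p) \<and> (1/2) *\<^sub>R (D0 + cl_vec w \<star> Dp) = 0"
    if z: "Complex x0 p \<in> U" and w: "norm w = 1" for x0 p and w :: "(real, 'n) vec"
  proof -
    define D where "D = slice_series (\<lambda>j k. deriv (u j k)) P (Complex x0 p) w"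
    have "((\<lambda>z. f (Re z, Im z, w)) has_derivative (\<lambda>h. slice_act w h D)) (at (Complex x0 p))"
      unfolding D_def
      by (rule has_derivative_transform_within_open[OF has_derivative_slice_series[OF U u P z w] U z]) (simp add: f w)
    note has_derivative_complex_partials[OF this]
    moreover have "(1/2) *\<^sub>R (slice_act w 1 D + cl_vec w \<star> slice_act w \<i> D) = 0"
      using w by (simp add: slice_act_ii cl_vec_square)
    ultimately show ?thesis by blast
  qed
  ultimately show ?thesis unfolding slice_monogenic_def by auto
qed

section \<open>Laurent coefficients of slice monogenic functions\<close>

lemma slice_monogenic_smooth_extension:
  assumes "slice_monogenic U f"
  obtains W F where "open W" "sdom U \<subseteq> W" "smooth_on W F" "\<And>z. z \<in> sdom U \<Longrightarrow> F z = f z"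
  using assms unfolding slice_monogenic_def smooth_on_sdom_def by blast

lemma slice_monogenic_continuous:
  assumes "slice_monogenic U f"
  shows "continuous_on (sdom U) f"
proof -
  obtain W F where W: "open W" "sdom U \<subseteq> W" "smooth_on W F" and F: "\<And>z. z \<in> sdom U \<Longrightarrow> F z = f z"
    by (rule slice_monogenic_smooth_extension[OF assms]) (rule that)
  have "continuous_on (sdom U) F" by (rule continuous_on_subset[OF smooth_on_continuous[OF W(3)] W(2)])
  then show ?thesis by (rule continuous_on_eq) (rule F)
qed

lemma slice_monogenic_has_derivative:
  fixes f :: "'n::{finite,linorder} slice_function"
  assumes f: "slice_monogenic U f" and z: "(x0, p) \<in> U" and w: "norm w = 1"
  obtains D where "((\<lambda>z. f (Re z, Im z, w)) has_derivative (\<lambda>h. slice_act w h D)) (at (Complex x0 p))"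
proof -
  obtain W F where W: "open W" "sdom U \<subseteq> W" "smooth_on W F" and F: "\<And>z. z \<in> sdom U \<Longrightarrow> F z = f z"
    by (rule slice_monogenic_smooth_extension[OF f]) (rule that)
  define L where "L h = frechet_derivative F (at (x0, p, w)) (Re h, Im h, 0)" for h
  have "(x0, p, w) \<in> W" using W(2) z w by (auto simp: sdom_def)
  note F_deriv = smooth_on_has_derivative[OF W(3,1) this]
  have "((\<lambda>z. (Re z, Im z, w)) has_derivative (\<lambda>h. (Re h, Im h, 0))) (at (Complex x0 p))"
    by (auto intro!: derivative_eq_intros)
  from has_derivative_compose[OF this, of F] F_deriv
  have "((\<lambda>z. F (Re z, Im z, w)) has_derivative L) (at (Complex x0 p))"
    unfolding L_def by simp
  moreover have "open ((\<lambda>z. (Re z, Im z)) -` U)"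
    using f unfolding slice_monogenic_def by (intro open_vimage continuous_intros) blast+
  ultimately have deriv: "((\<lambda>z. f (Re z, Im z, w)) has_derivative L) (at (Complex x0 p))"
    by (rule has_derivative_transform_within_open) (use z w F in \<open>auto simp: sdom_def\<close>)
  obtain D0 Dp where D: "((\<lambda>t. f (t, p, w)) has_vector_derivative D0) (at x0)"
    "((\<lambda>t. f (x0, t, w)) has_vector_derivative Dp) (at p)" "D0 + cl_vec w \<star> Dp = 0"
    using f[unfolded slice_monogenic_def, THEN conjunct2, THEN conjunct2, rule_format, of x0 p w] z w by auto
  then have partials: "L 1 + cl_vec w \<star> L \<i> = 0"
    using has_derivative_complex_partials[OF deriv] vector_derivative_unique_at by blast
  have "L h = slice_act w h (L 1)" for h
  proof -
    have linear: "linear L" using deriv by (rule has_derivative_linear)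
    have "cl_vec w \<star> (L 1 + cl_vec w \<star> L \<i>) = 0" unfolding partials by (rule cl_mult.zero_right)
    then have "L \<i> = cl_vec w \<star> L 1" using w by (simp add: cl_mult.add_right cl_vec_square)
    moreover have "h = Re h *\<^sub>R 1 + Im h *\<^sub>R \<i>" by (simp add: complex_eq_iff)
    then have "L h = L (Re h *\<^sub>R 1 + Im h *\<^sub>R \<i>)" by (rule arg_cong)
    then have "L h = Re h *\<^sub>R L 1 + Im h *\<^sub>R L \<i>"
      by (simp only: linear_add[OF linear] linear_scale[OF linear])
    ultimately show ?thesis by (simp add: slice_act_def)
  qed
  then have "L = (\<lambda>h. slice_act w h (L 1))" by (rule ext)
  then show ?thesis using that[of "L 1"] deriv by argo
qed

text \<open>A family of real-linear functionals that separates points and turns the action of \<open>z\<close>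
  into multiplication by \<open>z\<close>; composed with it, a slice monogenic function becomes holomorphic.\<close>

definition slice_functional :: "real ^ 'n::{finite,linorder} \<Rightarrow> 'n clif \<Rightarrow> 'n clif \<Rightarrow> complex" where
  "slice_functional w b x = Complex (inner x b) (- inner (cl_vec w \<star> x) b)"

lemma bounded_linear_slice_functional: "bounded_linear (slice_functional w b)"
  unfolding linear_conv_bounded_linear[symmetric] linear_iff slice_functional_def
  by (simp add: complex_eq_iff inner_add_left cl_mult.add_right cl_mult.scaleR_right)

lemma slice_functional_scaleR: "slice_functional w b (c *\<^sub>R x) = of_real c * slice_functional w b x"
  by (simp add: slice_functional_def complex_eq_iff cl_mult.scaleR_right)

lemma slice_functional_slice_act:
  assumes "norm w = 1"
  shows "slice_functional w b (slice_act w z x) = z * slice_functional w b x"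
  using assms by (simp add: slice_functional_def slice_act_def complex_eq_iff inner_add_left inner_diff_left
      cl_mult.add_right cl_mult.diff_right cl_mult.scaleR_right cl_vec_square algebra_simps)

lemma slice_functional_eqI: "(\<And>b. slice_functional w b x = slice_functional w b y) \<Longrightarrow> x = y"
  by (rule euclidean_eqI) (simp add: slice_functional_def)

lemma holomorphic_slice_functional:
  assumes f: "slice_monogenic U f" and w: "norm w = 1"
  shows "(\<lambda>z. slice_functional w b (f (Re z, Im z, w))) holomorphic_on {z. (Re z, Im z) \<in> U}"
  unfolding holomorphic_on_def
proof
  fix z assume "z \<in> {z. (Re z, Im z) \<in> U}"
  then obtain D where "((\<lambda>z. f (Re z, Im z, w)) has_derivative (\<lambda>h. slice_act w h D)) (at z)"
    using slice_monogenic_has_derivative[OF f _ w, of "Re z" "Im z"] by auto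
  from bounded_linear.has_derivative[OF bounded_linear_slice_functional this, of w b]
  have "((\<lambda>z. slice_functional w b (f (Re z, Im z, w))) has_field_derivative slice_functional w b D) (at z)"
    by (simp add: slice_functional_slice_act[OF w] has_field_derivative_def
        mult.commute[of _ "slice_functional w b D"])
  then show "(\<lambda>z. slice_functional w b (f (Re z, Im z, w))) field_differentiable at z within {z. (Re z, Im z) \<in> U}"
    unfolding field_differentiable_def by (blast intro: has_field_derivative_at_within)
qed

definition circle_trace :: "(real \<times> real \<times> (real ^ 'n) \<Rightarrow> 'a) \<Rightarrow> real \<Rightarrow> (real, 'n) vec \<Rightarrow> real \<Rightarrow> 'a" where
  "circle_trace f r w \<theta> = f (r * cos \<theta>, r * sin \<theta>, w)"

lemma circle_nonzero: "0 < (r::real) \<Longrightarrow> (r * cos \<theta>, r * sin \<theta>) \<noteq> (0, 0)"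
  using sin_zero_norm_cos_one[of \<theta>] by auto

lemma circle_in_sphere:
  assumes "0 \<le> r"
  shows "(r * cos \<theta>, r * sin \<theta>) \<in> sphere 0 r"
proof -
  have "(r * cos \<theta>)\<^sup>2 + (r * sin \<theta>)\<^sup>2 = r\<^sup>2" by (simp add: power_mult_distrib flip: distrib_left)
  then show ?thesis using assms by (simp add: norm_Pair)
qed

lemma circle_in_sdom_punct: "0 < r \<Longrightarrow> norm w = 1 \<Longrightarrow> (r * cos \<theta>, r * sin \<theta>, w) \<in> sdom punct"
  using circle_nonzero[of r \<theta>] by (simp add: sdom_def)

lemma continuous_on_circle_trace:
  fixes f :: "real \<times> real \<times> (real ^ 'n) \<Rightarrow> 'a::topological_space"
  assumes f: "continuous_on (sdom punct) f" and r: "0 < r"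
  shows "continuous_on (S \<times> sphere 0 1) (\<lambda>(\<theta>, w). circle_trace f r w \<theta>)"
    and "norm w = 1 \<Longrightarrow> continuous_on S (circle_trace f r w)"
    and "continuous_on (sphere 0 1) (\<lambda>w. circle_trace f r w \<theta>)"
proof -
  show "continuous_on (S \<times> sphere 0 1) (\<lambda>(\<theta>, w). circle_trace f r w \<theta>)"
    unfolding circle_trace_def split_def
    by (rule continuous_on_compose2[OF f]) (use circle_in_sdom_punct[OF r] in \<open>auto intro!: continuous_intros\<close>)
  show "continuous_on S (circle_trace f r w)" if "norm w = 1"
    unfolding circle_trace_def
    by (rule continuous_on_compose2[OF f]) (use circle_in_sdom_punct[OF r that] in \<open>auto intro!: continuous_intros\<close>)
  show "continuous_on (sphere 0 1) (\<lambda>w. circle_trace f r w \<theta>)"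
    unfolding circle_trace_def
    by (rule continuous_on_compose2[OF f]) (use circle_in_sdom_punct[OF r] in \<open>auto intro!: continuous_intros\<close>)
qed

lemma contour_integral_circlepath_powi:
  assumes r: "0 < r"
  shows "contour_integral (circlepath 0 r) (\<lambda>z. z powi (- j - 1) * g z)
    = \<i> * of_real (r powi (- j)) * integral {0..2 * pi} (\<lambda>\<theta>. cis (- (real_of_int j * \<theta>)) * g (of_real r * cis \<theta>))"
proof -
  have "(of_real r * cis \<theta>) powi (- j - 1) * g (of_real r * cis \<theta>) * of_real r * \<i> * cis \<theta>
      = \<i> * of_real (r powi (- j)) * (cis (- (real_of_int j * \<theta>)) * g (of_real r * cis \<theta>))" for \<theta>
  proof -
    have "(of_real r * cis \<theta>) powi (- j - 1) * (of_real r * cis \<theta>) = (of_real r * cis \<theta>) powi (- j)"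
      using r power_int_add_1[of "of_real r * cis \<theta>" "- j - 1"] by simp
    also have "\<dots> = of_real (r powi (- j)) * cis (- (real_of_int j * \<theta>))"
      by (simp only: power_int_mult_distrib cis_power_int of_real_power_int) simp
    finally have "(of_real r * cis \<theta>) powi (- j - 1) * (of_real r * cis \<theta>) * (\<i> * g (of_real r * cis \<theta>))
        = of_real (r powi (- j)) * cis (- (real_of_int j * \<theta>)) * (\<i> * g (of_real r * cis \<theta>))" by (rule arg_cong)
    then show ?thesis by (simp only: mult_ac)
  qed
  then show ?thesis
    unfolding circlepath_def
    by (subst contour_integral_part_circlepath_eq) (simp_all only: add_0 integral_mult_right pi_gt_zero
        zero_less_mult_iff zero_less_numeral simp_thms)
qed

lemma slice_functional_fourier_coeff:
  assumes w: "norm w = 1" and r: "0 < r" and f: "continuous_on (sdom punct) f"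
  shows "slice_functional w b (fourier_coeff w j (circle_trace f r w)) = of_real (r powi j) / (2 * pi * \<i>) *
    contour_integral (circlepath 0 r) (\<lambda>z. z powi (- j - 1) * slice_functional w b (f (Re z, Im z, w)))"
proof -
  let ?\<phi> = "\<lambda>\<theta>. slice_functional w b (circle_trace f r w \<theta>)"
  let ?T = "\<lambda>\<theta>. cis (- (real_of_int j * \<theta>)) * ?\<phi> \<theta>"
  have "(\<lambda>\<theta>. slice_act w (cis (- (real_of_int j * \<theta>))) (circle_trace f r w \<theta>)) integrable_on {0..2 * pi}"
    by (intro fourier_integrable continuous_on_circle_trace f r w)
  from integral_linear[OF this bounded_linear_slice_functional, of w b]
  have "slice_functional w b (fourier_coeff w j (circle_trace f r w))
      = of_real (1 / (2 * pi)) * integral {0..2 * pi} ?T"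
    by (simp add: fourier_coeff_def slice_functional_scaleR o_def slice_functional_slice_act[OF w])
  moreover have "contour_integral (circlepath 0 r) (\<lambda>z. z powi (- j - 1) * slice_functional w b (f (Re z, Im z, w)))
      = \<i> * of_real (r powi (- j)) * integral {0..2 * pi} ?T"
    by (simp add: contour_integral_circlepath_powi[OF r] circle_trace_def)
  moreover have "of_real (r powi j) * of_real (r powi (- j)) = (1 :: complex)"
    using r by (simp add: power_int_minus flip: of_real_mult)
  ultimately show ?thesis by (simp add: field_simps)
qed

definition laurent_coeff :: "'n::{finite,linorder} slice_function \<Rightarrow> int \<Rightarrow> (real, 'n) vec \<Rightarrow> 'n clif" where
  "laurent_coeff f j w = fourier_coeff w j (circle_trace f 1 w)"

text \<open>By Cauchy's theorem the contour integrals over all circles around the origin agree.\<close>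

lemma fourier_coeff_eq_laurent_coeff:
  fixes f :: "'n::{finite,linorder} slice_function"
  assumes f: "slice_monogenic punct f" and w: "norm w = 1" and r: "0 < r"
  shows "fourier_coeff w j (circle_trace f r w) = r powi j *\<^sub>R laurent_coeff f j w"
proof (rule slice_functional_eqI)
  fix b
  let ?\<phi> = "\<lambda>z. z powi (- j - 1) * slice_functional w b (f (Re z, Im z, w))"
  have punct: "{z. (Re z, Im z) \<in> punct} = UNIV - {0}" by (auto simp: complex_eq_iff)
  have "(\<lambda>z. slice_functional w b (f (Re z, Im z, w))) holomorphic_on UNIV - {0}"
    using holomorphic_slice_functional[OF f w, of b] unfolding punct .
  then have "?\<phi> holomorphic_on UNIV - {0}" by (intro holomorphic_intros) auto
  then have "contour_integral (circlepath 0 (max 1 r)) ?\<phi> = contour_integral (circlepath 0 s) ?\<phi>"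
      if "0 < s" "s \<le> max 1 r" for s
    using that by (intro contour_integral_circlepath_eq(3)[where s=UNIV]) auto
  from this[of r] this[of 1]
  have "contour_integral (circlepath 0 r) ?\<phi> = contour_integral (circlepath 0 1) ?\<phi>"
    using r by simp
  then show "slice_functional w b (fourier_coeff w j (circle_trace f r w))
      = slice_functional w b (r powi j *\<^sub>R laurent_coeff f j w)"
    unfolding laurent_coeff_def
    using slice_functional_fourier_coeff[OF w _ slice_monogenic_continuous[OF f], of _ b j] r
    by (simp add: slice_functional_scaleR)
qed

lemma norm_laurent_coeff_le:
  assumes f: "slice_monogenic punct f" and w: "norm w = 1" and r: "0 < r"
    and M: "\<And>\<theta>. norm (circle_trace f r w \<theta>) \<le> M"
  shows "r powi j * norm (laurent_coeff f j w) \<le> M"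
  using norm_fourier_coeff_le[OF continuous_on_circle_trace(2)[OF slice_monogenic_continuous[OF f] r w] M w, of j]
    fourier_coeff_eq_laurent_coeff[OF f w r] r by simp

section \<open>Uniqueness of Laurent coefficients\<close>

lemma continuous_on_circle: "continuous_on (sphere 0 1) g \<Longrightarrow> continuous_on S (\<lambda>\<theta>. g (cis \<theta>))"
  by (rule continuous_on_compose2[of "sphere 0 1" g]) (auto intro!: continuous_intros)

lemma continuous_on_real_polynomial_function: "real_polynomial_function p \<Longrightarrow> continuous_on S p"
  by (simp add: real_polynomial_function_eq continuous_on_polymonial_function)

lemma fourier_coeff_real_polynomial_eq_0:
  fixes g :: "complex \<Rightarrow> 'n::{finite,linorder} clif"
  assumes p: "real_polynomial_function p" and w: "norm w = 1"
    and g: "continuous_on (sphere 0 1) g" "\<And>m. fourier_coeff w m (\<lambda>\<theta>. g (cis \<theta>)) = 0"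
  shows "fourier_coeff w m (\<lambda>\<theta>. p (cis \<theta>) *\<^sub>R g (cis \<theta>)) = 0"
  using p g
proof (induction arbitrary: g m rule: real_polynomial_function.induct)
  case (linear p)
  interpret p: bounded_linear p by (rule linear(1))
  have "cis \<theta> = cos \<theta> *\<^sub>R 1 + sin \<theta> *\<^sub>R \<i>" for \<theta> by (simp add: complex_eq_iff)
  then have p: "p (cis \<theta>) = p 1 * cos \<theta> + p \<i> * sin \<theta>" for \<theta>
    by (simp only: p.add p.scaleR) (simp add: mult.commute)
  have g: "continuous_on {0..2 * pi} (\<lambda>\<theta>. g (cis \<theta>))" using linear(2) by (rule continuous_on_circle)
  have "fourier_coeff w m (\<lambda>\<theta>. slice_act w (cis (real_of_int l * \<theta>)) (slice_act w z (g (cis \<theta>)))) = 0" for l z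
    unfolding fourier_coeff_shift[OF w] fourier_coeff_slice_act[OF w g] linear(3) by (rule slice_act.zero_right)
  from this[of 1] this[of "-1"] show ?case
    unfolding p scaleR_trig_eq_slice_act[OF w]
    by (subst fourier_coeff_add) (auto intro!: continuous_intros g)
next
  case (const c)
  then show ?case by (simp add: fourier_coeff_scaleR)
next
  case (add p q)
  have "continuous_on {0..2 * pi} (\<lambda>\<theta>. q (cis \<theta>) *\<^sub>R g (cis \<theta>))" if "real_polynomial_function q" for q
    using that add.prems(1)
    by (intro continuous_intros continuous_on_circle continuous_on_real_polynomial_function)
  then show ?case using add by (simp add: scaleR_add_left fourier_coeff_add)
next
  case (mult p q)
  have "continuous_on (sphere 0 1) (\<lambda>z. q z *\<^sub>R g z)"
    using mult.hyps(2) mult.prems(1) by (intro continuous_intros continuous_on_real_polynomial_function)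
  from mult.IH(1)[OF this] mult.IH(2)[OF mult.prems] show ?case by simp
qed

lemma integral_inner_polynomial_eq_0:
  fixes g :: "complex \<Rightarrow> 'n::{finite,linorder} clif"
  assumes w: "norm w = 1" and g: "continuous_on (sphere 0 1) g" "\<And>m. fourier_coeff w m (\<lambda>\<theta>. g (cis \<theta>)) = 0"
    and p: "polynomial_function p"
  shows "integral {0..2 * pi} (\<lambda>\<theta>. inner (g (cis \<theta>)) (p (cis \<theta>))) = 0"
proof -
  note cont = continuous_on_circle[OF g(1)] continuous_on_circle[OF continuous_on_polymonial_function[OF p]]
  have "integral {0..2 * pi} (\<lambda>\<theta>. inner (p (cis \<theta>)) b * inner (g (cis \<theta>)) b) = 0" if "b \<in> Basis" for b
  proof -
    have q: "real_polynomial_function (\<lambda>z. inner (p z) b)"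
      using p that by (simp add: polynomial_function_iff_Basis_inner)
    have "integral {0..2 * pi} (\<lambda>\<theta>. inner (p (cis \<theta>)) b *\<^sub>R g (cis \<theta>)) = 0"
      using fourier_coeff_real_polynomial_eq_0[OF q w g, of 0] by (simp add: fourier_coeff_def)
    moreover have "(\<lambda>\<theta>. inner (p (cis \<theta>)) b *\<^sub>R g (cis \<theta>)) integrable_on {0..2 * pi}"
      by (intro integrable_continuous_real continuous_intros cont)
    ultimately show ?thesis
      using integral_linear[OF _ bounded_linear_inner_left,
          of "\<lambda>\<theta>. inner (p (cis \<theta>)) b *\<^sub>R g (cis \<theta>)" "{0..2 * pi}" b]
      by (simp add: o_def)
  qed
  then show ?thesis
    by (subst euclidean_inner, subst integral_sum)
      (auto intro!: integrable_continuous_real continuous_intros cont simp: mult.commute)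
qed

lemma fourier_coeff_eq_0_imp:
  fixes g :: "complex \<Rightarrow> 'n::{finite,linorder} clif"
  assumes w: "norm w = 1" and g: "continuous_on (sphere 0 1) g" "\<And>m. fourier_coeff w m (\<lambda>\<theta>. g (cis \<theta>)) = 0"
    and z: "norm z = 1"
  shows "g z = 0"
proof -
  let ?L = "\<lambda>h::complex \<Rightarrow> real. integral {0..2 * pi} (\<lambda>\<theta>. h (cis \<theta>))"
  have "?L (\<lambda>z. inner (g z) (g z)) = 0"
  proof (rule orthogonal_to_polynomials_imp_square_0[OF compact_sphere g(1), where C="2 * pi"])
    show "?L (\<lambda>z. f z - h z) = ?L f - ?L h" if "continuous_on (sphere 0 1) f" "continuous_on (sphere 0 1) h" for f h
      using that by (intro integral_diff integrable_continuous_real continuous_on_circle)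
    show "\<bar>?L f\<bar> \<le> 2 * pi * B" if "continuous_on (sphere 0 1) f" "\<And>z. z \<in> sphere 0 1 \<Longrightarrow> \<bar>f z\<bar> \<le> B" for f B
      using integral_bound[OF _ continuous_on_circle[OF that(1)], of 0 "2 * pi" B] that(2) by (simp add: mult.commute)
  qed (rule integral_inner_polynomial_eq_0[OF w g])
  then have "\<forall>\<theta>\<in>{0..2 * pi}. g (cis \<theta>) = 0"
    by (subst (asm) integral_eq_0_iff) (auto intro!: continuous_intros continuous_on_circle[OF g(1)])
  moreover have "z = cis (Arg2pi z)"
    using z Arg2pi_eq[of z] by (simp add: cis_conv_exp)
  moreover have "Arg2pi z \<in> {0..2 * pi}" using Arg2pi_ge_0[of z] Arg2pi_lt_2pi[of z] by simp
  ultimately show ?thesis by metis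
qed

lemma laurent_coeff_unique:
  fixes f h :: "'n::{finite,linorder} slice_function"
  assumes f: "slice_monogenic punct f" and h: "slice_monogenic punct h" and w: "norm w = 1"
    and coeff_eq: "\<And>j. laurent_coeff f j w = laurent_coeff h j w" and z: "(x0, p) \<noteq> (0, 0)"
  shows "f (x0, p, w) = h (x0, p, w)"
proof -
  define r where "r = norm (Complex x0 p)"
  have r: "0 < r" using z by (auto simp: r_def complex_eq_iff)
  define \<zeta> where "\<zeta> = Complex x0 p / of_real r"
  have \<zeta>: "norm \<zeta> = 1" "r * Re \<zeta> = x0" "r * Im \<zeta> = p"
    using r by (simp_all add: \<zeta>_def norm_divide) (simp add: r_def)
  have dom: "(r * Re \<xi>, r * Im \<xi>, w) \<in> sdom punct" if "norm \<xi> = 1" for \<xi>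
    using that r w by (auto simp: sdom_def cmod_def)
  define g where "g \<xi> = f (r * Re \<xi>, r * Im \<xi>, w) - h (r * Re \<xi>, r * Im \<xi>, w)" for \<xi>
  have "g \<zeta> = 0"
  proof (rule fourier_coeff_eq_0_imp[OF w _ _ \<zeta>(1)])
    show "continuous_on (sphere 0 1) g"
      unfolding g_def
      by (intro continuous_on_diff slice_monogenic_continuous[OF f, THEN continuous_on_compose2]
          slice_monogenic_continuous[OF h, THEN continuous_on_compose2] continuous_intros) (use dom in auto)
    fix j
    have "fourier_coeff w j (\<lambda>\<theta>. g (cis \<theta>)) = fourier_coeff w j (\<lambda>\<theta>. circle_trace f r w \<theta> - circle_trace h r w \<theta>)"
      by (simp add: g_def circle_trace_def)
    also have "\<dots> = fourier_coeff w j (circle_trace f r w) - fourier_coeff w j (circle_trace h r w)"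
      by (intro fourier_coeff_diff continuous_on_circle_trace(2) slice_monogenic_continuous f h r w)
    finally show "fourier_coeff w j (\<lambda>\<theta>. g (cis \<theta>)) = 0"
      using fourier_coeff_eq_laurent_coeff[OF f w r] fourier_coeff_eq_laurent_coeff[OF h w r] coeff_eq by simp
  qed
  then show ?thesis by (simp add: g_def \<zeta>)
qed

section \<open>Decay of the spherical components of the Laurent coefficients\<close>

lemma sphere_inner_sph_monogenic_decay:
  fixes F :: "real ^ 'n::{finite,linorder} \<Rightarrow> 'n clif"
  assumes F: "\<And>l. C1_sphere ((spherical_dirac ^^ l) F)" and Q: "monogenic_hom k Q"
    and B: "\<And>w. norm w = 1 \<Longrightarrow> norm ((spherical_dirac ^^ m) F w) \<le> B"
  shows "\<bar>dirac_eigenvalue CARD('n) k\<bar> ^ m * \<bar>sphere_inner F (sph_monogenic k Q)\<bar> \<le> B * sup_norm_S Q"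
proof -
  have "\<bar>sphere_inner ((spherical_dirac ^^ m) F) (sph_monogenic k Q)\<bar> \<le> B * sup_norm_S Q"
  proof (rule abs_sphere_inner_le[OF C1_sphere_continuous[OF F] continuous_on_sph_monogenic[OF Q] B])
    show "norm (sph_monogenic k Q w) \<le> sup_norm_S Q" if "norm w = 1" for w
      using norm_le_sup_norm_S[OF hom_poly_continuous_on[OF monogenic_hom_imp_hom_poly[OF Q]] that]
      by (simp add: norm_sph_monogenic[OF that])
  qed
  then show ?thesis
    by (simp add: sphere_inner_spherical_dirac_funpow[OF F Q] abs_mult power_abs)
qed

definition slice_spherical_dirac :: "'n::{finite,linorder} slice_function \<Rightarrow> 'n slice_function" where
  "slice_spherical_dirac F = (\<lambda>(x0, p, y). spherical_dirac (\<lambda>y. F (x0, p, y)) y)"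

definition slice_vec_mult :: "'n::{finite,linorder} slice_function \<Rightarrow> 'n slice_function" where
  "slice_vec_mult F = (\<lambda>(x0, p, y). vec_mult (\<lambda>y. F (x0, p, y)) y)"

lemma slice_axis_in_Basis: "(0, 0, axis i 1) \<in> (Basis :: (real \<times> real \<times> (real ^ 'n)) set)"
  by (auto simp: Basis_prod_def Basis_vec_def zero_prod_def)

lemma has_derivative_slice:
  assumes F: "smooth_on W F" "open W" "(x0, p, y) \<in> W"
  shows "((\<lambda>y. F (x0, p, y)) has_derivative (\<lambda>v. frechet_derivative F (at (x0, p, y)) (0, 0, v))) (at y)"
proof -
  have "((\<lambda>y. (x0, p, y)) has_derivative (\<lambda>v. (0, 0, v))) (at y)"
    by (auto intro!: derivative_eq_intros)
  from has_derivative_compose[OF this smooth_on_has_derivative[OF F]] show ?thesis .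
qed

lemma partial_deriv_slice:
  assumes "smooth_on W F" "open W" "(x0, p, y) \<in> W"
  shows "partial_deriv (\<lambda>y. F (x0, p, y)) i y = frechet_derivative F (at (x0, p, y)) (0, 0, axis i 1)"
  by (rule partial_deriv_eq[OF has_derivative_slice[OF assms]])

lemma bounded_linear_slice_coord: "bounded_linear (\<lambda>z :: real \<times> real \<times> (real ^ 'n). snd (snd z) $ i)"
  by (intro bounded_linear_compose[OF bounded_linear_vec_nth] bounded_linear_compose[OF bounded_linear_snd]
      bounded_linear_snd)

lemma smooth_on_slice_vec_mult:
  assumes W: "open W" and F: "smooth_on W F"
  shows "smooth_on W (slice_vec_mult F)"
proof (rule smooth_on_cong[OF W])
  show "smooth_on W (\<lambda>z. \<Sum>i\<in>UNIV. snd (snd z) $ i *\<^sub>R (cl_e i \<star> F z))"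
    by (intro smooth_on_sum W smooth_on_linear_scaleR bounded_linear_slice_coord
        smooth_on_linear[OF W cl_mult.bounded_linear_right] F)
qed (auto simp: slice_vec_mult_def vec_mult_def cl_vec_mult)

lemma smooth_on_slice_spherical_dirac:
  assumes W: "open W" and F: "smooth_on W F"
  shows "smooth_on W (slice_spherical_dirac F)"
proof (rule smooth_on_cong[OF W])
  let ?G = "\<lambda>i z. frechet_derivative F (at z) (0, 0, axis i 1)"
  let ?D = "\<lambda>z. \<Sum>i\<in>UNIV. cl_e i \<star> ?G i z"
  have G: "smooth_on W (?G i)" for i by (rule smooth_on_derivative[OF F slice_axis_in_Basis])
  have D: "smooth_on W ?D" by (intro smooth_on_sum W smooth_on_linear[OF W cl_mult.bounded_linear_right] G)
  show "smooth_on W (\<lambda>z. - (\<Sum>i\<in>UNIV. snd (snd z) $ i *\<^sub>R (cl_e i \<star> ?D z)) + - (\<Sum>i\<in>UNIV. snd (snd z) $ i *\<^sub>R ?G i z))"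
    by (intro smooth_on_add W smooth_on_linear[OF W bounded_linear_minus[OF bounded_linear_ident]] smooth_on_sum
        smooth_on_linear_scaleR bounded_linear_slice_coord smooth_on_linear[OF W cl_mult.bounded_linear_right] G D)
  fix z assume z: "z \<in> W"
  obtain x0 p y where z_eq: "z = (x0, p, y)" by (cases z)
  have "partial_deriv (\<lambda>y. F (x0, p, y)) i y = ?G i z" for i
    using partial_deriv_slice[OF F W] z by (simp add: z_eq)
  then show "- (\<Sum>i\<in>UNIV. snd (snd z) $ i *\<^sub>R (cl_e i \<star> ?D z)) + - (\<Sum>i\<in>UNIV. snd (snd z) $ i *\<^sub>R ?G i z)
      = slice_spherical_dirac F z"
    by (simp add: slice_spherical_dirac_def spherical_dirac_def z_eq cl_vec_mult dirac_def euler_def)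
qed

lemma slice_spherical_dirac_funpow:
  "(slice_spherical_dirac ^^ m) F (x0, p, y) = (spherical_dirac ^^ m) (\<lambda>y. F (x0, p, y)) y"
  by (induction m arbitrary: y) (simp_all add: slice_spherical_dirac_def)

lemma smooth_on_slice_spherical_dirac_funpow:
  "open W \<Longrightarrow> smooth_on W F \<Longrightarrow> smooth_on W ((slice_spherical_dirac ^^ m) F)"
  by (induction m) (auto intro: smooth_on_slice_spherical_dirac)

lemma C1_sphere_slice:
  fixes F :: "'n::{finite,linorder} slice_function"
  assumes F: "smooth_on W F" "open W" and W: "\<And>w. norm w = 1 \<Longrightarrow> (x0, p, w) \<in> W"
  shows "C1_sphere (\<lambda>y. F (x0, p, y))"
  unfolding C1_sphere_def
proof (intro conjI allI impI)
  show "(\<lambda>y. F (x0, p, y)) differentiable at w" if "norm w = 1" for w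
    using has_derivative_slice[OF F W[OF that]] unfolding differentiable_def by blast
  fix i
  have "continuous_on (sphere 0 1) (\<lambda>w. frechet_derivative F (at (x0, p, w)) (0, 0, axis i 1))"
    by (rule continuous_on_compose2[OF smooth_on_continuous[OF smooth_on_derivative[OF F(1) slice_axis_in_Basis]]])
      (use W in \<open>auto intro!: continuous_intros\<close>)
  then show "continuous_on (sphere 0 1) (partial_deriv (\<lambda>y. F (x0, p, y)) i)"
    by (rule continuous_on_eq) (simp add: partial_deriv_slice[OF F W])
qed

lemma compact_sdom:
  assumes "compact K"
  shows "compact (sdom K :: (real \<times> real \<times> (real, 'n::finite) vec) set)"
proof -
  have "sdom K = (\<lambda>x. (fst (fst x), snd (fst x), snd x)) ` (K \<times> (sphere 0 1 :: (real, 'n) vec set))"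
    by (force simp: sdom_def image_iff)
  also have "compact \<dots>"
    by (intro compact_continuous_image compact_Times assms compact_sphere continuous_intros)
  finally show ?thesis .
qed

lemma smooth_slice_decay:
  fixes F :: "'n::{finite,linorder} slice_function"
  assumes F: "smooth_on W F" "open W" and K: "compact K" "sdom K \<subseteq> W"
  obtains B where "0 \<le> B" "\<And>x0 p k Q. (x0, p) \<in> K \<Longrightarrow> monogenic_hom k Q \<Longrightarrow>
    \<bar>dirac_eigenvalue CARD('n) k\<bar> ^ m * \<bar>sphere_inner (\<lambda>w. F (x0, p, w)) (sph_monogenic k Q)\<bar> \<le> B * sup_norm_S Q"
proof -
  note smooth = smooth_on_slice_spherical_dirac_funpow[OF F(2,1)]
  obtain B where B: "0 \<le> B" "\<And>z. z \<in> sdom K \<Longrightarrow> norm ((slice_spherical_dirac ^^ m) F z) \<le> B"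
    using continuous_on_compact_bound[OF compact_sdom[OF K(1)]
        continuous_on_subset[OF smooth_on_continuous[OF smooth] K(2)]] by blast
  have "\<bar>dirac_eigenvalue CARD('n) k\<bar> ^ m * \<bar>sphere_inner (\<lambda>w. F (x0, p, w)) (sph_monogenic k Q)\<bar> \<le> B * sup_norm_S Q"
    if z: "(x0, p) \<in> K" and Q: "monogenic_hom k Q" for x0 p k Q
  proof (rule sphere_inner_sph_monogenic_decay[OF _ Q])
    have dom: "(x0, p, w) \<in> sdom K" if "norm w = 1" for w using z that by (simp add: sdom_def)
    then show "C1_sphere ((spherical_dirac ^^ l) (\<lambda>w. F (x0, p, w)))" for l
      unfolding slice_spherical_dirac_funpow[symmetric] using K(2) by (intro C1_sphere_slice[OF smooth F(2)]) blast
    show "norm ((spherical_dirac ^^ m) (\<lambda>w. F (x0, p, w)) w) \<le> B" if "norm w = 1" for w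
      unfolding slice_spherical_dirac_funpow[symmetric] by (rule B(2)[OF dom[OF that]])
  qed
  with B(1) show ?thesis by (rule that)
qed

lemma abs_sphere_inner_slice_act_le:
  fixes F :: "real ^ 'n::{finite,linorder} \<Rightarrow> 'n clif"
  assumes F: "continuous_on (sphere 0 1) F" and q: "continuous_on (sphere 0 1) q" and c: "norm c \<le> 1"
  shows "\<bar>sphere_inner (\<lambda>w. slice_act w c (F w)) q\<bar> \<le> \<bar>sphere_inner F q\<bar> + \<bar>sphere_inner (vec_mult F) q\<bar>"
proof -
  have "continuous_on (sphere 0 1) (vec_mult F)"
    unfolding vec_mult_def[abs_def] by (intro continuous_intros F)
  then have "sphere_inner (\<lambda>w. slice_act w c (F w)) q = Re c * sphere_inner F q + Im c * sphere_inner (vec_mult F) q"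
    unfolding slice_act_def vec_mult_def[symmetric]
    by (subst sphere_inner_add_left) (auto simp: sphere_inner_scaleR_left intro!: continuous_intros F q)
  also have "\<bar>\<dots>\<bar> \<le> 1 * \<bar>sphere_inner F q\<bar> + 1 * \<bar>sphere_inner (vec_mult F) q\<bar>"
    unfolding abs_mult[symmetric]
    using order_trans[OF abs_Re_le_cmod c] order_trans[OF abs_Im_le_cmod c]
    by (intro order_trans[OF abs_triangle_ineq] add_mono) (simp_all only: abs_mult mult_right_mono abs_ge_zero)
  finally show ?thesis by simp
qed

lemma slice_monogenic_decay:
  fixes f :: "'n::{finite,linorder} slice_function"
  assumes f: "slice_monogenic U f" and K: "compact K" "K \<subseteq> U"
  obtains B where "0 \<le> B" "\<And>x0 p c k Q. (x0, p) \<in> K \<Longrightarrow> norm c \<le> 1 \<Longrightarrow> monogenic_hom k Q \<Longrightarrow>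
    \<bar>dirac_eigenvalue CARD('n) k\<bar> ^ m * \<bar>sphere_inner (\<lambda>w. slice_act w c (f (x0, p, w))) (sph_monogenic k Q)\<bar>
      \<le> B * sup_norm_S Q"
proof -
  obtain W F where W: "open W" "sdom U \<subseteq> W" "smooth_on W F" and F: "\<And>z. z \<in> sdom U \<Longrightarrow> F z = f z"
    by (rule slice_monogenic_smooth_extension[OF f]) (rule that)
  have K_W: "sdom K \<subseteq> W" using K(2) W(2) by (auto simp: sdom_def)
  let ?e = "\<lambda>k. \<bar>dirac_eigenvalue CARD('n) k\<bar> ^ m"
  obtain B1 where B1: "0 \<le> B1" "\<And>x0 p k Q. (x0, p) \<in> K \<Longrightarrow> monogenic_hom k Q \<Longrightarrow>
      ?e k * \<bar>sphere_inner (\<lambda>w. F (x0, p, w)) (sph_monogenic k Q)\<bar> \<le> B1 * sup_norm_S Q"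
    using smooth_slice_decay[OF W(3,1) K(1) K_W, of m] by blast
  obtain B2 where B2: "0 \<le> B2" "\<And>x0 p k Q. (x0, p) \<in> K \<Longrightarrow> monogenic_hom k Q \<Longrightarrow>
      ?e k * \<bar>sphere_inner (\<lambda>w. slice_vec_mult F (x0, p, w)) (sph_monogenic k Q)\<bar> \<le> B2 * sup_norm_S Q"
    using smooth_slice_decay[OF smooth_on_slice_vec_mult[OF W(1,3)] W(1) K(1) K_W, of m] by blast
  have "?e k * \<bar>sphere_inner (\<lambda>w. slice_act w c (f (x0, p, w))) (sph_monogenic k Q)\<bar> \<le> (B1 + B2) * sup_norm_S Q"
    if z: "(x0, p) \<in> K" and c: "norm c \<le> 1" and Q: "monogenic_hom k Q" for x0 p c k Q
  proof -
    have dom: "(x0, p, w) \<in> sdom U" if "norm w = 1" for w using z K(2) that by (auto simp: sdom_def)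
    have "sphere_inner (\<lambda>w. slice_act w c (f (x0, p, w))) (sph_monogenic k Q)
        = sphere_inner (\<lambda>w. slice_act w c (F (x0, p, w))) (sph_monogenic k Q)"
      by (intro sphere_inner_cong refl) (simp add: F dom)
    also have "\<bar>\<dots>\<bar> \<le> \<bar>sphere_inner (\<lambda>w. F (x0, p, w)) (sph_monogenic k Q)\<bar>
        + \<bar>sphere_inner (\<lambda>w. slice_vec_mult F (x0, p, w)) (sph_monogenic k Q)\<bar>"
      unfolding slice_vec_mult_def prod.case
      using dom W(2) by (intro abs_sphere_inner_slice_act_le C1_sphere_continuous C1_sphere_slice[OF W(3,1)]
          continuous_on_sph_monogenic Q c) blast
    finally have "?e k * \<bar>sphere_inner (\<lambda>w. slice_act w c (f (x0, p, w))) (sph_monogenic k Q)\<bar>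
        \<le> ?e k * (\<bar>sphere_inner (\<lambda>w. F (x0, p, w)) (sph_monogenic k Q)\<bar>
          + \<bar>sphere_inner (\<lambda>w. slice_vec_mult F (x0, p, w)) (sph_monogenic k Q)\<bar>)"
      by (rule mult_left_mono) simp
    then show ?thesis using B1(2)[OF z Q] B2(2)[OF z Q] by (simp add: distrib_left distrib_right)
  qed
  then show ?thesis using B1(1) B2(1) by (intro that[of "B1 + B2"]) auto
qed

lemma abs_sphere_inner_fourier_coeff_le:
  fixes T :: "real \<Rightarrow> real ^ 'n::{finite,linorder} \<Rightarrow> 'n clif"
  assumes T: "continuous_on ({0..2 * pi} \<times> sphere 0 1) (\<lambda>(\<theta>, w). T \<theta> w)" and q: "continuous_on UNIV q"
    and B: "\<And>c \<theta>. norm c \<le> 1 \<Longrightarrow> \<theta> \<in> {0..2 * pi} \<Longrightarrow> \<bar>sphere_inner (\<lambda>w. slice_act w c (T \<theta> w)) q\<bar> \<le> B"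
  shows "\<bar>sphere_inner (\<lambda>w. fourier_coeff w j (\<lambda>\<theta>. T \<theta> w)) q\<bar> \<le> B"
proof -
  define T' where "T' \<theta> w = slice_act w (cis (- (real_of_int j * \<theta>))) (T \<theta> w)" for \<theta> w
  define I where "I = sphere_integral (\<lambda>w. integral {0..2 * pi} (\<lambda>\<theta>. inner (T' \<theta> w) (q w)))"
  have "continuous_on ({0..2 * pi} \<times> sphere 0 1) (\<lambda>(\<theta>, w). inner (T' \<theta> w) (q w))"
    unfolding T'_def split_def using T
    by (intro continuous_intros continuous_on_compose2[OF q]) (auto simp: split_def)
  from sphere_integral_integral_swap[OF this]
  have "((\<lambda>\<theta>. sphere_inner (T' \<theta>) q) has_integral I) {0..2 * pi}"
    by (simp add: I_def sphere_inner_def)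
  moreover have "\<bar>sphere_inner (T' \<theta>) q\<bar> \<le> B" if "\<theta> \<in> {0..2 * pi}" for \<theta>
    unfolding T'_def[abs_def] by (rule B) (use that in auto)
  ultimately have "norm I \<le> B * measure lborel (cbox 0 (2 * pi))"
    using order_trans[OF abs_ge_zero B[of 1 0]]
    by (intro has_integral_bound[where f="\<lambda>\<theta>. sphere_inner (T' \<theta>) q"]) auto
  moreover have "sphere_inner (\<lambda>w. fourier_coeff w j (\<lambda>\<theta>. T \<theta> w)) q = (1 / (2 * pi)) * I"
    unfolding I_def sphere_inner_def sphere_integral_cmult[symmetric]
  proof (rule sphere_integral_cong)
    fix w :: "(real, 'n) vec" assume "norm w = 1"
    then have "continuous_on {0..2 * pi} (\<lambda>\<theta>. T \<theta> w)"
      by (intro continuous_on_compose2[OF T, of _ "\<lambda>\<theta>. (\<theta>, w)", simplified]) (auto intro!: continuous_intros)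
    then have "(\<lambda>\<theta>. T' \<theta> w) integrable_on {0..2 * pi}"
      unfolding T'_def by (rule fourier_integrable)
    from integral_linear[OF this bounded_linear_inner_left, of "q w"]
    show "inner (fourier_coeff w j (\<lambda>\<theta>. T \<theta> w)) (q w)
        = (1 / (2 * pi)) * integral {0..2 * pi} (\<lambda>\<theta>. inner (T' \<theta> w) (q w))"
      by (simp add: fourier_coeff_def T'_def o_def)
  qed
  ultimately show ?thesis by (simp add: abs_mult pos_divide_le_eq)
qed

lemma laurent_coeff_decay_circle:
  fixes f :: "'n::{finite,linorder} slice_function"
  assumes f: "slice_monogenic punct f" and r: "0 < r"
  obtains B where "0 \<le> B" "\<And>j k Q. monogenic_hom k Q \<Longrightarrow>
    \<bar>dirac_eigenvalue CARD('n) k\<bar> ^ m * (r powi j * \<bar>sphere_inner (laurent_coeff f j) (sph_monogenic k Q)\<bar>)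
      \<le> B * sup_norm_S Q"
proof -
  let ?e = "\<lambda>k. \<bar>dirac_eigenvalue CARD('n) k\<bar> ^ m"
  have "sphere 0 r \<subseteq> (punct :: (real \<times> real) set)" using r by (auto simp: zero_prod_def[symmetric])
  then obtain B where B: "0 \<le> B" "\<And>x0 p c k Q. (x0, p) \<in> sphere 0 r \<Longrightarrow> norm c \<le> 1 \<Longrightarrow> monogenic_hom k Q \<Longrightarrow>
      ?e k * \<bar>sphere_inner (\<lambda>w. slice_act w c (f (x0, p, w))) (sph_monogenic k Q)\<bar> \<le> B * sup_norm_S Q"
    using slice_monogenic_decay[OF f compact_sphere, of 0 r m] by blast
  have "?e k * (r powi j * \<bar>sphere_inner (laurent_coeff f j) (sph_monogenic k Q)\<bar>) \<le> B * sup_norm_S Q"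
    if Q: "monogenic_hom k Q" for j k Q
  proof -
    have "sphere_inner (\<lambda>w. fourier_coeff w j (circle_trace f r w)) (sph_monogenic k Q)
        = sphere_inner (\<lambda>w. r powi j *\<^sub>R laurent_coeff f j w) (sph_monogenic k Q)"
      by (intro sphere_inner_cong fourier_coeff_eq_laurent_coeff[OF f _ r] refl)
    then have "sphere_inner (\<lambda>w. fourier_coeff w j (circle_trace f r w)) (sph_monogenic k Q)
        = r powi j * sphere_inner (laurent_coeff f j) (sph_monogenic k Q)"
      by (simp add: sphere_inner_scaleR_left)
    moreover have "\<bar>sphere_inner (\<lambda>w. fourier_coeff w j (circle_trace f r w)) (\<lambda>w. ?e k *\<^sub>R sph_monogenic k Q w)\<bar>
        \<le> B * sup_norm_S Q"
      using B(2)[OF circle_in_sphere _ Q] r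
      by (intro abs_sphere_inner_fourier_coeff_le continuous_on_circle_trace slice_monogenic_continuous f r
          continuous_intros continuous_on_sph_monogenic[OF Q])
        (simp add: sphere_inner_scaleR_right abs_mult circle_trace_def)
    ultimately show ?thesis using r by (simp add: sphere_inner_scaleR_right abs_mult)
  qed
  with B(1) show ?thesis by (rule that)
qed

text \<open>Of the circles of radii $a$ and $1/a$ the first one handles $j<0$ and the second one $j\ge0$.\<close>

lemma laurent_coeff_eigenvalue_decay:
  fixes f :: "'n::{finite,linorder} slice_function"
  assumes f: "slice_monogenic punct f" and a: "0 < a"
  obtains B where "0 \<le> B" "\<And>j k Q. monogenic_hom k Q \<Longrightarrow>
    \<bar>dirac_eigenvalue CARD('n) k\<bar> ^ m * \<bar>sphere_inner (laurent_coeff f j) (sph_monogenic k Q)\<bar>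
      \<le> B * a ^ nat \<bar>j\<bar> * sup_norm_S Q"
proof -
  let ?X = "\<lambda>j k Q. \<bar>dirac_eigenvalue CARD('n) k\<bar> ^ m * \<bar>sphere_inner (laurent_coeff f j) (sph_monogenic k Q)\<bar>"
  obtain B1 where B1: "0 \<le> B1" "\<And>j k Q. monogenic_hom k Q \<Longrightarrow> (1 / a) powi j * ?X j k Q \<le> B1 * sup_norm_S Q"
    using laurent_coeff_decay_circle[OF f, of "1 / a" m] a by (auto simp: mult.left_commute)
  obtain B2 where B2: "0 \<le> B2" "\<And>j k Q. monogenic_hom k Q \<Longrightarrow> a powi j * ?X j k Q \<le> B2 * sup_norm_S Q"
    using laurent_coeff_decay_circle[OF f a, of m] by (auto simp: mult.left_commute)
  have "?X j k Q \<le> (B1 + B2) * a ^ nat \<bar>j\<bar> * sup_norm_S Q" if Q: "monogenic_hom k Q" for j k Q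
  proof -
    have "0 \<le> sup_norm_S Q"
      by (intro sup_norm_S_nonneg hom_poly_continuous_on[OF monogenic_hom_imp_hom_poly[OF Q]])
    then have "0 \<le> B1 * sup_norm_S Q" "0 \<le> B2 * sup_norm_S Q" using B1(1) B2(1) by auto
    moreover have "(1 / a) powi j = 1 / a ^ nat \<bar>j\<bar>" if "0 \<le> j" using that by (simp add: power_int_def power_one_over)
    moreover have "a powi j = 1 / a ^ nat \<bar>j\<bar>" if "\<not> 0 \<le> j"
      using that by (simp add: power_int_def power_one_over inverse_eq_divide)
    ultimately have "(1 / a ^ nat \<bar>j\<bar>) * ?X j k Q \<le> (B1 + B2) * sup_norm_S Q"
      using B1(2)[OF Q, of j] B2(2)[OF Q, of j] by (cases "0 \<le> j") (simp_all add: distrib_right)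
    then show ?thesis using a by (simp add: pos_divide_le_eq mult_ac)
  qed
  then show ?thesis using B1(1) B2(1) by (intro that[of "B1 + B2"]) auto
qed

lemma laurent_coeff_decay:
  fixes f :: "'n::{finite,linorder} slice_function"
  assumes f: "slice_monogenic punct f" and a: "0 < a"
  obtains B where "0 \<le> B" "\<And>j k Q. monogenic_hom k Q \<Longrightarrow>
    (real k + 1) ^ m * \<bar>sphere_inner (laurent_coeff f j) (sph_monogenic k Q)\<bar> \<le> B * a ^ nat \<bar>j\<bar> * sup_norm_S Q"
proof -
  let ?e = "dirac_eigenvalue CARD('n)"
  let ?X = "\<lambda>j k Q. \<bar>sphere_inner (laurent_coeff f j) (sph_monogenic k Q)\<bar>"
  obtain B0 where B0: "0 \<le> B0" "\<And>j k Q. monogenic_hom k Q \<Longrightarrow> \<bar>?e k\<bar> ^ 0 * ?X j k Q \<le> B0 * a ^ nat \<bar>j\<bar> * sup_norm_S Q"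
    using laurent_coeff_eigenvalue_decay[OF f a, of 0] by blast
  obtain B where B: "0 \<le> B" "\<And>j k Q. monogenic_hom k Q \<Longrightarrow> \<bar>?e k\<bar> ^ m * ?X j k Q \<le> B * a ^ nat \<bar>j\<bar> * sup_norm_S Q"
    using laurent_coeff_eigenvalue_decay[OF f a, of m] by blast
  have "(real k + 1) ^ m * ?X j k Q \<le> (B0 + 2 ^ m * B) * a ^ nat \<bar>j\<bar> * sup_norm_S Q" if Q: "monogenic_hom k Q"
      for j k Q
  proof -
    have "(real k + 1) ^ m \<le> 1 + (2 * \<bar>?e k\<bar>) ^ m"
    proof (cases "k = 0")
      case False
      then have "real k + 1 \<le> 2 * \<bar>?e k\<bar>" using abs_dirac_eigenvalue_ge[of "CARD('n)" k] by simp
      then have "(real k + 1) ^ m \<le> (2 * \<bar>?e k\<bar>) ^ m" by (intro power_mono) auto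
      then show ?thesis by simp
    qed simp
    then have "(real k + 1) ^ m * ?X j k Q \<le> (1 + (2 * \<bar>?e k\<bar>) ^ m) * ?X j k Q" by (intro mult_right_mono) auto
    also have "\<dots> = ?X j k Q + 2 ^ m * (\<bar>?e k\<bar> ^ m * ?X j k Q)" by (simp add: power_mult_distrib algebra_simps)
    also have "\<dots> \<le> B0 * a ^ nat \<bar>j\<bar> * sup_norm_S Q + 2 ^ m * (B * a ^ nat \<bar>j\<bar> * sup_norm_S Q)"
      using B0(2)[OF Q, of j] B(2)[OF Q, of j] by (intro add_mono mult_left_mono) auto
    finally show ?thesis by (simp add: algebra_simps)
  qed
  then show ?thesis using B0(1) B(1) by (intro that[of "B0 + 2 ^ m * B"]) auto
qed

section \<open>Coefficients of an expansion\<close>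

lemma continuous_on_suminf:
  fixes g :: "nat \<Rightarrow> 'a::topological_space \<Rightarrow> 'b::banach"
  assumes g: "\<And>n. continuous_on K (g n)" and M: "\<And>n x. x \<in> K \<Longrightarrow> norm (g n x) \<le> M n" "summable M"
  shows "continuous_on K (\<lambda>x. \<Sum>n. g n x)"
  using g by (intro uniform_limit_theorem[OF _ Weierstrass_m_test[OF M]] always_eventually allI continuous_on_sum)
      auto

lemma bounded_functional_suminf:
  fixes g :: "nat \<Rightarrow> 'a::topological_space \<Rightarrow> 'b::banach" and L :: "('a \<Rightarrow> 'b) \<Rightarrow> 'c::real_normed_vector"
  assumes g: "\<And>n. continuous_on K (g n)" and M: "\<And>n x. x \<in> K \<Longrightarrow> norm (g n x) \<le> M n" "summable M"
    and diff: "\<And>f h. continuous_on K f \<Longrightarrow> continuous_on K h \<Longrightarrow> L (\<lambda>x. f x - h x) = L f - L h"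
    and sum: "\<And>n. L (\<lambda>x. \<Sum>i<n. g i x) = (\<Sum>i<n. L (g i))"
    and bound: "\<And>f B. continuous_on K f \<Longrightarrow> (\<And>x. x \<in> K \<Longrightarrow> norm (f x) \<le> B) \<Longrightarrow> norm (L f) \<le> C * B"
  shows "(\<lambda>n. L (g n)) sums L (\<lambda>x. \<Sum>n. g n x)"
proof -
  let ?S = "\<lambda>x. \<Sum>n. g n x"
  have S_cont: "continuous_on K ?S" by (rule continuous_on_suminf[OF g M])
  have partial: "continuous_on K (\<lambda>x. \<Sum>i<n. g i x)" for n by (intro continuous_on_sum g)
  have tail: "norm ((\<Sum>i<n. g i x) - ?S x) \<le> suminf M - (\<Sum>i<n. M i)" if "x \<in> K" for x n
    using norm_suminf_tail_le[OF M(2) M(1)[OF that]] by (simp add: suminf_minus_initial_segment[OF M(2)])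
  have partial_error: "norm ((\<Sum>i<n. L (g i)) - L ?S) \<le> C * (suminf M - (\<Sum>i<n. M i))" for n
    unfolding sum[symmetric] diff[OF partial S_cont, symmetric]
    by (intro bound continuous_on_diff partial S_cont tail)
  have "(\<lambda>n. C * (suminf M - (\<Sum>i<n. M i))) \<longlonglongrightarrow> C * (suminf M - suminf M)"
    by (intro tendsto_mult_left tendsto_diff tendsto_const summable_LIMSEQ M(2))
  then have "(\<lambda>n. C * (suminf M - (\<Sum>i<n. M i))) \<longlonglongrightarrow> 0" by simp
  then have "(\<lambda>n. (\<Sum>i<n. L (g i)) - L ?S) \<longlonglongrightarrow> 0"
    by (rule Lim_null_comparison[OF always_eventually[OF allI[OF partial_error]]])
  then show ?thesis unfolding sums_def by (simp add: LIM_zero_iff)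
qed

lemma fourier_coeff_sums:
  assumes w: "norm w = 1" and g: "\<And>n. continuous_on {0..2 * pi} (g n)"
    and M: "\<And>n \<theta>. \<theta> \<in> {0..2 * pi} \<Longrightarrow> norm (g n \<theta>) \<le> M n" "summable M"
  shows "(\<lambda>n. fourier_coeff w j (g n)) sums fourier_coeff w j (\<lambda>\<theta>. \<Sum>n. g n \<theta>)"
proof (rule bounded_functional_suminf[OF g M, where C=1])
  show "norm (fourier_coeff w j T) \<le> 1 * B"
    if "continuous_on {0..2 * pi} T" "\<And>\<theta>. \<theta> \<in> {0..2 * pi} \<Longrightarrow> norm (T \<theta>) \<le> B" for T B
    using norm_fourier_coeff_le[OF that w] by simp
qed (simp_all add: fourier_coeff_diff fourier_coeff_sum g)

lemma sphere_inner_sums: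
  fixes g :: "nat \<Rightarrow> 'a::euclidean_space \<Rightarrow> 'b::euclidean_space"
  assumes g: "\<And>n. continuous_on (sphere 0 1) (g n)" and M: "\<And>n w. norm w = 1 \<Longrightarrow> norm (g n w) \<le> M n" "summable M"
    and q: "continuous_on (sphere 0 1) q"
  shows "(\<lambda>n. sphere_inner (g n) q) sums sphere_inner (\<lambda>w. \<Sum>n. g n w) q"
proof -
  obtain C where C: "\<And>w. w \<in> sphere 0 1 \<Longrightarrow> norm (q w) \<le> C"
    using continuous_on_compact_bound[OF compact_sphere q] by blast
  show ?thesis
  proof (rule bounded_functional_suminf[OF g _ M(2), where C=C])
    show "norm (sphere_inner f q) \<le> C * B"
      if "continuous_on (sphere 0 1) f" "\<And>w. w \<in> sphere 0 1 \<Longrightarrow> norm (f w) \<le> B" for f B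
      using abs_sphere_inner_le[OF that(1) q, of B C] that(2) C by (simp add: mult.commute)
  qed (simp_all add: M(1) sphere_inner_diff_left sphere_inner_sum_left q g)
qed

definition powi_family :: "int \<Rightarrow> nat \<Rightarrow> complex \<Rightarrow> complex" where
  "powi_family j k z = z powi j * \<i> ^ k"

definition power_family :: "int \<Rightarrow> nat \<Rightarrow> complex \<Rightarrow> complex" where
  "power_family j k z = (if j < 0 then 0 else z ^ nat j * \<i> ^ k)"

lemma norm_power_int_le:
  fixes z :: complex
  assumes "norm z \<le> B" "inverse (norm z) \<le> B"
  shows "norm (z powi j) \<le> B ^ nat \<bar>j\<bar>"
  using assms
  by (auto simp: power_int_def norm_power norm_inverse power_inverse[symmetric] simp del: power_inverse
      intro!: power_mono)

lemma holomorphic_family_powi: "holomorphic_family (- {0}) powi_family"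
  unfolding holomorphic_family_def
proof (intro conjI allI ballI)
  show "powi_family j k holomorphic_on - {0}" for j k
    unfolding powi_family_def[abs_def] by (intro holomorphic_intros) auto
  fix z :: complex assume "z \<in> - {0}"
  then have z: "0 < norm z" by simp
  define B where "B = 2 * norm z + 2 / norm z"
  have "norm (powi_family j k x) \<le> 1 * B ^ nat \<bar>j\<bar>" if x: "x \<in> ball z (norm z / 2)" for j k x
  proof -
    have "norm (z - x) < norm z / 2" using x by (simp add: dist_norm)
    then have norm_x: "norm x \<le> 2 * norm z" "norm z / 2 \<le> norm x"
      using norm_triangle_ineq2[of x z] norm_triangle_ineq2[of z x] norm_minus_commute[of x z] by linarith+
    then have "inverse (norm x) \<le> inverse (norm z / 2)" using z by (intro le_imp_inverse_le) auto
    then have "norm x \<le> B" "inverse (norm x) \<le> B"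
      using norm_x(1) z unfolding B_def by (auto simp: inverse_eq_divide add_increasing add_increasing2)
    then show ?thesis by (simp add: powi_family_def norm_mult norm_power norm_power_int_le)
  qed
  then show "\<exists>e>0. \<exists>C\<ge>0. \<exists>B\<ge>0. \<forall>j k. \<forall>x\<in>ball z e. norm (powi_family j k x) \<le> C * B ^ nat \<bar>j\<bar>"
    using z by (intro exI[of _ "norm z / 2"] conjI exI[of _ 1] exI[of _ B]) (auto simp: B_def)
qed

lemma holomorphic_family_power: "holomorphic_family UNIV power_family"
  unfolding holomorphic_family_def
proof (intro conjI allI ballI)
  show "power_family j k holomorphic_on UNIV" for j k
    unfolding power_family_def[abs_def] by (cases "j < 0") (auto intro!: holomorphic_intros)
  fix z :: complex
  have "norm (power_family j k x) \<le> 1 * (norm z + 1) ^ nat \<bar>j\<bar>" if x: "x \<in> ball z 1" for j k x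
  proof (cases "j < 0")
    case False
    have "norm x \<le> norm z + 1"
      using x norm_triangle_ineq2[of x z] norm_minus_commute[of x z] by (simp add: dist_norm)
    then have "norm x ^ nat j \<le> (norm z + 1) ^ nat j" by (intro power_mono) auto
    then show ?thesis using False by (simp add: power_family_def norm_mult norm_power)
  qed (simp add: power_family_def)
  then show "\<exists>e>0. \<exists>C\<ge>0. \<exists>B\<ge>0. \<forall>j k. \<forall>x\<in>ball z e. norm (power_family j k x) \<le> C * B ^ nat \<bar>j\<bar>"
    by (intro exI[of _ 1] conjI exI[of _ "norm z + 1"]) auto
qed

definition angular_sum :: "'n::{finite,linorder} coeff_family \<Rightarrow> int \<Rightarrow> (real, 'n) vec \<Rightarrow> 'n clif" where
  "angular_sum P j w = (\<Sum>k. slice_act w (\<i> ^ k) (P k j w))"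

lemma angular_term_bound:
  assumes P: "rapid_family 0 P"
  obtains C where "\<And>k w. norm w = 1 \<Longrightarrow> norm (slice_act w (\<i> ^ k) (P k j w)) \<le> C / (real k + 1)\<^sup>2"
proof -
  obtain C where C: "0 < C" "\<And>k j. sup_norm_S (P k j) \<le> C * 1 ^ nat \<bar>j\<bar> / (real k + 1)\<^sup>2"
    using rapidly_decayingD[OF rapid_family_decay[OF P] zero_less_one, of 2] by blast
  have "norm (slice_act w (\<i> ^ k) (P k j w)) \<le> C / (real k + 1)\<^sup>2" if "norm w = 1" for k w
    using norm_le_sup_norm_S[OF rapid_family_continuous[OF P] that, of k j] C(2)[of k j]
    by (simp add: norm_slice_act[OF that] norm_power)
  then show ?thesis by (rule that)
qed

lemma continuous_on_angular_term:
  "rapid_family 0 P \<Longrightarrow> continuous_on S (\<lambda>w. slice_act w z (P k j w))"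
  by (intro continuous_intros rapid_family_continuous)

lemma continuous_on_angular_sum:
  assumes P: "rapid_family 0 P"
  shows "continuous_on (sphere 0 1) (angular_sum P j)"
proof -
  obtain C where "\<And>k w. norm w = 1 \<Longrightarrow> norm (slice_act w (\<i> ^ k) (P k j w)) \<le> C / (real k + 1)\<^sup>2"
    using angular_term_bound[OF P] by blast
  then show ?thesis
    unfolding angular_sum_def[abs_def]
    by (intro continuous_on_suminf[OF continuous_on_angular_term[OF P] _ summable_inverse_squares[of C]]) auto
qed

text \<open>Passing from $\underline\omega$ to $-\underline\omega$ conjugates \<open>z\<close> and $\underline\omega^k$,
  and the factor $(-1)^k$ from the homogeneous polynomial undoes the latter.\<close>

lemma slice_act_hom_poly_even:
  assumes "hom_poly k P"
  shows "slice_act (- w) (cnj z * \<i> ^ k) (P (- w)) = slice_act w (z * \<i> ^ k) (P w)"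
proof -
  have "cnj (\<i> ^ k) * (-1) ^ k = (cnj \<i> * (-1)) ^ k" by (simp only: complex_cnj_power power_mult_distrib)
  then have "(-1) ^ k *\<^sub>R cnj (cnj z * \<i> ^ k) = z * \<i> ^ k" by (simp add: scaleR_conv_of_real mult.commute)
  then show ?thesis
    by (simp add: slice_act_uminus_direction hom_poly_uminus_arg[OF assms] slice_act.scaleR_right
        flip: slice_act.scaleR_left)
qed

lemma angular_sum_even:
  assumes P: "rapid_family 0 P"
  shows "angular_sum P j (- w) = angular_sum P j w"
  unfolding angular_sum_def
proof (rule suminf_cong)
  show "slice_act (- w) (\<i> ^ k) (P k j (- w)) = slice_act w (\<i> ^ k) (P k j w)" for k
    using slice_act_hom_poly_even[of k "P k j" w 1] rapid_family_hom_poly[OF P, of k j] by simp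
qed

lemma sphere_inner_angular_sum:
  fixes P :: "'n::{finite,linorder} coeff_family"
  assumes P: "rapid_family 0 P" "\<And>k. monogenic_hom k (P k j)" and Q: "monogenic_hom l Q"
  shows "sphere_inner (angular_sum P j) (sph_monogenic l Q)
    = (-1) ^ (l div 2) * sphere_inner (sph_monogenic l (P l j)) (sph_monogenic l Q)"
proof -
  obtain C where C: "\<And>k w. norm w = 1 \<Longrightarrow> norm (slice_act w (\<i> ^ k) (P k j w)) \<le> C / (real k + 1)\<^sup>2"
    using angular_term_bound[OF P(1)] by blast
  let ?s = "\<lambda>k. (-1) ^ (k div 2) * sphere_inner (sph_monogenic k (P k j)) (sph_monogenic l Q)"
  have "sphere_inner (\<lambda>w. slice_act w (\<i> ^ k) (P k j w)) (sph_monogenic l Q)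
      = sphere_inner (\<lambda>w. (-1) ^ (k div 2) *\<^sub>R sph_monogenic k (P k j) w) (sph_monogenic l Q)" for k
    by (intro sphere_inner_cong slice_act_i_power refl)
  then have "sphere_inner (\<lambda>w. slice_act w (\<i> ^ k) (P k j w)) (sph_monogenic l Q) = (if k = l then ?s k else 0)" for k
    using sph_monogenic_orthogonal[OF P(2) Q] by (simp add: sphere_inner_scaleR_left)
  then have "(\<lambda>k. if k = l then ?s k else 0) sums sphere_inner (angular_sum P j) (sph_monogenic l Q)"
    using sphere_inner_sums[OF continuous_on_angular_term[OF P(1)] C summable_inverse_squares
        continuous_on_sph_monogenic[OF Q]]
    by (simp add: angular_sum_def[abs_def])
  then show ?thesis by (rule sums_unique2) (rule sums_single)
qed

lemma angular_sum_unique: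
  fixes P Q :: "'n::{finite,linorder} coeff_family"
  assumes P: "rapid_family 0 P" "\<And>k. monogenic_hom k (P k j)" and Q: "rapid_family 0 Q" "\<And>k. monogenic_hom k (Q k j)"
    and sums_eq: "\<And>w. norm w = 1 \<Longrightarrow> angular_sum P j w = angular_sum Q j w"
  shows "P k j = Q k j"
proof -
  define R where "R x = P k j x - Q k j x" for x
  have R: "monogenic_hom k R" unfolding R_def[abs_def] by (rule monogenic_hom_diff[OF P(2) Q(2)])
  have "sphere_inner (angular_sum P j) (sph_monogenic k R) = sphere_inner (angular_sum Q j) (sph_monogenic k R)"
    by (intro sphere_inner_cong sums_eq refl)
  then have "sphere_inner (sph_monogenic k (P k j)) (sph_monogenic k R)
      = sphere_inner (sph_monogenic k (Q k j)) (sph_monogenic k R)"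
    by (simp add: sphere_inner_angular_sum P Q R)
  then have "sphere_inner (sph_monogenic k R) (sph_monogenic k R) = 0"
    using sphere_inner_diff_left[OF continuous_on_sph_monogenic[OF R] continuous_on_sph_monogenic[OF P(2)]
        continuous_on_sph_monogenic[OF Q(2)]]
    by (simp add: R_def[abs_def] sph_monogenic_diff)
  then have "R w = 0" if "norm w = 1" for w
    using sphere_inner_self_eq_0_imp[OF continuous_on_sph_monogenic[OF R] _ that]
        norm_sph_monogenic[OF that, of k R] by simp
  then have "R = (\<lambda>x. 0)" by (rule hom_poly_eq_0[OF monogenic_hom_imp_hom_poly[OF R]])
  then show ?thesis by (simp add: R_def fun_eq_iff)
qed

definition expansion_sum :: "'n::{finite,linorder} coeff_family \<Rightarrow> 'n slice_function" where
  "expansion_sum P = (\<lambda>(x0, p, w). slice_series powi_family P (Complex x0 p) w)"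

lemma expansion_sum_slice_monogenic:
  assumes P: "rapid_family 0 P" and f: "\<And>z. z \<in> sdom punct \<Longrightarrow> f z = expansion_sum P z"
  shows "slice_monogenic punct f"
proof -
  have punct: "{(x0, p). Complex x0 p \<in> - {0}} = punct" by (auto simp: complex_eq_iff)
  have "f (x0, p, w) = slice_series powi_family P (Complex x0 p) w" if "Complex x0 p \<in> - {0}" "norm w = 1" for x0 p w
    using f[of "(x0, p, w)"] that by (simp add: sdom_def expansion_sum_def complex_eq_iff)
  from slice_series_slice_monogenic[OF _ holomorphic_family_powi P this] show ?thesis
    unfolding punct by (simp add: open_Compl)
qed

lemma slice_term_powi_cis:
  assumes "norm w = 1"
  shows "slice_term powi_family P (cis \<theta>) w (j, k)
      = slice_act w (cis (real_of_int j * \<theta>)) (slice_act w (\<i> ^ k) (P k j w))"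
  by (simp add: slice_term_def powi_family_def cis_power_int slice_act_mult[OF assms])

lemma has_sum_fibre:
  fixes c :: "'a \<times> 'b \<Rightarrow> 'c::{comm_monoid_add,t2_space}"
  assumes "(c has_sum s) UNIV" "\<And>x y. x \<noteq> a \<Longrightarrow> c (x, y) = 0"
  shows "((\<lambda>y. c (a, y)) has_sum s) UNIV"
proof -
  have "(c has_sum s) (range (Pair a))"
    using assms by (subst has_sum_cong_neutral[where T=UNIV and g=c]) auto
  then show ?thesis by (subst (asm) has_sum_reindex) (auto simp: inj_on_def o_def)
qed

lemma laurent_coeff_expansion_sum:
  fixes P :: "'n::{finite,linorder} coeff_family"
  assumes P: "rapid_family 0 P" and w: "norm w = 1"
  shows "laurent_coeff (expansion_sum P) j w = angular_sum P j w"
proof -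
  let ?T = "\<lambda>jk \<theta>. slice_term powi_family P (cis \<theta>) w jk"
  let ?c = "\<lambda>(l, k). if j = l then slice_act w (\<i> ^ k) (P k l w) else 0"
  obtain e K where e: "0 < e" "0 \<le> K"
    "\<And>x jk. x \<in> ball 1 e \<Longrightarrow> norm (slice_term powi_family P x w jk) \<le> K * index_weight jk"
    using slice_term_bound[OF holomorphic_family_powi P, of 1] w by (metis ComplI empty_iff insert_iff one_neq_zero)
  have norm_T_eq: "norm (?T (l, k) \<theta>) = norm (slice_act w (\<i> ^ k) (P k l w))" for l k \<theta>
    by (simp only: slice_term_powi_cis[OF w] norm_slice_act[OF w] norm_cis mult_1)
  have bound: "norm (slice_act w (\<i> ^ k) (P k l w)) \<le> K * index_weight (l, k)" for l k
    using e(3)[of 1 "(l, k)"] norm_T_eq[of 0 l k] e(1) by simp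
  then have norm_T: "norm (?T jk \<theta>) \<le> K * index_weight jk" for jk \<theta>
    by (cases jk) (simp only: norm_T_eq)
  have norm_c: "norm (?c jk) \<le> K * index_weight jk" for jk
    using bound e(2) index_weight_nonneg[of jk] by (cases jk) simp
  have cont: "continuous_on {0..2 * pi} (?T jk)" for jk
    by (cases jk) (simp only: slice_term_powi_cis[OF w], intro continuous_intros)
  have coeff: "fourier_coeff w j (?T jk) = ?c jk" for jk
    by (cases jk) (simp add: slice_term_powi_cis[OF w] fourier_coeff_cis[OF w])
  have trace: "circle_trace (expansion_sum P) 1 w = (\<lambda>\<theta>. \<Sum>n. ?T (index_enum n) \<theta>)"
    by (simp add: circle_trace_def[abs_def] expansion_sum_def slice_series_def cis.code)
  have "(\<lambda>n. ?c (index_enum n)) sums laurent_coeff (expansion_sum P) j w"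
    unfolding laurent_coeff_def trace coeff[symmetric]
    by (rule fourier_coeff_sums[OF w cont norm_T summable_mult[OF summable_index_weight]])
  then have "(?c has_sum laurent_coeff (expansion_sum P) j w) UNIV"
    using has_sum_index_enum[of ?c K] norm_c by blast
  then have "((\<lambda>k. ?c (j, k)) has_sum laurent_coeff (expansion_sum P) j w) UNIV"
    by (rule has_sum_fibre) simp
  then show ?thesis unfolding angular_sum_def by (simp add: has_sum_imp_sums sums_unique)
qed

section \<open>Existence of the expansion\<close>

lemma continuous_on_fourier_coeff:
  fixes T :: "real \<Rightarrow> real ^ 'n::{finite,linorder} \<Rightarrow> 'n clif"
  assumes T: "continuous_on ({0..2 * pi} \<times> sphere 0 1) (\<lambda>(\<theta>, w). T \<theta> w)"
  shows "continuous_on (sphere 0 1) (\<lambda>w. fourier_coeff w j (\<lambda>\<theta>. T \<theta> w))"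
proof -
  have "continuous_on (sphere 0 1 \<times> cbox 0 (2 * pi)) (\<lambda>(w, \<theta>). slice_act w (cis (- (real_of_int j * \<theta>))) (T \<theta> w))"
    unfolding split_def
    by (intro continuous_intros continuous_on_compose2[OF T, of _ "\<lambda>x. (snd x, fst x)", simplified]) auto
  from integral_continuous_on_param[OF this] show ?thesis
    unfolding fourier_coeff_def by (intro continuous_intros) simp
qed

lemma continuous_on_laurent_coeff:
  assumes "slice_monogenic punct f"
  shows "continuous_on (sphere 0 1) (laurent_coeff f j)"
  unfolding laurent_coeff_def[abs_def]
  using continuous_on_fourier_coeff[OF
      continuous_on_circle_trace(1)[OF slice_monogenic_continuous[OF assms] zero_less_one]] .

lemma fourier_coeff_uminus_direction:
  assumes "\<And>\<theta>. T (\<theta> + 2 * pi) = T \<theta>"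
  shows "fourier_coeff (- w) j (\<lambda>\<theta>. T (- \<theta>)) = fourier_coeff w j T"
proof -
  define G where "G \<theta> = slice_act w (cis (- (real_of_int j * \<theta>))) (T \<theta>)" for \<theta>
  have "G (\<theta> + 2 * pi) = G \<theta>" for \<theta>
  proof -
    have "cis (- (real_of_int j * (\<theta> + 2 * pi))) = cis (- (real_of_int j * \<theta>)) * cis (2 * pi * of_int (- j))"
      by (simp add: cis_mult algebra_simps)
    moreover have "cis (2 * pi * of_int (- j)) = 1" by (rule cis_multiple_2pi) simp
    ultimately show ?thesis by (simp only: G_def mult_1_right assms)
  qed
  then have "integral {- (2 * pi)..0} G = integral {0..2 * pi} G"
    using integral_shift_real_ivl[of 0 "2 * pi" "2 * pi" G] by simp
  moreover have "integral {- 0..- (- (2 * pi))} (\<lambda>\<theta>. G (- \<theta>)) = integral {- (2 * pi)..0} G"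
    by (rule Henstock_Kurzweil_Integration.integral_reflect_real)
  ultimately show ?thesis
    by (simp add: fourier_coeff_def G_def[abs_def] slice_act_uminus_direction cis_cnj)
qed

lemma laurent_coeff_even:
  assumes f: "in_S f" and w: "norm w = 1"
  shows "laurent_coeff f j (- w) = laurent_coeff f j w"
proof -
  have "f (cos \<theta>, - sin (- \<theta>), - w) = f (cos \<theta>, sin (- \<theta>), w)" for \<theta>
    using f[unfolded in_S_def, THEN conjunct2, rule_format, of "cos \<theta>" "sin (- \<theta>)" w] circle_nonzero[of 1 "- \<theta>"] w
    by simp
  then have "circle_trace f 1 (- w) = (\<lambda>\<theta>. circle_trace f 1 w (- \<theta>))"
    by (simp add: circle_trace_def fun_eq_iff)
  moreover have "circle_trace f 1 w (\<theta> + 2 * pi) = circle_trace f 1 w \<theta>" for \<theta>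
    by (simp add: circle_trace_def)
  ultimately show ?thesis
    unfolding laurent_coeff_def by (simp only: fourier_coeff_uminus_direction)
qed

lemma sphere_inner_sph_monogenic_self:
  assumes "monogenic_hom k P"
  shows "sphere_inner (sph_monogenic k P) (sph_monogenic k P) = (L2_norm_S P)\<^sup>2"
  unfolding sphere_inner_def power2_norm_eq_inner[symmetric]
    L2_norm_S_power2[OF hom_poly_continuous_on[OF monogenic_hom_imp_hom_poly[OF assms]]]
  by (rule sphere_integral_cong) (simp add: norm_sph_monogenic)

lemma rapid_family_projection:
  fixes R :: "'n::{finite,linorder} coeff_family"
  assumes f: "slice_monogenic punct f" and R: "\<And>k j. monogenic_hom k (R k j)"
    and proj: "\<And>k j. sphere_inner (laurent_coeff f j) (sph_monogenic k (R k j))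
      = sphere_inner (sph_monogenic k (R k j)) (sph_monogenic k (R k j))"
  shows "rapid_family 0 R"
  unfolding rapid_family_def rapidly_decaying_def
proof (intro conjI allI impI)
  note hom = monogenic_hom_imp_hom_poly[OF R]
  then show "hom_poly (k + 0) (R k j)" for k j by simp
  fix m :: nat and a :: real assume a: "0 < a"
  let ?n = "CARD('n)" and ?s = "\<lambda>k j. sup_norm_S (R k j)" and ?L = "\<lambda>k j. L2_norm_S (R k j)"
  define K :: real where "K = 2 * 4 ^ ?n"
  obtain B where B: "0 \<le> B" "\<And>j k Q. monogenic_hom k Q \<Longrightarrow> (real k + 1) ^ (m + 2 * ?n)
      * \<bar>sphere_inner (laurent_coeff f j) (sph_monogenic k Q)\<bar> \<le> B * a ^ nat \<bar>j\<bar> * sup_norm_S Q"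
    using laurent_coeff_decay[OF f a, of "m + 2 * ?n"] by blast
  have "?s k j \<le> (K\<^sup>2 * B + 1) * a ^ nat \<bar>j\<bar> / (real k + 1) ^ m" for k j
  proof -
    have s: "0 \<le> ?s k j" by (rule sup_norm_S_nonneg[OF hom_poly_continuous_on[OF hom]])
    have L2_bound: "(real k + 1) ^ (m + 2 * ?n) * (?L k j)\<^sup>2 \<le> B * a ^ nat \<bar>j\<bar> * ?s k j"
      using B(2)[OF R[of k j], of j] proj[of j k] sphere_inner_sph_monogenic_self[OF R[of k j]] by simp
    have "(?s k j)\<^sup>2 \<le> (K * (real k + 1) ^ ?n * ?L k j)\<^sup>2"
      using sup_norm_S_le_L2_norm_S[OF hom, of k j] s unfolding K_def by (intro power_mono) simp_all
    then have "(real k + 1) ^ m * (?s k j)\<^sup>2 \<le> (real k + 1) ^ m * (K * (real k + 1) ^ ?n * ?L k j)\<^sup>2"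
      by (rule mult_left_mono) simp
    also have "\<dots> = K\<^sup>2 * ((real k + 1) ^ (m + 2 * ?n) * (?L k j)\<^sup>2)"
      by (simp add: power_mult_distrib power_add power_mult mult_ac)
    also have "\<dots> \<le> K\<^sup>2 * (B * a ^ nat \<bar>j\<bar> * ?s k j)" using L2_bound by (rule mult_left_mono) simp
    finally have "((real k + 1) ^ m * ?s k j) * ?s k j \<le> (K\<^sup>2 * B * a ^ nat \<bar>j\<bar>) * ?s k j"
      by (simp add: power2_eq_square mult_ac)
    then have "(real k + 1) ^ m * ?s k j \<le> K\<^sup>2 * B * a ^ nat \<bar>j\<bar>"
      using s a B(1) by (cases "?s k j = 0") (auto simp: mult_le_cancel_right)
    also have "\<dots> \<le> (K\<^sup>2 * B + 1) * a ^ nat \<bar>j\<bar>" using a by (intro mult_right_mono) auto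
    finally show ?thesis by (simp add: pos_le_divide_eq mult.commute)
  qed
  moreover have "0 < K\<^sup>2 * B + 1" using B(1) by (intro add_nonneg_pos mult_nonneg_nonneg) auto
  ultimately show "\<exists>C>0. \<forall>k j. ?s k j \<le> C * a ^ nat \<bar>j\<bar> / (real k + 1) ^ m" by blast
qed

lemma laurent_coeff_projection:
  fixes f :: "'n::{finite,linorder} slice_function"
  assumes f: "slice_monogenic punct f"
  obtains R where "\<And>k j. monogenic_hom k (R k j)" "rapid_family 0 R"
    "\<And>k j Q. monogenic_hom k Q \<Longrightarrow>
      sphere_inner (laurent_coeff f j) (sph_monogenic k Q)
        = sphere_inner (sph_monogenic k (R k j)) (sph_monogenic k Q)"
proof -
  have "\<exists>P. monogenic_hom k P \<and> (\<forall>Q. monogenic_hom k Q \<longrightarrow>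
      sphere_inner (laurent_coeff f j) (sph_monogenic k Q)
        = sphere_inner (sph_monogenic k P) (sph_monogenic k Q))" for k j
    using spherical_projection[OF continuous_on_laurent_coeff[OF f]] by metis
  then obtain R where R: "\<And>k j. monogenic_hom k (R k j)"
    "\<And>k j Q. monogenic_hom k Q \<Longrightarrow>
      sphere_inner (laurent_coeff f j) (sph_monogenic k Q)
        = sphere_inner (sph_monogenic k (R k j)) (sph_monogenic k Q)"
    by metis
  have "rapid_family 0 R" by (rule rapid_family_projection[OF f R(1)]) (rule R(2)[OF R(1)])
  then show ?thesis using R by (intro that[of R]) auto
qed

lemma laurent_coeff_eq_angular_sum:
  fixes f :: "'n::{finite,linorder} slice_function"
  assumes f: "in_S f"
  obtains P where "\<And>k j. monogenic_hom k (P k j)" "rapid_family 0 P"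
    "\<And>j w. norm w = 1 \<Longrightarrow> laurent_coeff f j w = angular_sum P j w"
proof -
  have slice: "slice_monogenic punct f" using f by (simp add: in_S_def)
  note cont = continuous_on_laurent_coeff[OF slice]
  obtain R where R: "\<And>k j. monogenic_hom k (R k j)" "rapid_family 0 R"
    "\<And>k j Q. monogenic_hom k Q \<Longrightarrow>
      sphere_inner (laurent_coeff f j) (sph_monogenic k Q)
        = sphere_inner (sph_monogenic k (R k j)) (sph_monogenic k Q)"
    using laurent_coeff_projection[OF slice] by metis
  define P where "P k j = (\<lambda>x. (-1) ^ (k div 2) *\<^sub>R R k j x)" for k j
  have P: "monogenic_hom k (P k j)" for k j unfolding P_def by (rule monogenic_hom_scaleR[OF R(1)])
  have rapid: "rapid_family 0 P"
    by (rule rapid_family_same_norm[OF R(2)])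
      (use monogenic_hom_imp_hom_poly[OF P] in \<open>simp_all add: P_def power_abs\<close>)
  note cont_sum = continuous_on_angular_sum[OF rapid]
  have "laurent_coeff f j w - angular_sum P j w = 0" if "norm w = 1" for j w
  proof (rule spherical_completeness[where g="\<lambda>w. laurent_coeff f j w - angular_sum P j w", OF _ _ _ that])
    show "continuous_on (sphere 0 1) (\<lambda>w. laurent_coeff f j w - angular_sum P j w)"
      by (intro continuous_on_diff cont cont_sum)
    show "laurent_coeff f j (- w) - angular_sum P j (- w) = laurent_coeff f j w - angular_sum P j w"
        if "norm w = 1" for w
      using laurent_coeff_even[OF f that] angular_sum_even[OF rapid] by simp
    show "sphere_inner (\<lambda>w. laurent_coeff f j w - angular_sum P j w) (sph_monogenic k Q) = 0"
      if Q: "monogenic_hom k Q" for k and Q :: "(real, 'n) vec \<Rightarrow> 'n clif"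
    proof -
      have "sphere_inner (angular_sum P j) (sph_monogenic k Q)
          = sphere_inner (sph_monogenic k (R k j)) (sph_monogenic k Q)"
        unfolding sphere_inner_angular_sum[OF rapid P Q]
        by (simp add: P_def sph_monogenic_scaleR sphere_inner_scaleR_left flip: mult.assoc power_mult_distrib)
      then show ?thesis
        using R(3)[OF Q] by (simp add: sphere_inner_diff_left[OF continuous_on_sph_monogenic[OF Q] cont cont_sum])
    qed
  qed
  with P rapid show ?thesis by (intro that) auto
qed

section \<open>The expansion theorem\<close>

definition expands :: "'n::{finite,linorder} slice_function
    \<Rightarrow> 'n coeff_family \<Rightarrow> bool" where
  "expands f P \<longleftrightarrow> (\<forall>k j. monogenic_hom k (P k j)) \<and> rapid_family 0 P \<and> (\<forall>z\<in>sdom punct. f z = expansion_sum P z)"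

lemma expandsD:
  assumes "expands f P"
  shows "monogenic_hom k (P k j)" "rapid_family 0 P" "z \<in> sdom punct \<Longrightarrow> f z = expansion_sum P z"
  using assms by (auto simp: expands_def)

lemma expandsD_slice_series:
  assumes "expands f P" "(x0, p) \<noteq> (0, 0)" "norm w = 1"
  shows "f (x0, p, w) = slice_series powi_family P (Complex x0 p) w"
  using expandsD(3)[OF assms(1), of "(x0, p, w)"] assms(2,3) by (simp add: sdom_def expansion_sum_def)

lemma rapidly_decaying_norm_iff:
  fixes P :: "'n::{finite,linorder} coeff_family"
  assumes N: "N = sup_norm_S \<or> N = L2_norm_S" and P: "\<And>k j. hom_poly k (P k j)"
  shows "rapidly_decaying (\<lambda>k j. N (P k j)) \<longleftrightarrow> rapid_family 0 P"
proof -
  have "rapidly_decaying (\<lambda>k j. L2_norm_S (P k j)) \<longleftrightarrow> rapidly_decaying (\<lambda>k j. sup_norm_S (P k j))"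
  proof
    show "rapidly_decaying (\<lambda>k j. sup_norm_S (P k j))" if "rapidly_decaying (\<lambda>k j. L2_norm_S (P k j))"
      by (rule rapidly_decaying_dominated[OF that sup_norm_S_le_L2_norm_S[OF P]]) simp
    have "L2_norm_S (P k j) \<le> 1 * (real k + 1) ^ 0 * sup_norm_S (P k j)" for k j
      using L2_norm_S_le_sup_norm_S[OF hom_poly_continuous_on[OF P]] by simp
    then show "rapidly_decaying (\<lambda>k j. L2_norm_S (P k j))" if "rapidly_decaying (\<lambda>k j. sup_norm_S (P k j))"
      by (rule rapidly_decaying_dominated[OF that]) simp
  qed
  then show ?thesis using N P by (auto simp: rapid_family_def)
qed

lemma exp_term_has_sum_iff:
  assumes P: "rapid_family 0 P" and z: "(x0, p) \<noteq> (0, 0)" and w: "norm w = 1"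
  shows "(exp_term P x0 p w has_sum s) UNIV \<longleftrightarrow> s = expansion_sum P (x0, p, w)"
proof -
  have "exp_term P x0 p w = slice_term powi_family P (Complex x0 p) w"
    using exp_term_eq_slice_act[OF w z, of P] by (auto simp: fun_eq_iff slice_term_def powi_family_def)
  moreover have "Complex x0 p \<in> - {0}" using z by (auto simp: complex_eq_iff)
  from has_sum_slice_series[OF holomorphic_family_powi P this w]
  have "(slice_term powi_family P (Complex x0 p) w has_sum expansion_sum P (x0, p, w)) UNIV"
    by (simp add: expansion_sum_def)
  ultimately show ?thesis using has_sum_unique by auto
qed

lemma is_expansion_iff_expands:
  assumes N: "N = sup_norm_S \<or> N = L2_norm_S"
  shows "is_expansion N f P \<longleftrightarrow> expands f P"
proof -
  have "rapidly_decaying (\<lambda>k j. N (P k j)) \<longleftrightarrow> rapid_family 0 P" if "\<forall>k j. monogenic_hom k (P k j)"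
    using that by (intro rapidly_decaying_norm_iff[OF N] monogenic_hom_imp_hom_poly) blast
  moreover have "(\<forall>x0 p w. (x0, p) \<noteq> (0, 0) \<and> w \<in> sphere 0 1 \<longrightarrow> (exp_term P x0 p w has_sum f (x0, p, w)) UNIV)
      \<longleftrightarrow> (\<forall>z\<in>sdom punct. f z = expansion_sum P z)" if "rapid_family 0 P"
    using exp_term_has_sum_iff[OF that] by (auto simp: sdom_def)
  ultimately show ?thesis
    unfolding is_expansion_def expands_def by (intro conj_cong refl) (simp_all add: rapidly_decaying_def)
qed

lemma slice_term_powi_even:
  assumes "hom_poly k (P k j)"
  shows "slice_term powi_family P (cnj z) (- w) (j, k) = slice_term powi_family P z w (j, k)"
  using slice_act_hom_poly_even[OF assms, of w "z powi j"] by (simp add: slice_term_def powi_family_def)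

lemma expands_in_S:
  assumes f: "expands f P"
  shows "in_S f"
  unfolding in_S_def
proof (intro conjI allI impI)
  show "slice_monogenic punct f"
    by (rule expansion_sum_slice_monogenic[OF expandsD(2)[OF f] expandsD(3)[OF f]])
  fix x0 p :: real and w :: "(real, 'a) vec" assume "(x0, p) \<noteq> (0, 0) \<and> w \<in> sphere 0 1"
  then have z: "(x0, p) \<noteq> (0, 0)" "(x0, - p) \<noteq> (0, 0)" and w: "norm w = 1" "norm (- w) = 1" by auto
  have "slice_term powi_family P (Complex x0 (- p)) (- w) jk = slice_term powi_family P (Complex x0 p) w jk" for jk
    using slice_term_powi_even[of _ P _ "Complex x0 p" w] monogenic_hom_imp_hom_poly[OF expandsD(1)[OF f]]
    by (cases jk) (simp add: complex_cnj)
  then show "f (x0, - p, - w) = f (x0, p, w)"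
    using expandsD_slice_series[OF f z(1) w(1)] expandsD_slice_series[OF f z(2) w(2)]
    by (simp add: slice_series_def)
qed

lemma in_S_iff_expands: "in_S f \<longleftrightarrow> (\<exists>P. expands f P)"
proof
  assume f: "in_S f"
  then have slice: "slice_monogenic punct f" by (simp add: in_S_def)
  obtain P where P: "\<And>k j. monogenic_hom k (P k j)" "rapid_family 0 P"
    "\<And>j w. norm w = 1 \<Longrightarrow> laurent_coeff f j w = angular_sum P j w"
    using laurent_coeff_eq_angular_sum[OF f] by blast
  have "f (x0, p, w) = expansion_sum P (x0, p, w)" if "(x0, p) \<noteq> (0, 0)" "norm w = 1" for x0 p w
    using P(3) laurent_coeff_expansion_sum[OF P(2)] that
    by (intro laurent_coeff_unique[OF slice expansion_sum_slice_monogenic[OF P(2) refl]]) auto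
  then have "expands f P" using P(1,2) by (auto simp: expands_def sdom_def)
  then show "\<exists>P. expands f P" by blast
qed (elim exE, rule expands_in_S)

lemma expands_expansion_sum:
  "(\<And>k j. monogenic_hom k (P k j)) \<Longrightarrow> rapid_family 0 P \<Longrightarrow> expands (expansion_sum P) P"
  by (simp add: expands_def)

lemma laurent_coeff_expands:
  assumes f: "expands f P" and w: "norm w = 1"
  shows "laurent_coeff f j w = angular_sum P j w"
proof -
  have "circle_trace f 1 w = circle_trace (expansion_sum P) 1 w"
    using expandsD(3)[OF f circle_in_sdom_punct[OF zero_less_one w]] by (simp add: circle_trace_def fun_eq_iff)
  then show ?thesis
    using laurent_coeff_expansion_sum[OF expandsD(2)[OF f] w] by (simp add: laurent_coeff_def)
qed

lemma expands_unique:
  assumes P: "expands f P" and Q: "expands f Q"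
  shows "P = Q"
proof (intro ext)
  fix k j x
  have "P k j = Q k j"
    by (rule angular_sum_unique[OF expandsD(2,1)[OF P] expandsD(2,1)[OF Q]])
      (simp add: laurent_coeff_expands[OF P, symmetric] laurent_coeff_expands[OF Q])
  then show "P k j x = Q k j x" by simp
qed

lemma rapid_family_restrict: "rapid_family 0 P \<Longrightarrow> rapid_family 0 (\<lambda>k j. if A j then P k j else (\<lambda>x. 0))"
  by (rule rapid_family_same_norm) (auto intro: hom_poly_zero dest: rapid_family_hom_poly)

lemma rapid_family_reindex:
  "rapid_family 0 P \<Longrightarrow> (\<And>j. nat \<bar>j\<bar> \<le> nat \<bar>\<sigma> j\<bar> + l) \<Longrightarrow> rapid_family 0 (\<lambda>k j. P k (\<sigma> j))"
  using rapidly_decaying_reindex[of "\<lambda>k j. sup_norm_S (P k j)" \<sigma> l] by (simp add: rapid_family_def)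

lemma expands_coefficient_eq_0:
  assumes f: "expands f P" and zero: "\<And>w. norm w = 1 \<Longrightarrow> laurent_coeff f j w = 0"
  shows "P k j = (\<lambda>_. 0)"
proof -
  have Z: "rapid_family 0 (\<lambda>k j x. 0 :: 'a clif)"
    using rapid_family_restrict[OF expandsD(2)[OF f], of "\<lambda>_. False"] by simp
  have "angular_sum P j w = angular_sum (\<lambda>k j x. 0) j w" if "norm w = 1" for w
    using zero[OF that] laurent_coeff_expands[OF f that, of j] by (simp add: angular_sum_def slice_act.zero_right)
  then show ?thesis by (rule angular_sum_unique[OF expandsD(2,1)[OF f] Z monogenic_hom_zero])
qed

section \<open>Extension to the origin and to infinity\<close>

lemma in_S0_bounded:
  fixes f :: "'n::{finite,linorder} slice_function"
  assumes "in_S0 f"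
  obtains B where "\<And>x0 p w. (x0, p) \<noteq> (0, 0) \<Longrightarrow> norm (x0, p) \<le> 1 \<Longrightarrow> norm w = 1 \<Longrightarrow> norm (f (x0, p, w)) \<le> B"
proof -
  obtain g where g: "slice_monogenic UNIV g"
    and agree: "\<And>x0 p w. (x0, p) \<noteq> (0, 0) \<Longrightarrow> norm w = 1 \<Longrightarrow> g (x0, p, w) = f (x0, p, w)"
    using assms unfolding in_S0_def by auto
  have "continuous_on (sdom (cball 0 1)) g"
    by (rule continuous_on_subset[OF slice_monogenic_continuous[OF g]]) (auto simp: sdom_def)
  then obtain B where B: "\<And>z. z \<in> sdom (cball 0 1) \<Longrightarrow> norm (g z) \<le> B"
    using continuous_on_compact_bound[OF compact_sdom[OF compact_cball]] by blast
  have "norm (f (x0, p, w)) \<le> B" if "(x0, p) \<noteq> (0, 0)" "norm (x0, p) \<le> 1" "norm w = 1" for x0 p w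
    using B[of "(x0, p, w)"] agree[OF that(1,3)] that(2,3) by (simp add: sdom_def)
  then show ?thesis by (rule that)
qed

text \<open>Cauchy's estimate on circles shrinking to the origin.\<close>

lemma laurent_coeff_in_S0:
  assumes f: "in_S0 f" and j: "j < 0" and w: "norm w = 1"
  shows "laurent_coeff f j w = 0"
proof -
  have slice: "slice_monogenic punct f" using f by (simp add: in_S0_def in_S_def)
  obtain B where B: "\<And>x0 p w. (x0, p) \<noteq> (0, 0) \<Longrightarrow> norm (x0, p) \<le> 1 \<Longrightarrow> norm w = 1 \<Longrightarrow> norm (f (x0, p, w)) \<le> B"
    using in_S0_bounded[OF f] by blast
  have B_nonneg: "0 \<le> B" using order_trans[OF norm_ge_zero B[of 1 0 w]] w by simp
  show ?thesis
  proof (rule norm_le_mult_imp_eq_0)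
    fix r :: real assume r: "0 < r" "r \<le> 1"
    have "norm (circle_trace f r w \<theta>) \<le> B" for \<theta>
      unfolding circle_trace_def using circle_in_sphere[of r \<theta>] r by (intro B circle_nonzero w) auto
    from norm_laurent_coeff_le[OF slice w r(1) this, of j]
    have "norm (laurent_coeff f j w) \<le> B * r ^ nat (- j)"
      using j r by (simp add: power_int_def power_inverse field_simps)
    also have "\<dots> \<le> B * r ^ 1"
      using j r B_nonneg by (intro mult_left_mono power_decreasing) auto
    finally show "norm (laurent_coeff f j w) \<le> B * r" by simp
  qed
qed

lemma nonnegative_expansion_in_S0:
  assumes f: "expands f P" and zero: "\<And>k j. j < 0 \<Longrightarrow> P k j = (\<lambda>_. 0)"
  shows "in_S0 f"
proof -
  define g where "g = (\<lambda>(x0, p, w). slice_series power_family P (Complex x0 p) w)"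
  have "slice_monogenic {(x0, p). Complex x0 p \<in> UNIV} g"
    by (rule slice_series_slice_monogenic[OF open_UNIV holomorphic_family_power expandsD(2)[OF f]]) (simp add: g_def)
  moreover have "slice_term power_family P z w jk = slice_term powi_family P z w jk" for z w jk
    using zero by (cases jk) (auto simp: slice_term_def power_family_def powi_family_def power_int_def
        slice_act.zero_right)
  then have "g (x0, p, w) = f (x0, p, w)" if "(x0, p) \<noteq> (0, 0)" "norm w = 1" for x0 p w
    using expandsD_slice_series[OF f that] by (simp add: g_def slice_series_def)
  ultimately show ?thesis unfolding in_S0_def using expands_in_S[OF f] by auto
qed

lemma expands_S0_iff:
  assumes f: "expands f P"
  shows "in_S0 f \<longleftrightarrow> (\<forall>k j. j < 0 \<longrightarrow> P k j = (\<lambda>_. 0))"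
  using expands_coefficient_eq_0[OF f] laurent_coeff_in_S0 nonnegative_expansion_in_S0[OF f] by blast

definition inversion :: "(real \<times> real \<times> (real ^ 'n) \<Rightarrow> 'a) \<Rightarrow> real \<times> real \<times> (real, 'n) vec \<Rightarrow> 'a" where
  "inversion f = (\<lambda>(x0, p, w). f (x0 / (x0\<^sup>2 + p\<^sup>2), - p / (x0\<^sup>2 + p\<^sup>2), w))"

lemma inverse_Complex: "inverse (Complex x0 p) = Complex (x0 / (x0\<^sup>2 + p\<^sup>2)) (- p / (x0\<^sup>2 + p\<^sup>2))"
  by (simp add: complex_eq_iff)

lemma inversion_nonzero: "(x0, p) \<noteq> (0, 0) \<Longrightarrow> (x0 / (x0\<^sup>2 + p\<^sup>2), - p / (x0\<^sup>2 + p\<^sup>2)) \<noteq> (0::real, 0)"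
  by (auto simp: sum_power2_eq_zero_iff)

lemma I2_eq_slice_act: "I2 f (x0, p, w) = slice_act w (inverse (Complex x0 p)) (inversion f (x0, p, w))"
  unfolding inverse_Complex I2_def slice_act_def inversion_def
  by (simp add: cl_mult.scaleR_left cl_mult.diff_left scaleR_diff_right)

lemma slice_series_reindex:
  assumes P: "rapid_family 0 P" "rapid_family 0 (\<lambda>k j. P k (\<sigma> j))" and \<sigma>: "bij \<sigma>" and w: "norm w = 1"
    and nonzero: "u \<noteq> 0" "z \<noteq> 0" and scaling: "\<And>j. c * u powi \<sigma> j = z powi j"
  shows "slice_act w c (slice_series powi_family P u w) = slice_series powi_family (\<lambda>k j. P k (\<sigma> j)) z w"
proof -
  have "(slice_term powi_family P u w has_sum slice_series powi_family P u w) UNIV"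
    by (rule has_sum_slice_series[OF holomorphic_family_powi P(1) _ w]) (simp add: nonzero)
  from has_sum_bounded_linear[OF slice_act.bounded_linear_right this]
  have "((\<lambda>jk. slice_act w c (slice_term powi_family P u w jk))
      has_sum slice_act w c (slice_series powi_family P u w)) UNIV"
    by (simp add: o_def)
  moreover have "bij (map_prod \<sigma> (id :: nat \<Rightarrow> nat))"
    using \<sigma> unfolding bij_def by (intro conjI prod.inj_map map_prod_surj) auto
  ultimately have "((\<lambda>jk. slice_act w c (slice_term powi_family P u w (map_prod \<sigma> id jk)))
      has_sum slice_act w c (slice_series powi_family P u w)) UNIV"
    by (subst has_sum_reindex_bij_betw)
  moreover have "slice_act w c (slice_term powi_family P u w (map_prod \<sigma> id jk))
      = slice_term powi_family (\<lambda>k j. P k (\<sigma> j)) z w jk" for jk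
    by (cases jk) (simp add: slice_term_def powi_family_def scaling mult.assoc[symmetric] flip: slice_act_mult[OF w])
  ultimately have "(slice_term powi_family (\<lambda>k j. P k (\<sigma> j)) z w
      has_sum slice_act w c (slice_series powi_family P u w)) UNIV"
    by simp
  then show ?thesis
    by (rule has_sum_unique) (rule has_sum_slice_series[OF holomorphic_family_powi P(2) _ w], simp add: nonzero)
qed

lemma expands_reindex:
  fixes f g :: "'n::{finite,linorder} slice_function"
  assumes g: "expands g P" and \<sigma>: "bij \<sigma>" "\<And>j. nat \<bar>j\<bar> \<le> nat \<bar>\<sigma> j\<bar> + l"
    and scaling: "\<And>z j. z \<noteq> 0 \<Longrightarrow> c z * inverse z powi \<sigma> j = z powi j"
    and f: "\<And>x0 p w. (x0, p, w) \<in> sdom punct \<Longrightarrow> f (x0, p, w) = slice_act w (c (Complex x0 p)) (inversion g (x0, p, w))"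
  shows "expands f (\<lambda>k j. P k (\<sigma> j))"
  unfolding expands_def
proof (intro conjI allI ballI)
  show "monogenic_hom k (P k (\<sigma> j))" for k j by (rule expandsD(1)[OF g])
  show rapid: "rapid_family 0 (\<lambda>k j. P k (\<sigma> j))" by (rule rapid_family_reindex[OF expandsD(2)[OF g] \<sigma>(2)])
  fix z :: "real \<times> real \<times> (real, 'n) vec" assume z: "z \<in> sdom punct"
  obtain x0 p w where z_eq: "z = (x0, p, w)" by (cases z)
  have nonzero: "(x0, p) \<noteq> (0, 0)" and w: "norm w = 1" using z by (auto simp: z_eq sdom_def)
  then have complex_nonzero: "Complex x0 p \<noteq> 0" by (auto simp: complex_eq_iff)
  have "inversion g z = slice_series powi_family P (inverse (Complex x0 p)) w"
    using expandsD_slice_series[OF g inversion_nonzero[OF nonzero] w]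
    by (simp add: inversion_def z_eq inverse_Complex)
  then have "f z = slice_act w (c (Complex x0 p)) (slice_series powi_family P (inverse (Complex x0 p)) w)"
    using f z by (simp add: z_eq)
  also have "\<dots> = slice_series powi_family (\<lambda>k j. P k (\<sigma> j)) (Complex x0 p) w"
    using complex_nonzero scaling by (intro slice_series_reindex expandsD(2)[OF g] rapid \<sigma>(1) w) auto
  finally show "f z = expansion_sum (\<lambda>k j. P k (\<sigma> j)) z" by (simp add: expansion_sum_def z_eq)
qed

lemma expands_inversion: "expands f P \<Longrightarrow> expands (inversion f) (\<lambda>k j. P k (- j))"
  by (rule expands_reindex[where c="\<lambda>_. 1" and l=0])
    (auto simp: power_int_inverse power_int_minus intro: bij_uminus)

lemma expands_I2:
  fixes f g :: "'n::{finite,linorder} slice_function"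
  assumes "expands g P" "\<And>z. z \<in> sdom punct \<Longrightarrow> f z = I2 g z"
  shows "expands f (\<lambda>k j. P k (- 1 - j))"
proof (rule expands_reindex[OF assms(1), where c=inverse and l=1])
  show "bij (\<lambda>j::int. - 1 - j)" by (rule o_bij[of "\<lambda>j. - 1 - j"]) (auto simp: fun_eq_iff)
  show "inverse z * inverse z powi (- 1 - j) = z powi j" if "z \<noteq> 0" for z :: complex and j
    using that power_int_add_1'[of "inverse z" "- 1 - j"] by (simp add: power_int_inverse power_int_minus)
qed (use assms(2) in \<open>auto simp: I2_eq_slice_act\<close>)

lemma negative_expansion_eq_I2:
  fixes f :: "'n::{finite,linorder} slice_function"
  assumes f: "expands f P" and zero: "\<And>k j. 0 \<le> j \<Longrightarrow> P k j = (\<lambda>_. 0)"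
  obtains g where "in_S0 g" "\<And>z. z \<in> sdom punct \<Longrightarrow> f z = I2 g z"
proof -
  define Q where "Q k j = P k (- 1 - j)" for k j
  have "rapid_family 0 Q"
    unfolding Q_def[abs_def] by (rule rapid_family_reindex[OF expandsD(2)[OF f], of _ 1]) simp
  then have Q: "expands (expansion_sum Q) Q"
    by (intro expands_expansion_sum) (simp add: Q_def expandsD(1)[OF f])
  have "in_S0 (expansion_sum Q)"
    by (rule nonnegative_expansion_in_S0[OF Q]) (simp add: Q_def zero)
  moreover have "expands (I2 (expansion_sum Q)) P"
    using expands_I2[OF Q refl] by (simp add: Q_def)
  then have "f z = I2 (expansion_sum Q) z" if "z \<in> sdom punct" for z
    using expandsD(3)[OF f that] expandsD(3)[OF _ that] by metis
  ultimately show ?thesis by (rule that)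
qed

lemma I2_vanishes_at_infinity:
  fixes g :: "'n::{finite,linorder} slice_function"
  assumes g: "in_S0 g" and e: "0 < \<epsilon>"
  shows "\<exists>R>0. \<forall>x0 p w. R \<le> x0\<^sup>2 + p\<^sup>2 \<and> w \<in> sphere 0 1 \<longrightarrow> norm (I2 g (x0, p, w)) < \<epsilon>"
proof -
  obtain B where B: "\<And>x0 p w. (x0, p) \<noteq> (0, 0) \<Longrightarrow> norm (x0, p) \<le> 1 \<Longrightarrow> norm w = 1 \<Longrightarrow> norm (g (x0, p, w)) \<le> B"
    using in_S0_bounded[OF g] by blast
  define T where "T = max 1 (\<bar>B\<bar> / \<epsilon> + 1)"
  have "norm (I2 g (x0, p, w)) < \<epsilon>" if R: "T\<^sup>2 \<le> x0\<^sup>2 + p\<^sup>2" and w: "norm w = 1" for x0 p w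
  proof -
    define r where "r = norm (Complex x0 p)"
    have "T\<^sup>2 \<le> r\<^sup>2" using R by (simp add: r_def cmod_power2)
    then have r: "T \<le> r" by (rule power2_le_imp_le) (simp add: r_def)
    then have r_ge_1: "1 \<le> r" by (simp add: T_def)
    then have nonzero: "(x0, p) \<noteq> (0, 0)" by (auto simp: r_def cmod_def)
    have "norm (x0 / (x0\<^sup>2 + p\<^sup>2), - p / (x0\<^sup>2 + p\<^sup>2)) = norm (inverse (Complex x0 p))"
      by (simp add: inverse_Complex norm_Pair cmod_def power_divide)
    also have "\<dots> \<le> 1" using r_ge_1 by (simp add: norm_inverse r_def inverse_le_1_iff)
    finally have "norm (inversion g (x0, p, w)) \<le> B"
      unfolding inversion_def prod.case by (intro B inversion_nonzero nonzero w)
    then have "norm (I2 g (x0, p, w)) \<le> inverse r * \<bar>B\<bar>"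
      using r_ge_1 by (auto simp: I2_eq_slice_act norm_slice_act[OF w] norm_inverse r_def intro!: mult_left_mono)
    also have "\<bar>B\<bar> / \<epsilon> < r" using r by (simp add: T_def)
    then have "inverse r * \<bar>B\<bar> < \<epsilon>" using e r_ge_1 by (simp add: field_simps)
    finally show ?thesis .
  qed
  moreover have "0 < T\<^sup>2" by (simp add: T_def)
  ultimately show ?thesis by (intro exI[of _ "T\<^sup>2"]) auto
qed

lemma laurent_coeff_in_Sinf:
  assumes f: "in_Sinf f" and j: "0 \<le> j" and w: "norm w = 1"
  shows "laurent_coeff f j w = 0"
proof (rule norm_le_mult_imp_eq_0)
  fix \<epsilon> :: real assume "0 < \<epsilon>"
  then have "\<exists>R. \<forall>x0 p w. x0\<^sup>2 + p\<^sup>2 \<ge> R \<and> w \<in> sphere 0 1 \<longrightarrow> norm (f (x0, p, w)) < \<epsilon>"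
    using f unfolding in_Sinf_def by blast
  then obtain R where R: "\<And>x0 p. R \<le> x0\<^sup>2 + p\<^sup>2 \<Longrightarrow> norm (f (x0, p, w)) < \<epsilon>"
    using w by auto
  define r where "r = max 1 R"
  have r: "1 \<le> r" "R \<le> r" by (auto simp: r_def)
  then have "R \<le> r\<^sup>2" using power_increasing[of 1 2 r] by simp
  moreover have "(r * cos \<theta>)\<^sup>2 + (r * sin \<theta>)\<^sup>2 = r\<^sup>2" for \<theta>
    by (simp add: power_mult_distrib flip: distrib_left)
  ultimately have "norm (circle_trace f r w \<theta>) \<le> \<epsilon>" for \<theta>
    using R[of "r * cos \<theta>" "r * sin \<theta>"] by (simp add: circle_trace_def)
  moreover have "slice_monogenic punct f" using f by (simp add: in_Sinf_def in_S_def)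
  ultimately have "r powi j * norm (laurent_coeff f j w) \<le> \<epsilon>"
    using r(1) by (intro norm_laurent_coeff_le w) auto
  moreover have "1 \<le> r powi j" using j r by (simp add: power_int_def one_le_power)
  then have "1 * norm (laurent_coeff f j w) \<le> r powi j * norm (laurent_coeff f j w)" by (rule mult_right_mono) simp
  ultimately show "norm (laurent_coeff f j w) \<le> 1 * \<epsilon>" by simp
qed

lemma negative_expansion_in_Sinf:
  fixes f :: "'n::{finite,linorder} slice_function"
  assumes f: "expands f P" and zero: "\<And>k j. 0 \<le> j \<Longrightarrow> P k j = (\<lambda>_. 0)"
  shows "in_Sinf f"
proof -
  have "in_S0 (inversion f)"
    by (rule nonnegative_expansion_in_S0[OF expands_inversion[OF f]]) (simp add: zero)
  moreover obtain g where g: "in_S0 g" "\<And>z. z \<in> sdom punct \<Longrightarrow> f z = I2 g z"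
    using negative_expansion_eq_I2[OF f zero] by blast
  have "\<exists>R. \<forall>x0 p w. R \<le> x0\<^sup>2 + p\<^sup>2 \<and> w \<in> sphere 0 1 \<longrightarrow> norm (f (x0, p, w)) < \<epsilon>" if \<epsilon>: "0 < \<epsilon>" for \<epsilon>
  proof -
    obtain R where R: "0 < R" "\<And>x0 p w. R \<le> x0\<^sup>2 + p\<^sup>2 \<Longrightarrow> w \<in> sphere 0 1 \<Longrightarrow> norm (I2 g (x0, p, w)) < \<epsilon>"
      using I2_vanishes_at_infinity[OF g(1) \<epsilon>] by blast
    have "norm (f (x0, p, w)) < \<epsilon>" if "R \<le> x0\<^sup>2 + p\<^sup>2" "w \<in> sphere 0 1" for x0 p w
    proof -
      have "(x0, p, w) \<in> sdom punct" using that R(1) by (auto simp: sdom_def)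
      then show ?thesis using R(2)[OF that] g(2) by simp
    qed
    then show ?thesis by blast
  qed
  ultimately show ?thesis
    unfolding in_Sinf_def in_S0_def using expands_in_S[OF f] by (auto simp: inversion_def)
qed

lemma expands_Sinf_iff:
  assumes f: "expands f P"
  shows "in_Sinf f \<longleftrightarrow> (\<forall>k j. 0 \<le> j \<longrightarrow> P k j = (\<lambda>_. 0))"
  using expands_coefficient_eq_0[OF f] laurent_coeff_in_Sinf negative_expansion_in_Sinf[OF f] by blast

lemma expansion_sum_add:
  assumes P: "rapid_family 0 P" and Q: "rapid_family 0 Q" and z: "z \<in> sdom punct"
  shows "expansion_sum (\<lambda>k j x. P k j x + Q k j x) z = expansion_sum P z + expansion_sum Q z"
proof -
  obtain x0 p w where z_eq: "z = (x0, p, w)" by (cases z)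
  have dom: "Complex x0 p \<in> - {0}" "norm w = 1" using z by (auto simp: z_eq sdom_def complex_eq_iff)
  have "slice_term powi_family (\<lambda>k j x. P k j x + Q k j x) \<zeta> w jk
      = slice_term powi_family P \<zeta> w jk + slice_term powi_family Q \<zeta> w jk" for \<zeta> jk
    by (cases jk) (simp add: slice_term_def slice_act.add_right)
  then show ?thesis
    by (simp add: expansion_sum_def slice_series_def z_eq suminf_add
        summable_slice_term[OF holomorphic_family_powi P dom] summable_slice_term[OF holomorphic_family_powi Q dom])
qed

lemma in_S_split:
  assumes "in_S f"
  shows "\<exists>g h. in_S0 g \<and> in_Sinf h \<and> (\<forall>z\<in>sdom punct. f z = g z + h z)"
proof -
  obtain P where f: "expands f P" using assms in_S_iff_expands by blast
  define P0 where "P0 k j = (if 0 \<le> j then P k j else (\<lambda>x. 0))" for k j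
  define P1 where "P1 k j = (if j < 0 then P k j else (\<lambda>x. 0))" for k j
  have rapid: "rapid_family 0 P0" "rapid_family 0 P1"
    unfolding P0_def[abs_def] P1_def[abs_def] by (rule rapid_family_restrict[OF expandsD(2)[OF f]])+
  have "in_S0 (expansion_sum P0)"
    by (rule nonnegative_expansion_in_S0[OF expands_expansion_sum[OF _ rapid(1)]])
      (auto simp: P0_def monogenic_hom_zero expandsD(1)[OF f])
  moreover have "in_Sinf (expansion_sum P1)"
    by (rule negative_expansion_in_Sinf[OF expands_expansion_sum[OF _ rapid(2)]])
      (auto simp: P1_def monogenic_hom_zero expandsD(1)[OF f])
  moreover have "P = (\<lambda>k j x. P0 k j x + P1 k j x)" by (auto simp: fun_eq_iff P0_def P1_def)
  then have "f z = expansion_sum P0 z + expansion_sum P1 z" if "z \<in> sdom punct" for z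
    using expandsD(3)[OF f that] expansion_sum_add[OF rapid that] by metis
  ultimately show ?thesis by blast
qed

lemma S0_Sinf_trivial:
  assumes g: "in_S0 g" "in_Sinf g" and z: "z \<in> sdom punct"
  shows "g z = 0"
proof -
  obtain P where P: "expands g P" using g(1) in_S_iff_expands[of g] unfolding in_S0_def by blast
  have "P k j = (\<lambda>_. 0)" for k j
    using g expands_S0_iff[OF P] expands_Sinf_iff[OF P] by (cases "j < 0") auto
  then show ?thesis
    using expandsD(3)[OF P z]
    by (simp add: expansion_sum_def slice_series_def slice_term_def split_def slice_act.zero_right)
qed

lemma Sinf_iff_I2:
  fixes f :: "'n::{finite,linorder} slice_function"
  shows "in_Sinf f \<longleftrightarrow> (\<exists>g. in_S0 g \<and> (\<forall>z\<in>sdom punct. f z = I2 g z))"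
proof
  assume f: "in_Sinf f"
  then obtain P where P: "expands f P" using in_S_iff_expands[of f] unfolding in_Sinf_def by blast
  obtain g where "in_S0 g" "\<And>z. z \<in> sdom punct \<Longrightarrow> f z = I2 g z"
    using negative_expansion_eq_I2[OF P] f expands_Sinf_iff[OF P] by blast
  then show "\<exists>g. in_S0 g \<and> (\<forall>z\<in>sdom punct. f z = I2 g z)" by blast
next
  assume "\<exists>g. in_S0 g \<and> (\<forall>z\<in>sdom punct. f z = I2 g z)"
  then obtain g where g: "in_S0 g" "\<And>z. z \<in> sdom punct \<Longrightarrow> f z = I2 g z" by blast
  obtain P where P: "expands g P" using g(1) in_S_iff_expands[of g] unfolding in_S0_def by blast
  have "P k j = (\<lambda>_. 0)" if "j < 0" for k j using g(1) expands_S0_iff[OF P] that by auto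
  then show "in_Sinf f" by (intro negative_expansion_in_Sinf[OF expands_I2[OF P g(2)]]) auto
qed

theorem theorem3p5:
  fixes N :: "((real ^ ('n::{finite,linorder})) \<Rightarrow> 'n clif) \<Rightarrow> real"
  assumes "N = sup_norm_S \<or> N = L2_norm_S"
  shows "(\<forall>f. in_S f \<longleftrightarrow> (\<exists>P. is_expansion N f P))
    \<and> (\<forall>f P Q. is_expansion N f P \<and> is_expansion N f Q \<longrightarrow> P = Q)
    \<and> (\<forall>f P. is_expansion N f P \<longrightarrow> (in_S0 f \<longleftrightarrow> (\<forall>k j. j < 0 \<longrightarrow> P k j = (\<lambda>_. 0))))
    \<and> (\<forall>f P. is_expansion N f P \<longrightarrow> (in_Sinf f \<longleftrightarrow> (\<forall>k j. 0 \<le> j \<longrightarrow> P k j = (\<lambda>_. 0))))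
    \<and> (\<forall>f :: real \<times> real \<times> (real, 'n) vec \<Rightarrow> 'n clif. in_S f \<longrightarrow> (\<exists>g h. in_S0 g \<and> in_Sinf h \<and>
           (\<forall>z\<in>sdom punct. f z = g z + h z)))
    \<and> (\<forall>g :: real \<times> real \<times> (real, 'n) vec \<Rightarrow> 'n clif. in_S0 g \<and> in_Sinf g \<longrightarrow> (\<forall>z\<in>sdom punct. g z = 0))
    \<and> (\<forall>f :: real \<times> real \<times> (real, 'n) vec \<Rightarrow> 'n clif. in_Sinf f \<longleftrightarrow> (\<exists>g. in_S0 g \<and> (\<forall>z\<in>sdom punct. f z = I2 g z)))"
  unfolding is_expansion_iff_expands[OF assms]
proof (intro conjI allI impI ballI; (elim conjE)?)
  fix f g :: "real \<times> real \<times> (real, 'n) vec \<Rightarrow> 'n clif" and P Q z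
  show "in_S f \<longleftrightarrow> (\<exists>P. expands f P)" by (rule in_S_iff_expands)
  show "P = Q" if "expands f P" "expands f Q" using that by (rule expands_unique)
  show "in_S0 f \<longleftrightarrow> (\<forall>k j. j < 0 \<longrightarrow> P k j = (\<lambda>_. 0))" if "expands f P"
    using that by (rule expands_S0_iff)
  show "in_Sinf f \<longleftrightarrow> (\<forall>k j. 0 \<le> j \<longrightarrow> P k j = (\<lambda>_. 0))" if "expands f P"
    using that by (rule expands_Sinf_iff)
  show "\<exists>g h. in_S0 g \<and> in_Sinf h \<and> (\<forall>z\<in>sdom punct. f z = g z + h z)" if "in_S f"
    using that by (rule in_S_split)
  show "g z = 0" if "in_S0 g" "in_Sinf g" "z \<in> sdom punct" using that by (rule S0_Sinf_trivial)
  show "in_Sinf f \<longleftrightarrow> (\<exists>g. in_S0 g \<and> (\<forall>z\<in>sdom punct. f z = I2 g z))" by (rule Sinf_iff_I2)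
qed

end
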